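(* Let $M$ be a smooth manifold. Let $d$ be a distance on $M$ having the following property: there exists a sequence $(F_i)_i$ of Finsler metrics on $M$ such that $d_{F_i}(x,y)\nearrow d(x,y)$ (monotonically increasing convergence) for every $x,y\in M$. Then for any $f\in\mathrm{LIP}_d(M)$ there exists a sequence $(f_n)_n\subseteq C^\infty(M)\cap\mathrm{LIP}_d(M)$ such that $$\sup_{n\in\mathbb{N}}\mathrm{LIP}_d(f_n)\le\mathrm{LIP}_d(f),\qquad f_n\to f\ \text{ uniformly on compact sets.}$$
   Context: For a metric space $(X,d)$, $\mathrm{LIP}_d(X)$ is the family of real-valued $d$-Lipschitz functions on $X$, and for $f\in\mathrm{LIP}_d(X)$, $\mathrm{LIP}_d(f)\in[0,+\infty)$ denotes its global Lipschitz constant. A Finsler metric on a smooth manifold $M$ is a map $F:TM\to[0,+\infty)$ that is continuous on $TM$, smooth on $TM\setminus\{0\}$ (the complement of the zero section), absolutely $1$-homogeneous on each tangent space ($F(x,\lambda v)=|\lambda|F(x,v)$), and such that the Hessian matrix of $F^2(x,\cdot)$ is positive definite at every $v\in T_xM\setminus\{0\}$, for every $x\in M$. The induced length distance is $d_F(x,y):=\inf_\gamma\int_0^1F(\gamma(t),\dot\gamma(t))\,\mathrm{d}t$, the infimum being over Lipschitz curves $\gamma:[0,1]\to M$ joining $x$ and $y$.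
   Formalization: The distance d is additionally assumed to induce the manifold topology of M; without this the claim fails (a comb distance on the plane is a limit of Riemannian ones), and for a given d the claim for all f forces it. *)

theory Defs
  imports "HOL-Analysis.Analysis"
begin

section \<open>Smooth maps on open sets of a Euclidean space\<close>

text \<open>Meant for open \<open>S\<close>. Since the domain is finite-dimensional, continuity of all directional
  derivatives \<open>x \<mapsto> Df(x)v\<close> of a given order is continuity of the full derivative of that order.\<close>

primrec C_k_on :: "nat \<Rightarrow> ('e::euclidean_space \<Rightarrow> 'b::real_normed_vector) \<Rightarrow> 'e set \<Rightarrow> bool" where
  "C_k_on 0 f S \<longleftrightarrow> continuous_on S f"
| "C_k_on (Suc k) f S \<longleftrightarrow>
     (\<forall>x\<in>S. f differentiable (at x)) \<and> (\<forall>v. C_k_on k (\<lambda>x. frechet_derivative f (at x) v) S)"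

definition smooth_on :: "('e::euclidean_space \<Rightarrow> 'b::real_normed_vector) \<Rightarrow> 'e set \<Rightarrow> bool" where
  "smooth_on f S \<longleftrightarrow> (\<forall>k. C_k_on k f S)"

definition hessian :: "('e::euclidean_space \<Rightarrow> real) \<Rightarrow> 'e \<Rightarrow> 'e \<Rightarrow> 'e \<Rightarrow> real" where
  "hessian g w u u' = frechet_derivative (\<lambda>z. frechet_derivative g (at z) u) (at w) u'"

definition hessian_pos_def :: "('e::euclidean_space \<Rightarrow> real) \<Rightarrow> 'e \<Rightarrow> bool" where
  "hessian_pos_def g w \<longleftrightarrow> (\<forall>u. u \<noteq> 0 \<longrightarrow> hessian g w u u > 0)"

section \<open>Smooth manifolds\<close>

text \<open>The manifold \<open>M\<close> is a whole type \<open>'a\<close>, Hausdorff and second countable by its type classes, with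
  a smooth structure given by a (not necessarily maximal) smooth atlas. A chart is a pair of a
  domain and a coordinate map, whose values outside the domain are irrelevant.\<close>

type_synonym ('a, 'e) chart = "'a set \<times> ('a \<Rightarrow> 'e)"

abbreviation dom_chart :: "('a, 'e) chart \<Rightarrow> 'a set" where
  "dom_chart c \<equiv> fst c"

abbreviation coord :: "('a, 'e) chart \<Rightarrow> 'a \<Rightarrow> 'e" where
  "coord c \<equiv> snd c"

definition inv_coord :: "('a, 'e) chart \<Rightarrow> 'e \<Rightarrow> 'a" where
  "inv_coord c = inv_into (dom_chart c) (coord c)"

definition img_chart :: "('a, 'e) chart \<Rightarrow> 'e set" where
  "img_chart c = coord c ` dom_chart c"

definition is_chart :: "('a::topological_space, 'e::euclidean_space) chart \<Rightarrow> bool" where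
  "is_chart c \<longleftrightarrow> open (dom_chart c) \<and> open (img_chart c) \<and>
     homeomorphism (dom_chart c) (img_chart c) (coord c) (inv_coord c)"

definition transition :: "('a, 'e) chart \<Rightarrow> ('a, 'e) chart \<Rightarrow> 'e \<Rightarrow> 'e" where
  "transition c c' = coord c' \<circ> inv_coord c"

definition smooth_atlas ::
  "('a::{t2_space, second_countable_topology}, 'e::euclidean_space) chart set \<Rightarrow> bool" where
  "smooth_atlas A \<longleftrightarrow>
     (\<forall>c\<in>A. is_chart c) \<and>
     (\<Union>c\<in>A. dom_chart c) = UNIV \<and>
     (\<forall>c\<in>A. \<forall>c'\<in>A. smooth_on (transition c c') (coord c ` (dom_chart c \<inter> dom_chart c')))"

definition charts_at :: "('a, 'e) chart set \<Rightarrow> 'a \<Rightarrow> ('a, 'e) chart set" where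
  "charts_at A x = {c \<in> A. x \<in> dom_chart c}"

definition smooth_functions ::
  "('a, 'e::euclidean_space) chart set \<Rightarrow> ('a \<Rightarrow> real) set" where
  "smooth_functions A = {f. \<forall>c\<in>A. smooth_on (f \<circ> inv_coord c) (img_chart c)}"

section \<open>Tangent vectors\<close>

text \<open>A tangent vector at \<open>x\<close> is the family of its coordinates in all charts of the atlas around \<open>x\<close>,
  related by the differentials of the transition maps; it is zero at all other charts, so
  that equality of tangent vectors is equality of functions.\<close>

type_synonym ('a, 'e) tvec = "('a, 'e) chart \<Rightarrow> 'e"

definition tangent_space ::
  "('a, 'e::euclidean_space) chart set \<Rightarrow> 'a \<Rightarrow> ('a, 'e) tvec set" where
  "tangent_space A x = {v.
     (\<forall>c. c \<notin> charts_at A x \<longrightarrow> v c = 0) \<and>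
     (\<forall>c\<in>charts_at A x. \<forall>c'\<in>charts_at A x.
        v c' = frechet_derivative (transition c c') (at (coord c x)) (v c))}"

text \<open>The tangent vector at \<open>x\<close> with coordinates \<open>w\<close> in the chart \<open>c\<close>.\<close>

definition tvec_of ::
  "('a, 'e::euclidean_space) chart set \<Rightarrow> ('a, 'e) chart \<Rightarrow> 'a \<Rightarrow> 'e \<Rightarrow> ('a, 'e) tvec" where
  "tvec_of A c x w = (\<lambda>c'. if c' \<in> charts_at A x
     then frechet_derivative (transition c c') (at (coord c x)) w else 0)"

section \<open>Finsler metrics and their distances\<close>

text \<open>Only the values of \<open>F x\<close> on \<open>tangent_space A x\<close> matter. \<open>local_expr A F c\<close> is \<open>F\<close> read in the
  chart of the tangent bundle induced by \<open>c\<close>, whose image is \<open>img_chart c \<times> UNIV\<close>; the zero section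
  corresponds to \<open>img_chart c \<times> {0}\<close>.\<close>

definition local_expr ::
  "('a, 'e::euclidean_space) chart set \<Rightarrow> ('a \<Rightarrow> ('a, 'e) tvec \<Rightarrow> real) \<Rightarrow> ('a, 'e) chart
     \<Rightarrow> 'e \<times> 'e \<Rightarrow> real" where
  "local_expr A F c = (\<lambda>(p, w). F (inv_coord c p) (tvec_of A c (inv_coord c p) w))"

definition finsler_metric ::
  "('a, 'e::euclidean_space) chart set \<Rightarrow> ('a \<Rightarrow> ('a, 'e) tvec \<Rightarrow> real) \<Rightarrow> bool" where
  "finsler_metric A F \<longleftrightarrow>
     (\<forall>x. \<forall>v\<in>tangent_space A x. F x v \<ge> 0) \<and>
     (\<forall>c\<in>A. continuous_on (img_chart c \<times> UNIV) (local_expr A F c)) \<and>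
     (\<forall>c\<in>A. smooth_on (local_expr A F c) (img_chart c \<times> (UNIV - {0}))) \<and>
     (\<forall>x. \<forall>v\<in>tangent_space A x. \<forall>r::real. F x (\<lambda>c. r *\<^sub>R v c) = \<bar>r\<bar> * F x v) \<and>
     (\<forall>x. \<forall>c\<in>charts_at A x. \<forall>w. w \<noteq> 0 \<longrightarrow>
        hessian_pos_def (\<lambda>w. (F x (tvec_of A c x w))\<^sup>2) w)"

text \<open>Lipschitz continuity of a curve in a manifold is meant in charts; on the compact interval
  \<open>{0..1}\<close> this is the same as being Lipschitz for any Riemannian distance.\<close>

definition lipschitz_curve ::
  "('a, 'e::euclidean_space) chart set \<Rightarrow> (real \<Rightarrow> 'a) \<Rightarrow> bool" where
  "lipschitz_curve A \<gamma> \<longleftrightarrow> (\<forall>t\<in>{0..1}. \<exists>c\<in>charts_at A (\<gamma> t). \<exists>e>0. \<exists>L.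
     \<gamma> ` ({0..1} \<inter> ball t e) \<subseteq> dom_chart c \<and>
     L-lipschitz_on ({0..1} \<inter> ball t e) (coord c \<circ> \<gamma>))"

text \<open>For a Lipschitz curve this is a tangent vector at \<open>\<gamma> t\<close> for almost every \<open>t\<close>.\<close>

definition velocity ::
  "('a, 'e::euclidean_space) chart set \<Rightarrow> (real \<Rightarrow> 'a) \<Rightarrow> real \<Rightarrow> ('a, 'e) tvec" where
  "velocity A \<gamma> t = (\<lambda>c. if c \<in> charts_at A (\<gamma> t)
     then vector_derivative (coord c \<circ> \<gamma>) (at t within {0..1}) else 0)"

definition finsler_length ::
  "('a, 'e::euclidean_space) chart set \<Rightarrow> ('a \<Rightarrow> ('a, 'e) tvec \<Rightarrow> real) \<Rightarrow> (real \<Rightarrow> 'a) \<Rightarrow> ennreal" where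
  "finsler_length A F \<gamma> = (\<integral>\<^sup>+t\<in>{0..1}. ennreal (F (\<gamma> t) (velocity A \<gamma> t)) \<partial>lebesgue)"

text \<open>The distance of two points not joined by a Lipschitz curve is \<open>\<infinity>\<close>.\<close>

definition finsler_dist ::
  "('a, 'e::euclidean_space) chart set \<Rightarrow> ('a \<Rightarrow> ('a, 'e) tvec \<Rightarrow> real) \<Rightarrow> 'a \<Rightarrow> 'a \<Rightarrow> ennreal" where
  "finsler_dist A F x y =
     (INF \<gamma>\<in>{\<gamma>. lipschitz_curve A \<gamma> \<and> \<gamma> 0 = x \<and> \<gamma> 1 = y}. finsler_length A F \<gamma>)"

section \<open>Lipschitz functions for an explicit distance\<close>

definition LIP :: "('a \<Rightarrow> 'a \<Rightarrow> real) \<Rightarrow> ('a \<Rightarrow> real) set" where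
  "LIP d = {f. Lipschitz_continuous_map (metric (UNIV, d)) euclidean_metric f}"

text \<open>Extended-valued, so that suprema over families of functions are always meaningful; it is
  finite on \<open>LIP d\<close>, and \<open>0\<close> on a one-point space.\<close>

definition lip_const :: "('a \<Rightarrow> 'a \<Rightarrow> real) \<Rightarrow> ('a \<Rightarrow> real) \<Rightarrow> ennreal" where
  "lip_const d f = (SUP (x, y)\<in>{(x, y). x \<noteq> y}. ennreal (\<bar>f x - f y\<bar> / d x y))"

end

theory Submission
  imports Defs
begin

text \<open>On a finite set, a function that is \<open>L\<close>-Lipschitz for \<open>d\<close> is, up to a factor close to \<open>1\<close>,
  \<open>L\<close>-Lipschitz for the distance of \<open>F i\<close> with \<open>i\<close> large. Its McShane extension is Lipschitz for that
  smaller distance on the whole manifold, so it remains to smooth Lipschitz functions of a single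
  Finsler metric, with an arbitrarily small loss in the constant.

  This is done chart by chart along a countable cover by compact sets, each step blending the
  function with a mollification of it and leaving untouched what has been treated before. Translating
  a curve by a small vector in a chart changes its length by a factor close to \<open>1\<close>, since \<open>F\<close> is
  continuous and positive off the zero section; hence mollifying hardly changes the Lipschitz
  constant. As increments add up along a curve, like its length, local Lipschitz bounds along
  curves yield the global one.\<close>

section \<open>Almost everywhere differentiability of Lipschitz functions\<close>

text \<open>The final constant must not exceed that of \<open>f\<close>, yet passing to
  \<open>F i\<close> and smoothing both cost a little. Room is made beforehand by shrinking
  \<open>f\<close> to \<open>(1 - \<tau>) * f\<close>. This moves \<open>f\<close> by
  \<open>\<tau> * \<bar>f x\<bar>\<close>, which is controlled on a finite set only, as
  \<open>f\<close> may be unbounded; and pointwise convergence of the distances yields a common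
  index \<open>i\<close> for finitely many pairs only. Finite sets suffice because all approximants
  are Lipschitz for \<open>d\<close> with the constant of \<open>f\<close>: closeness on more and
  more points of a dense sequence then becomes uniform closeness on compact sets.

  By monotone convergence the distance of \<open>F i\<close> is at most \<open>d\<close>. Hence
  Lipschitz functions of \<open>F i\<close> are Lipschitz for \<open>d\<close>, and continuous
  because \<open>d\<close> induces the manifold topology.

  Lengths are integrals of speeds, so curves must be differentiable almost everywhere, with
  measurable derivatives whose integrals recover increments. Such facts are needed for functions of
  one real variable only, since curves are differentiated and never \<open>f\<close>; they rest on
  Vitali's covering theorem.\<close>

lemma open_cover_image_deriv_le:
  fixes v :: "real \<Rightarrow> real"
  assumes mono: "strict_mono v" and lip: "K-lipschitz_on UNIV v"
    and O: "open U" "E \<subseteq> U" "U \<in> lmeasurable" and p: "0 < p"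
    and E: "\<And>x r. x \<in> E \<Longrightarrow> 0 < r \<Longrightarrow> \<exists>y. y \<noteq> x \<and> \<bar>y - x\<bar> < r \<and> \<bar>v y - v x\<bar> < p * \<bar>y - x\<bar>"
    and e: "0 < e"
  shows "\<exists>V. open V \<and> v ` E \<subseteq> V \<and> V \<in> lmeasurable \<and> measure lebesgue V \<le> p * measure lebesgue U + e"
proof -
  \<comment> \<open>Intervals in \<open>U\<close> that \<open>v\<close> stretches by less than
    \<open>p\<close>. By hypothesis they form a Vitali cover of \<open>E\<close>, so disjoint ones
    cover \<open>E\<close> up to a null set. Their images have total length at most \<open>p\<close>
    times the measure of \<open>U\<close>, and the Lipschitz map \<open>v\<close> sends the null
    remainder to a null set.\<close>
  define I where "I = {(c, r). 0 < r \<and> cball c r \<subseteq> U \<and> v (c + r) - v (c - r) < p * (2 * r)}"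
  have inj: "inj v" using mono by (rule strict_mono_imp_inj_on)
  have cont: "continuous_on S v" for S
    using lip lipschitz_on_continuous_on lipschitz_on_subset by blast
  have cover: "\<exists>i. i \<in> I \<and> x \<in> cball (fst i) (snd i) \<and> snd i < r" if x: "x \<in> E" and r: "0 < r" for x r
  proof -
    obtain s where s: "0 < s" "ball x s \<subseteq> U" using O x open_contains_ball by blast
    then obtain y where y: "y \<noteq> x" "\<bar>y - x\<bar> < min r s" "\<bar>v y - v x\<bar> < p * \<bar>y - x\<bar>"
      using E[OF x, of "min r s"] r by auto
    \<comment> \<open>The interval between \<open>x\<close> and \<open>y\<close> as a ball. Since
      \<open>x\<close> is an end point of it, the covering theorem is used for closed balls.\<close>
    let ?c = "(x + y) / 2" and ?r = "\<bar>y - x\<bar> / 2"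
    have 1: "cball ?c ?r \<subseteq> ball x s"
    proof
      fix z assume "z \<in> cball ?c ?r"
      then show "z \<in> ball x s" using y(2) dist_triangle[of x z ?c]
        unfolding mem_cball mem_ball by (simp add: dist_real_def field_simps abs_minus_commute)
    qed
    have 2: "v (?c + ?r) - v (?c - ?r) < p * (2 * ?r)"
    proof (cases "x \<le> y")
      case True
      have [simp]: "?c + ?r = y" "?c - ?r = x" using True by (auto simp: field_simps)
      show ?thesis using y(3) unfolding \<open>?c + ?r = y\<close> \<open>?c - ?r = x\<close> by linarith
    next
      case False
      have [simp]: "?c + ?r = x" "?c - ?r = y" using False by (auto simp: field_simps)
      show ?thesis using y(3) unfolding \<open>?c + ?r = x\<close> \<open>?c - ?r = y\<close> by linarith
    qed
    have 3: "x \<in> cball ?c ?r" 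
    proof -
      have "?c - x = (y - x) / 2" by (simp add: field_simps)
      then show ?thesis unfolding mem_cball dist_real_def by (simp only:) simp
    qed
    have 4: "0 < ?r" using y by simp
    have 5: "?r < r" by (rule le_less_trans[of _ "\<bar>y - x\<bar>"]) (use y in auto)
    have "cball ?c ?r \<subseteq> U" using 1 s(2) by (rule subset_trans)
    with 2 4 have "(?c, ?r) \<in> I" unfolding I_def mem_Collect_eq prod.case by (intro conjI)
    then show ?thesis using 3 5 by (intro exI[of _ "(?c, ?r)"]) simp
  qed
  have rpos: "0 < snd i" if "i \<in> I" for i using that by (auto simp: I_def)
  obtain C where C: "countable C" "C \<subseteq> I"
    and disj: "pairwise (\<lambda>i j. disjnt (cball (fst i) (snd i)) (cball (fst j) (snd j))) C"
    and neg: "negligible (E - (\<Union>i\<in>C. cball (fst i) (snd i)))"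
    by (rule Vitali_covering_theorem_cballs[of I snd E fst, OF rpos cover]) blast+
  let ?B = "\<lambda>i. cball (fst i) (snd i)"
  let ?N = "E - (\<Union>i\<in>C. ?B i)"
  have negN: "negligible (v ` ?N)"
  proof (rule negligible_locally_Lipschitz_image[OF _ neg])
    fix x assume "x \<in> ?N"
    show "\<exists>T B. open T \<and> x \<in> T \<and> (\<forall>y\<in>?N \<inter> T. norm (v y - v x) \<le> B * norm (y - x))"
      using lipschitz_onD[OF lip] by (intro exI[of _ UNIV] exI[of _ K]) (auto simp: dist_norm)
  qed simp
  have dis: "disjoint_family_on ?B C"
    using disj by (auto simp: pairwise_def disjoint_family_on_def disjnt_def)
  then have dis': "disjoint_family_on (\<lambda>i. v ` ?B i) C"
    using inj unfolding disjoint_family_on_def by (metis image_Int image_empty)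
  have cpt: "v ` ?B i \<in> sets lebesgue" for i
  proof -
    have "compact (v ` ?B i)" by (intro compact_continuous_image cont) auto
    then show ?thesis by (metis borel_compact sets_completionI_sets sets_lborel)
  qed
  have le: "emeasure lebesgue (v ` ?B i) \<le> ennreal p * emeasure lebesgue (?B i)" if "i \<in> C" for i
  proof -
    have i: "0 < snd i" "v (fst i + snd i) - v (fst i - snd i) < p * (2 * snd i)"
      using that C by (auto simp: I_def)
    have "v ` ?B i \<subseteq> {v (fst i - snd i)..v (fst i + snd i)}"
      using mono by (auto simp: dist_real_def abs_real_def strict_mono_less_eq split: if_splits)
    then have "emeasure lebesgue (v ` ?B i) \<le> emeasure lebesgue {v (fst i - snd i)..v (fst i + snd i)}"
      by (rule emeasure_mono) auto
    also have "\<dots> = ennreal (v (fst i + snd i) - v (fst i - snd i))"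
      using i(1) mono by (subst emeasure_completion) (auto simp: strict_mono_less_eq)
    also have "\<dots> \<le> ennreal (p * (2 * snd i))" using i(2) by (intro ennreal_leI) auto
    also have "\<dots> = ennreal p * emeasure lebesgue (?B i)"
      using i(1) p by (simp add: cball_eq_atLeastAtMost ennreal_mult)
    finally show ?thesis .
  qed
  have UB: "(\<Union>i\<in>C. ?B i) \<subseteq> U" 
  proof (rule UN_least)
    fix i assume "i \<in> C"
    then have "i \<in> I" using C(2) by blast
    then show "?B i \<subseteq> U" unfolding I_def by (cases i) simp
  qed
  let ?W = "(\<Union>i\<in>C. v ` ?B i) \<union> v ` ?N"
  have W: "?W \<in> sets lebesgue"
    using cpt C(1) negN negligible_imp_sets by (intro sets.Un sets.countable_UN') auto
  have "emeasure lebesgue ?W = emeasure lebesgue (\<Union>i\<in>C. v ` ?B i)"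
    using cpt C(1) negN
    by (intro emeasure_Un_null_set sets.countable_UN') (auto simp: negligible_iff_null_sets)
  also have "\<dots> = (\<integral>\<^sup>+i. emeasure lebesgue (v ` ?B i) \<partial>count_space C)"
    using cpt C dis' by (intro emeasure_UN_countable) auto
  also have "\<dots> \<le> (\<integral>\<^sup>+i. ennreal p * emeasure lebesgue (?B i) \<partial>count_space C)"
    using le by (intro nn_integral_mono) auto
  also have "\<dots> = ennreal p * (\<integral>\<^sup>+i. emeasure lebesgue (?B i) \<partial>count_space C)"
    by (intro nn_integral_cmult) auto
  also have "(\<integral>\<^sup>+i. emeasure lebesgue (?B i) \<partial>count_space C) = emeasure lebesgue (\<Union>i\<in>C. ?B i)"
    using C dis by (intro emeasure_UN_countable[symmetric]) auto
  also have "emeasure lebesgue (\<Union>i\<in>C. ?B i) \<le> emeasure lebesgue U"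
    using UB O by (intro emeasure_mono) auto
  finally have le1: "emeasure lebesgue ?W \<le> ennreal p * emeasure lebesgue U"
    by (simp add: mult_left_mono)
  \<comment> \<open>The image is enclosed in an open set because the estimate will be applied again,
    to the inverse of \<open>v\<close>, with \<open>V\<close> in the role of
    \<open>U\<close>.\<close>
  obtain V where V: "open V" "?W \<subseteq> V" "V - ?W \<in> lmeasurable" "emeasure lebesgue (V - ?W) < ennreal e"
    by (rule sets_lebesgue_outer_open[OF W e])
  have "emeasure lebesgue (?W \<union> (V - ?W)) = emeasure lebesgue ?W + emeasure lebesgue (V - ?W)"
    by (rule plus_emeasure[symmetric]) (use W V(3) in auto)
  also have "?W \<union> (V - ?W) = V" using V(2) by blast
  finally have "emeasure lebesgue V = emeasure lebesgue ?W + emeasure lebesgue (V - ?W)" .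
  also have "\<dots> \<le> ennreal p * emeasure lebesgue U + ennreal e"
    using le1 V(4) by (intro add_mono) auto
  also have "emeasure lebesgue U = ennreal (measure lebesgue U)"
    using O(3) by (simp add: emeasure_eq_measure2)
  also have "ennreal p * ennreal (measure lebesgue U) + ennreal e = ennreal (p * measure lebesgue U + e)"
    using p e by (simp add: ennreal_mult)
  finally have Vle: "emeasure lebesgue V \<le> ennreal (p * measure lebesgue U + e)" .
  then have VL: "V \<in> lmeasurable" using V(1) 
    by (intro fmeasurableI) (auto simp: less_top[symmetric] top_unique)
  then have "measure lebesgue V \<le> p * measure lebesgue U + e"
    using Vle p e ennreal_le_iff[of "p * measure lebesgue U + e"] by (simp only: emeasure_eq_measure2) simp
  moreover have "v ` E \<subseteq> ?W" by (simp only: image_UN[symmetric] image_Un[symmetric]) (rule image_mono, blast)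
  then have "v ` E \<subseteq> V" using V(2) by (rule subset_trans)
  ultimately show ?thesis using V(1) VL by (intro exI[of _ V] conjI)
qed

text \<open>Where the lower derivative of \<open>v\<close> is less than \<open>p\<close>, \<open>v\<close> multiplies outer measure by at most \<open>p\<close>;
  where the upper one exceeds \<open>q\<close>, the inverse of \<open>v\<close> multiplies it by at most \<open>1 / q\<close>. Together they
  shrink the outer measure of \<open>E\<close> by the factor \<open>p / q\<close>.\<close>

lemma negligible_deriv_gap:
  fixes v :: "real \<Rightarrow> real"
  assumes mono: "strict_mono v" and lip: "K-lipschitz_on UNIV v"
    and surj: "surj v" and exp: "\<And>x y. \<bar>x - y\<bar> \<le> \<bar>v x - v y\<bar>"
    and bd: "bounded E" and pq: "0 < p" "p < q"
    and low: "\<And>x r. x \<in> E \<Longrightarrow> 0 < r \<Longrightarrow> \<exists>y. y \<noteq> x \<and> \<bar>y - x\<bar> < r \<and> \<bar>v y - v x\<bar> < p * \<bar>y - x\<bar>"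
    and upp: "\<And>x r. x \<in> E \<Longrightarrow> 0 < r \<Longrightarrow> \<exists>y. y \<noteq> x \<and> \<bar>y - x\<bar> < r \<and> \<bar>v y - v x\<bar> > q * \<bar>y - x\<bar>"
  shows "negligible E"
proof -
  define w where "w = inv v"
  have inj: "inj v" using mono by (rule strict_mono_imp_inj_on)
  have wv [simp]: "w (v x) = x" for x using inj by (simp add: w_def)
  have vw [simp]: "v (w x) = x" for x using surj by (simp add: w_def surj_f_inv_f)
  have wmono: "strict_mono w"
    by (intro strict_monoI) (metis mono vw strict_mono_less)
  have wlip: "1-lipschitz_on UNIV w"
    by (intro lipschitz_onI) (use exp[of "w _" "w _"] in \<open>auto simp: dist_real_def\<close>)
  have upp': "\<exists>z. z \<noteq> y \<and> \<bar>z - y\<bar> < r \<and> \<bar>w z - w y\<bar> < (1/q) * \<bar>z - y\<bar>"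
    if "y \<in> v ` E" "0 < r" for y r
  proof -
    obtain x where x: "x \<in> E" "y = v x" using \<open>y \<in> v ` E\<close> by auto
    have K: "K \<ge> 0" using lip lipschitz_on_nonneg by blast
    \<comment> \<open>The radius \<open>r / (K+1)\<close> makes \<open>v x'\<close> land within
      \<open>r\<close> of \<open>v x\<close>; \<open>K+1\<close> is positive even when
      \<open>K\<close> is 0.\<close>
    obtain x' where x': "x' \<noteq> x" "\<bar>x' - x\<bar> < r / (K+1)" "\<bar>v x' - v x\<bar> > q * \<bar>x' - x\<bar>"
      using upp[OF x(1), of "r / (K+1)"] \<open>0 < r\<close> K by auto
    have "\<bar>v x' - v x\<bar> \<le> K * \<bar>x' - x\<bar>"
      using lipschitz_onD[OF lip, of x' x] by (simp add: dist_real_def)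
    also have "\<dots> \<le> (K+1) * \<bar>x' - x\<bar>" by (simp add: mult_right_mono)
    also have "\<dots> < r" using x'(2) K by (simp add: field_simps)
    finally show ?thesis
      using x' pq x inj by (intro exI[of _ "v x'"]) (auto simp: inj_eq field_simps)
  qed
  \<comment> \<open>The infimum \<open>m\<close> of \<open>M\<close> is the outer measure of
    \<open>E\<close>, which is not known to be measurable. Boundedness of \<open>E\<close> makes
    \<open>M\<close> nonempty.\<close>
  define M where "M = measure lebesgue ` {U. open U \<and> E \<subseteq> U \<and> U \<in> lmeasurable}"
  obtain R where "E \<subseteq> ball 0 R" using bd bounded_subset_ballD by blast
  then have ne: "M \<noteq> {}" unfolding M_def using lmeasurable_ball by auto
  have bdd: "bdd_below M" by (rule bdd_belowI[of _ 0]) (auto simp: M_def)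
  define m where "m = Inf M"
  have m0: "m \<ge> 0" unfolding m_def using ne by (intro cInf_greatest) (auto simp: M_def)
  have step: "m \<le> (p * x + e) / q + e" if "x \<in> M" "0 < e" for x e
  proof -
    obtain U where U: "open U" "E \<subseteq> U" "U \<in> lmeasurable" "x = measure lebesgue U"
      using \<open>x \<in> M\<close> by (auto simp: M_def)
    obtain V where V: "open V" "v ` E \<subseteq> V" "V \<in> lmeasurable"
       "measure lebesgue V \<le> p * measure lebesgue U + e"
      using open_cover_image_deriv_le[OF mono lip U(1-3) pq(1) low \<open>0 < e\<close>] by blast
    obtain W where W: "open W" "w ` v ` E \<subseteq> W" "W \<in> lmeasurable"
       "measure lebesgue W \<le> (1/q) * measure lebesgue V + e"
      using open_cover_image_deriv_le[OF wmono wlip V(1,2,3) _ upp' \<open>0 < e\<close>] pq by auto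
    have "measure lebesgue W \<in> M" using W unfolding M_def by (auto simp: image_image)
    then have "m \<le> measure lebesgue W" unfolding m_def by (rule cInf_lower[OF _ bdd])
    also have "\<dots> \<le> (1/q) * (p * x + e) + e"
      using W(4) V(4) U(4) pq by (smt (verit) divide_pos_pos mult_left_mono)
    finally show ?thesis by simp
  qed
  have step2: "m \<le> (p * x) / q" if "x \<in> M" for x
  proof (rule field_le_epsilon)
    fix e :: real assume "0 < e"
    let ?e = "e / (1/q + 1)"
    have "0 < ?e" using \<open>0 < e\<close> pq by (intro divide_pos_pos) (auto simp: add_pos_pos)
    from step[OF that this] have "m \<le> p * x / q + ?e * (1/q + 1)"
      by (simp add: add_divide_distrib distrib_left)
    also have "?e * (1/q + 1) = e" using pq by (simp add: add_pos_pos less_imp_neq[THEN not_sym])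
    finally show "m \<le> p * x / q + e" .
  qed
  have "q * m / p \<le> m"
    unfolding m_def
  proof (rule cInf_greatest[OF ne])
    fix x assume "x \<in> M"
    from step2[OF this] show "q * Inf M / p \<le> x" using pq by (simp add: m_def field_simps)
  qed
  then have "q * m \<le> p * m" using pq by (simp add: field_simps)
  then have "m = 0" using m0 pq by (metis less_eq_real_def mult_less_cancel_right_pos not_le)
  show ?thesis
    unfolding negligible_outer
  proof (intro allI impI)
    fix e :: real assume "0 < e"
    then obtain x where "x \<in> M" "x < e"
      using cInf_lessD[OF ne, of e] \<open>m = 0\<close> by (auto simp: m_def)
    then show "\<exists>T. E \<subseteq> T \<and> T \<in> lmeasurable \<and> measure lebesgue T < e" by (auto simp: M_def)
  qed
qed

text \<open>If the difference quotients at \<open>x\<close> have no limit, rationals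
  \<open>p < q\<close> separate their lower and upper limits, and \<open>x\<close> lies in one of
  countably many sets treated by \<open>negligible_deriv_gap\<close>. The bound
  \<open>real n\<close> is there because that lemma asks for bounded sets.\<close>

lemma monotone_bilipschitz_AE_differentiable:
  fixes v :: "real \<Rightarrow> real"
  assumes mono: "strict_mono v" and lip: "K-lipschitz_on UNIV v"
    and surj: "surj v" and exp: "\<And>x y. \<bar>x - y\<bar> \<le> \<bar>v x - v y\<bar>"
  shows "AE x in lborel. v differentiable (at x)"
proof -
  define E where "E n p q = {x. \<bar>x\<bar> \<le> real n \<and>
    (\<forall>r>0. \<exists>y. y \<noteq> x \<and> \<bar>y - x\<bar> < r \<and> \<bar>v y - v x\<bar> < of_rat p * \<bar>y - x\<bar>) \<and>
    (\<forall>r>0. \<exists>y. y \<noteq> x \<and> \<bar>y - x\<bar> < r \<and> \<bar>v y - v x\<bar> > of_rat q * \<bar>y - x\<bar>)}" for n :: nat and p q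
  have neg: "negligible (E n p q)" if "0 < p" "p < q" for n p q
  proof (rule negligible_deriv_gap[OF assms, where p = "of_rat p" and q = "of_rat q"])
    show "bounded (E n p q)" by (intro boundedI[of _ "real n"]) (auto simp: E_def)
  qed (use that in \<open>auto simp: E_def of_rat_less\<close>)
  let ?P = "{(n, p, q). 0 < p \<and> p < q} :: (nat \<times> rat \<times> rat) set"
  have negU: "negligible (\<Union>(n, p, q)\<in>?P. E n p q)"
    using neg by (intro negligible_countable_Union) auto
  have diff: "v differentiable (at x)" if x: "x \<notin> (\<Union>(n, p, q)\<in>?P. E n p q)" for x
  proof -
    define Q where "Q y = (v y - v x) / (y - x)" for y
    have Q_abs: "\<bar>v y - v x\<bar> = Q y * \<bar>y - x\<bar>" if "y \<noteq> x" for y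
    proof (cases "y < x")
      case True then have "v y < v x" using mono by (simp add: strict_mono_less)
      then show ?thesis using True by (auto simp: Q_def field_simps)
    next
      case False then have "v x < v y" using mono that by (simp add: strict_mono_less)
      then show ?thesis using False that by (auto simp: Q_def field_simps)
    qed
    have Q1: "1 \<le> Q y" if "y \<noteq> x" for y
    proof -
      have "1 * \<bar>y - x\<bar> \<le> Q y * \<bar>y - x\<bar>" using exp[of y x] unfolding Q_abs[OF that] by simp
      then show ?thesis using that by (subst (asm) mult_le_cancel_right_pos) auto
    qed
    have QK: "Q y \<le> K" if "y \<noteq> x" for y
    proof -
      have "Q y * \<bar>y - x\<bar> \<le> K * \<bar>y - x\<bar>"
        using lipschitz_onD[OF lip UNIV_I UNIV_I, of y x] Q_abs[OF that] unfolding dist_real_def by linarith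
      then show ?thesis using that by (subst (asm) mult_le_cancel_right_pos) auto
    qed
    have dich: "(\<forall>\<^sub>F y in at x. Q y \<ge> of_rat p) \<or> (\<forall>\<^sub>F y in at x. Q y \<le> of_rat q)" if "0 < p" "p < q" for p q
    proof -
      obtain n :: nat where "\<bar>x\<bar> \<le> real n" using real_arch_simple by blast
      moreover have "x \<notin> E n p q" using x that by blast
      ultimately have "(\<exists>r>0. \<forall>y. y \<noteq> x \<longrightarrow> \<bar>y - x\<bar> < r \<longrightarrow> \<not> \<bar>v y - v x\<bar> < of_rat p * \<bar>y - x\<bar>) \<or>
          (\<exists>r>0. \<forall>y. y \<noteq> x \<longrightarrow> \<bar>y - x\<bar> < r \<longrightarrow> \<not> \<bar>v y - v x\<bar> > of_rat q * \<bar>y - x\<bar>)"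
        unfolding E_def by auto
      then consider r where "r > 0" "\<forall>y. y \<noteq> x \<longrightarrow> \<bar>y - x\<bar> < r \<longrightarrow> \<not> \<bar>v y - v x\<bar> < of_rat p * \<bar>y - x\<bar>"
        | r where "r > 0" "\<forall>y. y \<noteq> x \<longrightarrow> \<bar>y - x\<bar> < r \<longrightarrow> \<not> \<bar>v y - v x\<bar> > of_rat q * \<bar>y - x\<bar>"
        by blast
      then show ?thesis
      proof cases
        case 1
        have "\<forall>\<^sub>F y in at x. Q y \<ge> of_rat p"
          unfolding eventually_at using 1
          by (intro exI[of _ r]) (auto simp: dist_real_def Q_abs not_less)
        then show ?thesis ..
      next
        case 2
        have "\<forall>\<^sub>F y in at x. Q y \<le> of_rat q"
          unfolding eventually_at using 2
          by (intro exI[of _ r]) (auto simp: dist_real_def Q_abs not_less)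
        then show ?thesis ..
      qed
    qed
    \<comment> \<open>\<open>Sup S\<close> is the lower limit of \<open>Q\<close> at
      \<open>x\<close>. For rationals \<open>p < q\<close> between it and \<open>a\<close>,
      \<open>Q \<ge> p\<close> fails arbitrarily close to \<open>x\<close>, so \<open>dich\<close>
      gives \<open>Q \<le> q < a\<close> near \<open>x\<close>.\<close>
    define S where "S = {s. \<forall>\<^sub>F y in at x. Q y \<ge> s}"
    have "1 \<in> S" unfolding S_def by (auto simp: eventually_at_filter Q1)
    have bdd: "s \<le> K" if "s \<in> S" for s
    proof -
      have "\<forall>\<^sub>F y in at x. s \<le> K"
        using that eventually_neq_at_within[of x x UNIV] unfolding S_def mem_Collect_eq
      proof eventually_elim
        case (elim y)
        then show ?case using QK[of y] by linarith
      qed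
      then show ?thesis by simp
    qed
    have bdd': "bdd_above S" using bdd by (intro bdd_aboveI)
    have sup1: "1 \<le> Sup S" using \<open>1 \<in> S\<close> bdd' by (rule cSup_upper)
    have "(Q \<longlongrightarrow> Sup S) (at x)"
    proof (rule order_tendstoI)
      fix a assume "a < Sup S"
      then obtain s where "s \<in> S" "a < s" using \<open>1 \<in> S\<close> by (metis empty_iff less_cSupE)
      then show "\<forall>\<^sub>F y in at x. a < Q y" unfolding S_def by (auto elim: eventually_mono)
    next
      fix a assume a: "Sup S < a"
      obtain p where p: "Sup S < of_rat p" "of_rat p < a" using of_rat_dense[OF a] by blast
      obtain q where q: "of_rat p < real_of_rat q" "of_rat q < a" using of_rat_dense[OF p(2)] by blast
      have "\<not> (\<forall>\<^sub>F y in at x. Q y \<ge> of_rat p)"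
        using p(1) cSup_upper[OF _ bdd', of "of_rat p"] unfolding S_def by auto
      moreover have "real_of_rat p > 0" using sup1 p by linarith
      ultimately have "\<forall>\<^sub>F y in at x. Q y \<le> of_rat q"
        using dich[of p q] q by (auto simp: of_rat_less)
      then show "\<forall>\<^sub>F y in at x. Q y < a" by (rule eventually_mono) (use q in auto)
    qed
    then have "(v has_real_derivative Sup S) (at x)" unfolding Q_def[abs_def] has_field_derivative_iff .
    then show ?thesis using real_differentiable_def by blast
  qed
  have "AE x in lebesgue. x \<notin> (\<Union>(n, p, q)\<in>?P. E n p q)"
    using negU unfolding negligible_iff_null_sets by (rule AE_not_in)
  then show ?thesis
    unfolding AE_completion_iff by (rule AE_mp) (use diff in auto)
qed

text \<open>Adding \<open>(K + 1) * x\<close> does not affect differentiability and turns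
  \<open>u\<close> into an increasing function with all slopes at least 1, hence expanding and
  onto.\<close>

lemma lipschitz_real_AE_differentiable:
  fixes u :: "real \<Rightarrow> real"
  assumes lip: "K-lipschitz_on UNIV u"
  shows "AE x in lborel. u differentiable (at x)"
proof -
  define v where "v x = u x + (K + 1) * x" for x
  have K: "K \<ge> 0" using lip lipschitz_on_nonneg by blast
  have u: "\<bar>u x - u y\<bar> \<le> K * \<bar>x - y\<bar>" for x y
    using lipschitz_onD[OF lip, of x y] by (simp add: dist_real_def)
  have inc: "y - x \<le> v y - v x" if "x \<le> y" for x y
    using u[of y x] that by (auto simp: v_def algebra_simps)
  have exp: "\<bar>x - y\<bar> \<le> \<bar>v x - v y\<bar>" for x y
    using inc[of x y] inc[of y x] by linarith
  have mono: "strict_mono v"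
  proof (rule strict_monoI)
    fix x y :: real assume "x < y" then show "v x < v y" using inc[of x y] by linarith
  qed
  have lip': "(K + (K + 1))-lipschitz_on UNIV v"
  proof (rule lipschitz_onI)
    fix x y :: real
    have "\<bar>(u x - u y) + (K + 1) * (x - y)\<bar> \<le> K * \<bar>x - y\<bar> + (K + 1) * \<bar>x - y\<bar>"
      by (rule order_trans[OF abs_triangle_ineq add_mono]) (use u K in \<open>auto simp: abs_mult\<close>)
    then show "dist (v x) (v y) \<le> (K + (K + 1)) * dist x y"
      by (simp add: v_def dist_real_def algebra_simps)
  qed (use K in auto)
  have cont: "continuous_on {a..b} v" for a b
    using lip' lipschitz_on_continuous_on lipschitz_on_subset by blast
  have surj: "surj v"
    unfolding surj_def
  proof
    fix y
    let ?r = "\<bar>y\<bar> + \<bar>v 0\<bar>"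
    have "v (- ?r) \<le> y" "y \<le> v ?r" using inc[of "- ?r" 0] inc[of 0 ?r] by (auto simp: abs_real_def split: if_splits)
    then show "\<exists>x. y = v x" using IVT'[of v "- ?r" y ?r] cont by auto
  qed
  have eq: "u = (\<lambda>x. v x - (K + 1) * x)" by (auto simp: v_def)
  show ?thesis
    using monotone_bilipschitz_AE_differentiable[OF mono lip' surj exp]
    by (rule AE_mp) (intro AE_I2 impI, subst eq, auto intro!: derivative_intros)
qed

theorem lipschitz_AE_has_vector_derivative:
  fixes u :: "real \<Rightarrow> 'e::euclidean_space"
  assumes lip: "K-lipschitz_on UNIV u"
  obtains g where "g \<in> borel_measurable borel" "AE x in lborel. (u has_vector_derivative g x) (at x)"
proof -
  \<comment> \<open>The limit along one sequence makes \<open>g\<close> Borel on the whole line; its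
    value where no limit exists is irrelevant.\<close>
  define g where "g x = lim (\<lambda>n. (u (x + inverse (real (Suc n))) - u x) /\<^sub>R inverse (real (Suc n)))" for x
  have "continuous_on UNIV u" using lip by (rule lipschitz_on_continuous_on)
  then have [measurable]: "u \<in> borel_measurable borel" by (rule borel_measurable_continuous_onI)
  have "AE x in lborel. \<forall>b\<in>Basis. (\<lambda>x. u x \<bullet> b) differentiable (at x)"
  proof (intro AE_finite_allI lipschitz_real_AE_differentiable)
    fix b :: 'e assume b: "b \<in> Basis"
    show "K-lipschitz_on UNIV (\<lambda>x. u x \<bullet> b)"
    proof (rule lipschitz_onI)
      fix x y :: real
      have "\<bar>u x \<bullet> b - u y \<bullet> b\<bar> \<le> norm (u x - u y)"
        using Basis_le_norm[OF b, of "u x - u y"] by (simp add: inner_diff_left)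
      also have "\<dots> \<le> K * dist x y" using lipschitz_onD[OF lip, of x y] by (simp add: dist_norm)
      finally show "dist (u x \<bullet> b) (u y \<bullet> b) \<le> K * dist x y" by (simp add: dist_real_def)
    qed (use lip lipschitz_on_nonneg in blast)
  qed simp
  then have "AE x in lborel. (u has_vector_derivative g x) (at x)"
  proof (rule AE_mp, intro AE_I2 impI)
    fix x assume "\<forall>b\<in>Basis. (\<lambda>x. u x \<bullet> b) differentiable (at x)"
    then have "u differentiable (at x)"
      by (rule differentiable_componentwise_within[THEN iffD2])
    then obtain d where d: "(u has_vector_derivative d) (at x)"
      using vector_derivative_works by blast
    have "((\<lambda>h. (u (x + h) - u x) /\<^sub>R h) \<longlongrightarrow> d) (at 0)"
    proof (rule Lim_null[THEN iffD2], rule tendsto_norm_zero_cancel)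
      have "((\<lambda>h. norm (u (x + h) - u x - h *\<^sub>R d) / norm h) \<longlongrightarrow> 0) (at 0)"
        using d[unfolded has_vector_derivative_def has_derivative_at] by (rule conjunct2)
      then show "((\<lambda>h. norm ((u (x + h) - u x) /\<^sub>R h - d)) \<longlongrightarrow> 0) (at 0)"
      proof (rule Lim_transform_eventually)
        show "\<forall>\<^sub>F h in at 0. norm (u (x + h) - u x - h *\<^sub>R d) / norm h = norm ((u (x + h) - u x) /\<^sub>R h - d)"
          using eventually_neq_at_within[of 0 0 UNIV]
        proof eventually_elim
          case (elim h)
          then have "(u (x + h) - u x) /\<^sub>R h - d = (u (x + h) - u x - h *\<^sub>R d) /\<^sub>R h"
            unfolding scaleR_diff_right by simp
          then show ?case by (simp only: norm_scaleR) (simp add: divide_inverse mult.commute)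
        qed
      qed
    qed
    moreover have "filterlim (\<lambda>n. inverse (real (Suc n))) (at 0) sequentially"
      using LIMSEQ_inverse_real_of_nat by (auto simp: filterlim_at)
    ultimately have "(\<lambda>n. (u (x + inverse (real (Suc n))) - u x) /\<^sub>R inverse (real (Suc n))) \<longlonglongrightarrow> d"
      by (rule filterlim_compose)
    then have "g x = d" unfolding g_def by (rule limI)
    then show "(u has_vector_derivative g x) (at x)" using d by simp
  qed
  moreover have "g \<in> borel_measurable borel" unfolding g_def by measurable
  ultimately show thesis using that by blast
qed

text \<open>The difference quotients are bounded by \<open>K\<close>, so their integrals converge to
  that of \<open>g\<close> by dominated convergence. The same integrals telescope to the difference
  of the means of \<open>u\<close> over \<open>{b..b + h n}\<close> and \<open>{a..a + h n}\<close>,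
  which tends to \<open>u b - u a\<close> by continuity.\<close>

theorem lipschitz_increment_eq_integral:
  fixes u g :: "real \<Rightarrow> real"
  assumes lip: "K-lipschitz_on UNIV u" and [measurable]: "g \<in> borel_measurable borel"
    and g: "AE x in lborel. x \<in> {a..b} \<longrightarrow> (u has_vector_derivative g x) (at x)" and ab: "a \<le> b"
  shows "set_integrable lborel {a..b} g" "u b - u a = (LINT x:{a..b}|lborel. g x)"
proof -
  define h where "h n = inverse (real (Suc n))" for n
  define D where "D n x = (u (x + h n) - u x) / h n" for n x
  have h: "h n > 0" for n by (simp add: h_def)
  have hlim: "filterlim h (at_right 0) sequentially"
    unfolding h_def filterlim_at using LIMSEQ_inverse_real_of_nat by auto
  have K: "K \<ge> 0" using lip lipschitz_on_nonneg by blast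
  have cont: "continuous_on S u" for S
    using lip lipschitz_on_continuous_on lipschitz_on_subset by blast
  have [measurable]: "u \<in> borel_measurable borel" using cont by (rule borel_measurable_continuous_onI)
  have Dm [measurable]: "D n \<in> borel_measurable borel" for n unfolding D_def by measurable
  have Db: "\<bar>D n x\<bar> \<le> K" for n x
    using lipschitz_onD[OF lip UNIV_I UNIV_I, of "x + h n" x] h[of n]
    by (simp add: D_def dist_real_def divide_le_eq)
  have Dlim: "AE x in lborel. (\<lambda>n. indicator {a..b} x *\<^sub>R D n x) \<longlonglongrightarrow> indicator {a..b} x *\<^sub>R g x"
    using g
  proof (rule AE_mp, intro AE_I2 impI)
    fix x assume *: "x \<in> {a..b} \<longrightarrow> (u has_vector_derivative g x) (at x)"
    show "(\<lambda>n. indicator {a..b} x *\<^sub>R D n x) \<longlonglongrightarrow> indicator {a..b} x *\<^sub>R g x"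
    proof (cases "x \<in> {a..b}")
      case True
      then have "(u has_real_derivative g x) (at x)"
        using * by (simp add: has_real_derivative_iff_has_vector_derivative)
      then have "((\<lambda>k. (u (x + k) - u x) / k) \<longlongrightarrow> g x) (at 0)" by (simp add: DERIV_def)
      moreover have "filterlim h (at 0) sequentially"
        using hlim by (rule filterlim_mono) (auto simp: at_le)
      ultimately have "(\<lambda>n. D n x) \<longlonglongrightarrow> g x"
        unfolding D_def by (rule filterlim_compose)
      then show ?thesis using True by simp
    qed simp
  qed
  have int1: "integrable lborel (\<lambda>x. indicator {a..b} x * K :: real)"
    by (intro integrable_mult_left integrable_real_indicator) (auto simp: emeasure_lborel_Icc_eq)
  note conv = integral_dominated_convergence[OF _ _ int1 Dlim]
  have bnd: "AE x in lborel. norm (indicator {a..b} x *\<^sub>R D n x) \<le> indicator {a..b} x * K" for n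
    using Db by (intro AE_I2) (auto simp: indicator_def)
  show "set_integrable lborel {a..b} g"
    unfolding set_integrable_def
    by (rule integrable_dominated_convergence[OF _ _ int1 Dlim bnd]) auto
  have lim: "(\<lambda>n. LINT x:{a..b}|lborel. D n x) \<longlonglongrightarrow> (LINT x:{a..b}|lborel. g x)"
    unfolding set_lebesgue_integral_def by (rule conv) (use bnd in auto)
  define U where "U x = integral {a..x} u" for x
  have Ui: "u integrable_on {x..y}" for x y by (intro integrable_continuous_real cont)
  have Uder: "((\<lambda>k. (integral {x..x + k} u) / k) \<longlongrightarrow> u x) (at_right 0)" for x
  proof -
    have "((\<lambda>y. integral {x..y} u) has_vector_derivative u x) (at x within {x..x+1})"
      by (rule integral_has_vector_derivative) (auto intro: cont)
    then have "((\<lambda>y. integral {x..y} u) has_real_derivative u x) (at_right x)"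
      by (simp add: has_real_derivative_iff_has_vector_derivative at_within_Icc_at_right)
    then have "((\<lambda>y. integral {x..y} u / (y - x)) \<longlongrightarrow> u x) (at_right x)"
      by (simp add: has_field_derivative_iff)
    then show ?thesis
      by (simp add: filterlim_at_right_to_0[of _ _ x] add.commute)
  qed
  have "(LINT x:{a..b}|lborel. D n x) = integral {b..b + h n} u / h n - integral {a..a + h n} u / h n" for n
  proof -
    have ci: "continuous_on {a..b} (D n)" unfolding D_def using h[of n]
      by (intro continuous_intros continuous_on_compose2[OF cont[of UNIV]]) auto
    then have "set_integrable lborel {a..b} (D n)" by (rule borel_integrable_atLeastAtMost')
    then have "(LINT x:{a..b}|lborel. D n x) = integral {a..b} (D n)"
      by (rule set_borel_integral_eq_integral)
    also have "\<dots> = (integral {a..b} (\<lambda>x. u (x + h n)) - integral {a..b} u) / h n"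
      unfolding D_def
      by (subst integral_divide, subst integral_diff)
        (auto intro!: integrable_continuous_real continuous_intros continuous_on_compose2[OF cont[of UNIV]])
    also have "integral {a..b} (\<lambda>x. u (x + h n)) = integral {a + h n..b + h n} u"
      using integral_shift_real_ivl[of "a + h n" "h n" "b + h n" u] by simp
    also have "\<dots> - integral {a..b} u = integral {b..b + h n} u - integral {a..a + h n} u"
    proof -
      have "integral {a..b} u + integral {b..b + h n} u = integral {a..b + h n} u"
        using ab h[of n] by (intro Henstock_Kurzweil_Integration.integral_combine Ui) auto
      moreover have "integral {a..a + h n} u + integral {a + h n..b + h n} u = integral {a..b + h n} u"
        using ab h[of n] by (intro Henstock_Kurzweil_Integration.integral_combine Ui) auto
      ultimately show ?thesis by simp
    qed
    finally show ?thesis by (simp add: diff_divide_distrib)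
  qed
  moreover have "(\<lambda>n. integral {b..b + h n} u / h n - integral {a..a + h n} u / h n) \<longlonglongrightarrow> u b - u a"
    by (intro tendsto_diff filterlim_compose[OF Uder hlim])
  ultimately have "(\<lambda>n. LINT x:{a..b}|lborel. D n x) \<longlonglongrightarrow> u b - u a" by simp
  then show "u b - u a = (LINT x:{a..b}|lborel. g x)" using lim LIMSEQ_unique by blast
qed

section \<open>Smooth functions and mollification\<close>

lemma linear_eq_sum_Basis:
  fixes f :: "'e::euclidean_space \<Rightarrow> 'b::real_vector"
  assumes "linear f"
  shows "f w = (\<Sum>b\<in>Basis. (w \<bullet> b) *\<^sub>R f b)"
proof -
  have "f w = f (\<Sum>b\<in>Basis. (w \<bullet> b) *\<^sub>R b)" by (simp only: euclidean_representation)
  also have "\<dots> = (\<Sum>b\<in>Basis. (w \<bullet> b) *\<^sub>R f b)"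
    unfolding linear_sum[OF assms] by (intro sum.cong refl linear_scale[OF assms])
  finally show ?thesis .
qed

lemma C_k_on_subset: "C_k_on k f S \<Longrightarrow> T \<subseteq> S \<Longrightarrow> C_k_on k f T"
  by (induction k arbitrary: f) (auto intro: continuous_on_subset)

lemma C_k_on_cong:
  assumes "open S" "\<And>x. x \<in> S \<Longrightarrow> f x = g x" "C_k_on k f S"
  shows "C_k_on k g S"
  using assms(2,3)
proof (induction k arbitrary: f g)
  case 0
  then show ?case using continuous_on_eq[of S f g] by simp
next
  case (Suc k)
  have d: "f differentiable (at x)" if "x \<in> S" for x using Suc.prems(2) that by simp
  have "g differentiable (at x)" if x: "x \<in> S" for x
  proof -
    obtain f' where "(f has_derivative f') (at x)" using d[OF x] unfolding differentiable_def ..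
    then have "(g has_derivative f') (at x)"
      by (rule has_derivative_transform_within_open[OF _ \<open>open S\<close> x]) (rule Suc.prems(1))
    then show ?thesis by (rule differentiableI)
  qed
  moreover have "C_k_on k (\<lambda>x. frechet_derivative g (at x) v) S" for v
  proof (rule Suc.IH)
    show "C_k_on k (\<lambda>x. frechet_derivative f (at x) v) S" using Suc.prems(2) by simp
    fix x assume "x \<in> S"
    then show "frechet_derivative f (at x) v = frechet_derivative g (at x) v"
      using frechet_derivative_transform_within_open[OF d \<open>open S\<close>] Suc.prems(1) by metis
  qed
  ultimately show ?case by simp
qed

lemma C_k_on_Suc_imp: "C_k_on (Suc k) f S \<Longrightarrow> C_k_on k f S"
proof (induction k arbitrary: f)
  case 0
  then show ?case
    by (auto intro!: continuous_at_imp_continuous_on differentiable_imp_continuous_within)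
qed auto

lemma C_k_on_SucI:
  assumes "open S" "\<And>x. x \<in> S \<Longrightarrow> (f has_derivative f' x) (at x)" "\<And>v. C_k_on k (\<lambda>x. f' x v) S"
  shows "C_k_on (Suc k) f S"
proof -
  have "f' x = frechet_derivative f (at x)" if "x \<in> S" for x
    using frechet_derivative_at[OF assms(2)[OF that]] .
  then have "C_k_on k (\<lambda>x. frechet_derivative f (at x) v) S" for v
    using C_k_on_cong[OF assms(1) _ assms(3)[of v]] by auto
  then show ?thesis using assms(2) by (auto simp: differentiable_def)
qed

lemma C_k_on_SucD:
  assumes "C_k_on (Suc k) f S"
  shows "x \<in> S \<Longrightarrow> (f has_derivative frechet_derivative f (at x)) (at x)"
    and "C_k_on k (\<lambda>x. frechet_derivative f (at x) v) S"
  using assms by (auto simp: frechet_derivative_works)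

lemma C_k_on_local:
  assumes "\<And>x. x \<in> S \<Longrightarrow> \<exists>T. open T \<and> x \<in> T \<and> C_k_on k f T"
  shows "C_k_on k f S"
  using assms
proof (induction k arbitrary: f)
  case 0
  show ?case unfolding C_k_on.simps
  proof (rule continuous_at_imp_continuous_on, rule ballI)
    fix x assume "x \<in> S"
    then show "isCont f x" using 0 by (metis C_k_on.simps(1) continuous_on_eq_continuous_at)
  qed
next
  case (Suc k)
  have "\<exists>T. open T \<and> x \<in> T \<and> C_k_on k (\<lambda>x. frechet_derivative f (at x) v) T" if "x \<in> S" for x v
    using Suc.prems[OF that] by auto
  then have "C_k_on k (\<lambda>x. frechet_derivative f (at x) v) S" for v by (rule Suc.IH)
  then show ?case using Suc.prems by fastforce
qed

lemma C_k_on_const: "C_k_on k (\<lambda>x. c) S"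
proof (induction k arbitrary: c)
  case (Suc k)
  have "frechet_derivative (\<lambda>x::'a. c) (at x) v = 0" for x v
    using frechet_derivative_at[OF has_derivative_const[of c "at x"]] by metis
  then show ?case using Suc by simp
qed simp

lemma C_k_on_bounded_linear:
  assumes "bounded_linear L"
  shows "C_k_on k L S"
proof (cases k)
  case 0
  then show ?thesis using assms by (simp add: linear_continuous_on)
next
  case (Suc m)
  have "frechet_derivative L (at x) v = L v" for x v
    using frechet_derivative_at[OF bounded_linear_imp_has_derivative[OF assms]] by metis
  moreover have "L differentiable (at x)" for x
    using assms bounded_linear_imp_differentiable by blast
  ultimately show ?thesis by (simp add: Suc C_k_on_const)
qed

lemma C_k_on_bounded_linear_compose:
  assumes L: "bounded_linear L" and "open S" "C_k_on k f S"
  shows "C_k_on k (\<lambda>x. L (f x)) S"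
  using assms(3)
proof (induction k arbitrary: f)
  case 0
  then show ?case using L by (simp add: bounded_linear.continuous_on)
next
  case (Suc k)
  show ?case
  proof (rule C_k_on_SucI[OF \<open>open S\<close>])
    show "((\<lambda>x. L (f x)) has_derivative (\<lambda>v. L (frechet_derivative f (at x) v))) (at x)" if "x \<in> S" for x
      by (rule bounded_linear.has_derivative[OF L C_k_on_SucD(1)[OF Suc.prems that]])
  qed (rule Suc.IH[OF C_k_on_SucD(2)[OF Suc.prems]])
qed

lemma C_k_on_add:
  assumes "open S" "C_k_on k f S" "C_k_on k g S"
  shows "C_k_on k (\<lambda>x. f x + g x) S"
  using assms(2,3)
proof (induction k arbitrary: f g)
  case 0
  then show ?case by (simp add: continuous_on_add)
next
  case (Suc k)
  show ?case
    by (rule C_k_on_SucI[OF \<open>open S\<close> has_derivative_add[OF C_k_on_SucD(1)[OF Suc.prems(1)] C_k_on_SucD(1)[OF Suc.prems(2)]]])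
      (auto intro: Suc.IH C_k_on_SucD(2)[OF Suc.prems(1)] C_k_on_SucD(2)[OF Suc.prems(2)])
qed

lemma C_k_on_sum:
  assumes "open S" "\<And>i. i \<in> I \<Longrightarrow> C_k_on k (f i) S"
  shows "C_k_on k (\<lambda>x. \<Sum>i\<in>I. f i x) S"
  using assms(2)
proof (induction I rule: infinite_finite_induct)
  case (insert i I)
  then show ?case by (simp add: C_k_on_add[OF \<open>open S\<close>])
qed (simp_all add: C_k_on_const)

lemma C_k_on_bilinear:
  assumes B: "bounded_bilinear B" and "open S" "C_k_on k f S" "C_k_on k g S"
  shows "C_k_on k (\<lambda>x. B (f x) (g x)) S"
  using assms(3,4)
proof (induction k arbitrary: f g)
  case 0
  then show ?case using bounded_bilinear.continuous_on[OF B] by simp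
next
  case (Suc k)
  show ?case
  proof (rule C_k_on_SucI[OF \<open>open S\<close>])
    show "((\<lambda>x. B (f x) (g x)) has_derivative
        (\<lambda>v. B (f x) (frechet_derivative g (at x) v) + B (frechet_derivative f (at x) v) (g x))) (at x)"
      if "x \<in> S" for x
      by (rule bounded_bilinear.FDERIV[OF B C_k_on_SucD(1)[OF Suc.prems(1) that] C_k_on_SucD(1)[OF Suc.prems(2) that]])
    fix v
    have "C_k_on k (\<lambda>x. B (f x) (frechet_derivative g (at x) v)) S"
      by (rule Suc.IH[OF C_k_on_Suc_imp[OF Suc.prems(1)] C_k_on_SucD(2)[OF Suc.prems(2)]])
    moreover have "C_k_on k (\<lambda>x. B (frechet_derivative f (at x) v) (g x)) S"
      by (rule Suc.IH[OF C_k_on_SucD(2)[OF Suc.prems(1)] C_k_on_Suc_imp[OF Suc.prems(2)]])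
    ultimately show "C_k_on k (\<lambda>x. B (f x) (frechet_derivative g (at x) v) + B (frechet_derivative f (at x) v) (g x)) S"
      by (rule C_k_on_add[OF \<open>open S\<close>])
  qed
qed

text \<open>By the chain rule the derivative of \<open>f\<close> at \<open>g x\<close> is applied to
  a direction that moves with \<open>x\<close>, whereas \<open>C_k_on\<close> controls fixed
  directions. Expanding the moving direction in the basis leaves sums of products to which the
  induction hypothesis applies.\<close>

lemma C_k_on_compose:
  fixes f :: "'e::euclidean_space \<Rightarrow> 'b::real_normed_vector" and g :: "'d::euclidean_space \<Rightarrow> 'e"
  assumes "open S" "open T" "g ` S \<subseteq> T" "C_k_on k f T" "C_k_on k g S"
  shows "C_k_on k (\<lambda>x. f (g x)) S"
  using assms(4,5)
proof (induction k arbitrary: f)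
  case 0
  then show ?case using assms(3) by (auto intro: continuous_on_compose2)
next
  case (Suc k)
  let ?f' = "\<lambda>y. frechet_derivative f (at y)" and ?g' = "\<lambda>x. frechet_derivative g (at x)"
  have gT: "g x \<in> T" if "x \<in> S" for x using assms(3) that by auto
  show ?case
  proof (rule C_k_on_SucI[OF \<open>open S\<close>])
    show "((\<lambda>x. f (g x)) has_derivative (\<lambda>v. \<Sum>b\<in>Basis. (?g' x v \<bullet> b) *\<^sub>R ?f' (g x) b)) (at x)" if x: "x \<in> S" for x
    proof -
      have d: "(f has_derivative ?f' (g x)) (at (g x))"
        by (rule C_k_on_SucD(1)[OF Suc.prems(1) gT[OF x]])
      have dd: "((\<lambda>x. f (g x)) has_derivative (\<lambda>v. ?f' (g x) (?g' x v))) (at x)"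
        by (rule has_derivative_compose[OF C_k_on_SucD(1)[OF Suc.prems(2) x] d])
      have eq: "?f' (g x) w = (\<Sum>b\<in>Basis. (w \<bullet> b) *\<^sub>R ?f' (g x) b)" for w
        by (rule linear_eq_sum_Basis[OF has_derivative_linear[OF d]])
      show ?thesis by (rule has_derivative_eq_rhs[OF dd]) (rule ext, rule eq)
    qed
    fix v
    show "C_k_on k (\<lambda>x. \<Sum>b\<in>Basis. (?g' x v \<bullet> b) *\<^sub>R ?f' (g x) b) S"
    proof (rule C_k_on_sum[OF \<open>open S\<close>])
      fix b :: 'e
      have "C_k_on k (\<lambda>x. ?f' (g x) b) S"
        by (rule Suc.IH[OF C_k_on_SucD(2)[OF Suc.prems(1)] C_k_on_Suc_imp[OF Suc.prems(2)]])
      moreover have "C_k_on k (\<lambda>x. ?g' x v \<bullet> b) S"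
        by (rule C_k_on_bounded_linear_compose[OF bounded_linear_inner_left \<open>open S\<close> C_k_on_SucD(2)[OF Suc.prems(2)]])
      ultimately show "C_k_on k (\<lambda>x. (?g' x v \<bullet> b) *\<^sub>R ?f' (g x) b) S"
        by (intro C_k_on_bilinear[OF bounded_bilinear_scaleR \<open>open S\<close>])
    qed
  qed
qed

section \<open>Bump functions and convolution\<close>

lemma poly_times_exp_minus_tendsto_0:
  fixes p :: "real poly"
  shows "((\<lambda>y. poly p y * exp (- y)) \<longlongrightarrow> 0) at_top"
proof -
  have "((\<lambda>y. \<Sum>i\<le>degree p. coeff p i * (y ^ i / exp y)) \<longlongrightarrow> 0) at_top"
    by (intro tendsto_null_sum tendsto_mult_right_zero tendsto_power_div_exp_0)
  moreover have "poly p y * exp (- y) = (\<Sum>i\<le>degree p. coeff p i * (y ^ i / exp y))" for y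
    by (simp add: poly_altdef sum_distrib_right exp_minus divide_inverse mult.assoc)
  ultimately show ?thesis by simp
qed

text \<open>For \<open>p = 1\<close> the standard flat function \<open>exp (- (1 / x))\<close>.
  Admitting polynomials in \<open>1 / x\<close> closes the family under differentiation, so that
  smoothness is an induction over all \<open>p\<close> at once.\<close>

definition flat_exp :: "real poly \<Rightarrow> real \<Rightarrow> real" where
  "flat_exp p x = (if x > 0 then poly p (1 / x) * exp (- (1 / x)) else 0)"

lemma flat_exp_has_derivative:
  "(flat_exp p has_real_derivative flat_exp ([:0, 0, 1:] * (p - pderiv p)) x) (at x)"
proof -
  consider "x < 0" | "x = 0" | "x > 0" by linarith
  then show ?thesis
  proof cases
    case 1
    have "((\<lambda>x. 0) has_real_derivative 0) (at x)" by simp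
    then have "(flat_exp p has_real_derivative 0) (at x)"
      by (rule has_field_derivative_transform_within_open[of _ _ _ "{..<0}"])
        (use 1 in \<open>auto simp: flat_exp_def\<close>)
    then show ?thesis using 1 by (simp add: flat_exp_def)
  next
    case 2
    have "((\<lambda>h. flat_exp p h / h) \<longlongrightarrow> 0) (at_right 0)"
    proof (rule Lim_transform_eventually)
      \<comment> \<open>Dividing by \<open>h\<close> multiplies the polynomial by its variable,
        which stands for \<open>1 / h\<close>; the exponential beats every polynomial.\<close>
      show "((\<lambda>h. poly (pCons 0 p) (inverse h) * exp (- inverse h)) \<longlongrightarrow> 0) (at_right 0)"
        by (rule filterlim_compose[OF poly_times_exp_minus_tendsto_0 filterlim_inverse_at_top_right])
      show "\<forall>\<^sub>F h in at_right 0. poly (pCons 0 p) (inverse h) * exp (- inverse h) = flat_exp p h / h"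
        by (rule eventually_at_rightI[of 0 1]) (auto simp: flat_exp_def field_simps)
    qed
    moreover have "((\<lambda>h. flat_exp p h / h) \<longlongrightarrow> 0) (at_left 0)"
    proof (rule Lim_transform_eventually)
      show "((\<lambda>h. 0) \<longlongrightarrow> (0::real)) (at_left 0)" by simp
      show "\<forall>\<^sub>F h in at_left 0. 0 = flat_exp p h / h"
        by (rule eventually_at_leftI[of "-1" 0]) (auto simp: flat_exp_def)
    qed
    ultimately have "((\<lambda>h. flat_exp p h / h) \<longlongrightarrow> 0) (at 0)"
      by (simp add: filterlim_split_at)
    then show ?thesis using 2 by (simp add: DERIV_def flat_exp_def)
  next
    case 3
    have "((\<lambda>x. poly p (1 / x) * exp (- (1 / x))) has_real_derivative
        poly (pderiv p) (1 / x) * (- 1 / x\<^sup>2) * exp (- (1 / x)) +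
        poly p (1 / x) * (exp (- (1 / x)) * (1 / x\<^sup>2))) (at x)"
      by (rule derivative_eq_intros poly_DERIV[THEN DERIV_chain2] refl | use 3 in \<open>simp add: power2_eq_square\<close>)+
    then have "(flat_exp p has_real_derivative
        poly (pderiv p) (1 / x) * (- 1 / x\<^sup>2) * exp (- (1 / x)) +
        poly p (1 / x) * (exp (- (1 / x)) * (1 / x\<^sup>2))) (at x)"
      by (rule has_field_derivative_transform_within_open[of _ _ _ "{0<..}"])
        (use 3 in \<open>auto simp: flat_exp_def\<close>)
    also have "poly (pderiv p) (1 / x) * (- 1 / x\<^sup>2) * exp (- (1 / x)) +
        poly p (1 / x) * (exp (- (1 / x)) * (1 / x\<^sup>2)) = flat_exp ([:0, 0, 1:] * (p - pderiv p)) x"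
      using 3 by (simp add: flat_exp_def field_simps power2_eq_square)
    finally show ?thesis .
  qed
qed

lemma C_k_on_flat_exp: "C_k_on k (flat_exp p) UNIV"
proof (induction k arbitrary: p)
  case 0
  show ?case
    unfolding C_k_on.simps by (rule DERIV_continuous_on[OF flat_exp_has_derivative])
next
  case (Suc k)
  let ?q = "[:0, 0, 1:] * (p - pderiv p)"
  show ?case
  proof (rule C_k_on_SucI)
    show "(flat_exp p has_derivative (\<lambda>v. flat_exp ?q x * v)) (at x)" for x
      using flat_exp_has_derivative[of p x] unfolding has_field_derivative_def .
    show "C_k_on k (\<lambda>x. flat_exp ?q x * v) UNIV" for v
      by (rule C_k_on_bounded_linear_compose[OF bounded_linear_mult_left open_UNIV Suc.IH])
  qed simp
qed

lemma mollifier_exists: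
  assumes "0 < \<delta>"
  obtains \<rho> :: "'e::euclidean_space \<Rightarrow> real" where
    "smooth_on \<rho> UNIV" "\<And>x. 0 \<le> \<rho> x" "\<And>x. \<delta> \<le> norm x \<Longrightarrow> \<rho> x = 0"
    "integrable lborel \<rho>" "(\<integral>x. \<rho> x \<partial>lborel) = 1"
proof -
  \<comment> \<open>The inner product instead of the norm keeps \<open>r\<close> smooth at the
    origin; \<open>r\<close> is positive exactly on the open ball of radius
    \<open>\<delta>\<close>.\<close>
  define r where "r x = flat_exp [:1:] (\<delta>\<^sup>2 - x \<bullet> x)" for x :: 'e
  have smooth: "C_k_on k r UNIV" for k
  proof -
    have "C_k_on k (\<lambda>x. - (x \<bullet> x)) (UNIV :: 'e set)"
      by (intro C_k_on_bounded_linear_compose[OF bounded_linear_minus[OF bounded_linear_ident]]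
          C_k_on_bilinear[OF bounded_bilinear_inner] C_k_on_bounded_linear) auto
    then have "C_k_on k (\<lambda>x. \<delta>\<^sup>2 + - (x \<bullet> x)) (UNIV :: 'e set)"
      by (intro C_k_on_add C_k_on_const) auto
    then show ?thesis unfolding r_def
      by (intro C_k_on_compose[OF _ _ _ C_k_on_flat_exp]) auto
  qed
  have cont: "continuous_on UNIV r" using smooth[of 0] by simp
  have nn: "0 \<le> r x" for x by (simp add: r_def flat_exp_def)
  have z: "r x = 0" if "\<delta> \<le> norm x" for x
    using that assms by (simp add: r_def flat_exp_def power2_norm_eq_inner[symmetric] power_mono not_less)
  have int: "integrable lborel (\<lambda>x. indicator (cball 0 \<delta>) x *\<^sub>R r x)"
    by (intro borel_integrable_compact continuous_on_subset[OF cont]) auto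
  have eq: "(\<lambda>x. indicator (cball 0 \<delta>) x *\<^sub>R r x) = r"
  proof
    show "indicator (cball 0 \<delta>) x *\<^sub>R r x = r x" for x
      using z[of x] by (cases "norm x \<le> \<delta>") auto
  qed
  have int: "integrable lborel r" using int unfolding eq .
  have "(\<integral>x. r x \<partial>lborel) \<noteq> 0"
  proof
    assume "(\<integral>x. r x \<partial>lborel) = 0"
    then have "AE x in lborel. r x = 0"
      using integral_nonneg_eq_0_iff_AE[OF int] nn by simp
    then have "AE x in lborel. x \<notin> ball (0::'e) \<delta>"
    proof (rule eventually_mono)
      fix x :: 'e assume "r x = 0"
      then show "x \<notin> ball 0 \<delta>"
        using assms by (auto simp: r_def flat_exp_def power2_norm_eq_inner[symmetric] power_strict_mono split: if_splits)
    qed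
    then have "emeasure lborel (ball (0::'e) \<delta>) = 0"
      by (subst (asm) AE_iff_measurable[of "ball 0 \<delta>"]) auto
    then show False using content_ball_pos[OF assms, of "0::'e"] by (simp add: measure_def)
  qed
  then have pos: "0 < (\<integral>x. r x \<partial>lborel)" using nn by (simp add: order.strict_iff_order)
  show thesis
  proof (rule that[of "\<lambda>x. r x / (\<integral>x. r x \<partial>lborel)"])
    show "smooth_on (\<lambda>x. r x / (\<integral>x. r x \<partial>lborel)) UNIV"
      unfolding smooth_on_def
      by (intro allI C_k_on_bounded_linear_compose[OF bounded_linear_divide] smooth) auto
  qed (use pos nn z int in auto)
qed

text \<open>Differentiation under the integral sign over a fixed box: all derivatives fall on the
  kernel, so continuity of \<open>H\<close> is enough.\<close>

lemma C_k_on_integral_kernel: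
  fixes \<rho> H :: "'e::euclidean_space \<Rightarrow> real"
  assumes H: "continuous_on UNIV H" and "C_k_on k \<rho> UNIV"
  shows "C_k_on k (\<lambda>p. integral (cbox a b) (\<lambda>z. \<rho> (p - z) * H z)) UNIV"
  using assms(2)
proof (induction k arbitrary: \<rho>)
  case 0
  then have c\<rho>: "continuous_on UNIV \<rho>" by simp
  have "continuous_on (UNIV \<times> cbox a b) (\<lambda>x. \<rho> (fst x - snd x) * H (snd x))"
    by (intro continuous_on_mult continuous_on_compose2[OF c\<rho>] continuous_on_compose2[OF H]
          continuous_on_diff continuous_on_fst continuous_on_snd continuous_on_id subset_UNIV)
  then have "continuous_on (UNIV \<times> cbox a b) (\<lambda>(p, z). \<rho> (p - z) * H z)"
    by (simp add: split_beta)
  then show ?case unfolding C_k_on.simps by (rule integral_continuous_on_param)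
next
  case (Suc k)
  let ?\<rho>' = "\<lambda>x. frechet_derivative \<rho> (at x)"
  have d: "(\<rho> has_derivative ?\<rho>' x) (at x)" for x by (rule C_k_on_SucD(1)[OF Suc.prems]) simp
  have bl: "bounded_linear (?\<rho>' x)" for x using d by (rule has_derivative_bounded_linear)
  have c\<rho>: "continuous_on UNIV \<rho>"
    by (rule continuous_at_imp_continuous_on) (intro ballI has_derivative_continuous[OF d])
  have "C_k_on k (\<lambda>x. ?\<rho>' x v) UNIV" for v by (rule C_k_on_SucD(2)[OF Suc.prems])
  then have C0: "C_k_on 0 (\<lambda>x. ?\<rho>' x v) UNIV" for v
    by (induction k) (use C_k_on_Suc_imp in blast)+
  \<comment> \<open>The Leibniz rule asks for a derivative that is continuous as a bounded linear
    map; in finite dimension continuity in each basis direction gives this.\<close>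
  define fx where "fx p z = H z *\<^sub>R Blinfun (?\<rho>' (p - z))" for p z
  have fx: "blinfun_apply (fx p z) v = ?\<rho>' (p - z) v * H z" for p z v
    by (simp add: fx_def scaleR_blinfun.rep_eq bounded_linear_Blinfun_apply[OF bl])
  have cont': "continuous_on (UNIV \<times> cbox a b) (\<lambda>(p, z). fx p z)"
  proof (rule continuous_on_blinfun_componentwise)
    fix i :: 'e
    have "continuous_on (UNIV \<times> cbox a b) (\<lambda>x. ?\<rho>' (fst x - snd x) i * H (snd x))"
      by (intro continuous_on_mult continuous_on_compose2[OF C0[of i, unfolded C_k_on.simps]] continuous_on_compose2[OF H]
          continuous_on_diff continuous_on_fst continuous_on_snd continuous_on_id subset_UNIV)
    then show "continuous_on (UNIV \<times> cbox a b) (\<lambda>x. blinfun_apply (case x of (p, z) \<Rightarrow> fx p z) i)"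
      by (simp add: split_beta fx)
  qed
  have int: "(\<lambda>z. fx p z) integrable_on cbox a b" for p
  proof (rule integrable_continuous)
    have "continuous_on (cbox a b) (\<lambda>z. case (p, z) of (p, z) \<Rightarrow> fx p z)"
      by (rule continuous_on_compose2[OF cont' continuous_on_Pair[OF continuous_on_const continuous_on_id]]) auto
    then show "continuous_on (cbox a b) (fx p)" by simp
  qed
  show ?case
  proof (rule C_k_on_SucI)
    fix p
    have "((\<lambda>p. integral (cbox a b) (\<lambda>z. \<rho> (p - z) * H z)) has_derivative
        blinfun_apply (integral (cbox a b) (fx p))) (at p within UNIV)"
    proof (rule leibniz_rule[OF _ _ cont'])
      fix p z
      have "((\<lambda>p. \<rho> (p - z)) has_derivative (\<lambda>v. ?\<rho>' (p - z) v)) (at p)"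
        by (rule has_derivative_compose[OF _ d, of "\<lambda>p. p - z" "\<lambda>v. v", simplified]) (auto intro!: derivative_eq_intros)
      then have "((\<lambda>p. \<rho> (p - z) * H z) has_derivative (\<lambda>v. ?\<rho>' (p - z) v * H z)) (at p)"
        by (rule has_derivative_mult_left)
      then show "((\<lambda>p. \<rho> (p - z) * H z) has_derivative blinfun_apply (fx p z)) (at p within UNIV)"
        by (simp add: fx[abs_def, symmetric])
      show "(\<lambda>z. \<rho> (p - z) * H z) integrable_on cbox a b"
        by (intro integrable_continuous continuous_on_mult continuous_on_compose2[OF c\<rho>] continuous_on_subset[OF H]
            continuous_on_diff continuous_on_const continuous_on_id subset_UNIV)
    qed auto
    then show "((\<lambda>p. integral (cbox a b) (\<lambda>z. \<rho> (p - z) * H z)) has_derivative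
        (\<lambda>v. integral (cbox a b) (\<lambda>z. ?\<rho>' (p - z) v * H z))) (at p)"
      using int[of p] by (simp add: fx[symmetric] blinfun_apply_integral[symmetric] )
  qed (simp, rule Suc.IH[OF C_k_on_SucD(2)[OF Suc.prems]])
qed


text \<open>Convolution with the shift put into \<open>H\<close>: it averages translates of
  \<open>H\<close>, so a bound that holds for every translate by a vector in the support of
  \<open>\<rho>\<close> passes to the mean. The form with the shift in the kernel appears in
  \<open>smooth_on_mollify\<close>.\<close>

definition mollify :: "('e::euclidean_space \<Rightarrow> real) \<Rightarrow> ('e \<Rightarrow> real) \<Rightarrow> 'e \<Rightarrow> real" where
  "mollify \<rho> H p = (\<integral>z. \<rho> z * H (p - z) \<partial>lborel)"

locale mollifier =
  fixes \<rho> :: "'e::euclidean_space \<Rightarrow> real" and \<delta> :: real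
  assumes delta: "0 < \<delta>" and smooth: "smooth_on \<rho> UNIV" and nonneg: "\<And>x. 0 \<le> \<rho> x"
    and support: "\<And>x. \<delta> \<le> norm x \<Longrightarrow> \<rho> x = 0"
    and integrable: "integrable lborel \<rho>" and mass: "(\<integral>x. \<rho> x \<partial>lborel) = 1"
begin

lemma continuous: "continuous_on UNIV \<rho>"
  using smooth[unfolded smooth_on_def, THEN spec[of _ 0]] by simp

lemma continuous_on_reflect:
  "continuous_on UNIV H \<Longrightarrow> continuous_on UNIV (\<lambda>z::'e. H (p - z) :: real)"
  by (rule continuous_on_compose2[of UNIV H]) (auto intro: continuous_intros)

lemma integrable_times:
  assumes "continuous_on UNIV \<Phi>"
  shows "integrable lborel (\<lambda>z. \<rho> z * \<Phi> z :: real)"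
proof -
  have "integrable lborel (\<lambda>z. indicator (cball 0 \<delta>) z *\<^sub>R (\<rho> z * \<Phi> z))"
    by (intro borel_integrable_compact compact_cball continuous_on_mult
        continuous_on_subset[OF assms] continuous_on_subset[OF continuous] subset_UNIV)
  moreover have "(\<lambda>z. indicator (cball 0 \<delta>) z *\<^sub>R (\<rho> z * \<Phi> z)) = (\<lambda>z. \<rho> z * \<Phi> z)"
  proof
    show "indicator (cball 0 \<delta>) z *\<^sub>R (\<rho> z * \<Phi> z) = \<rho> z * \<Phi> z" for z
      using support[of z] by (cases "norm z \<le> \<delta>") auto
  qed
  ultimately show ?thesis by (simp only:)
qed

lemma average_bound:
  assumes cont: "continuous_on UNIV \<Phi>" and B: "\<And>z. norm z < \<delta> \<Longrightarrow> \<bar>\<Phi> z\<bar> \<le> B"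
  shows "\<bar>\<integral>z. \<rho> z * \<Phi> z \<partial>lborel\<bar> \<le> B"
proof -
  have le: "\<bar>\<rho> z * \<Phi> z\<bar> \<le> \<rho> z * B" for z
    using B[of z] support[of z] nonneg[of z]
    by (cases "norm z < \<delta>") (auto simp: abs_mult intro: mult_left_mono)
  have "\<bar>\<integral>z. \<rho> z * \<Phi> z \<partial>lborel\<bar> \<le> (\<integral>z. \<bar>\<rho> z * \<Phi> z\<bar> \<partial>lborel)"
    by (rule integral_abs_bound)
  also have "\<dots> \<le> (\<integral>z. \<rho> z * B \<partial>lborel)"
    using le by (intro integral_mono integrable_abs integrable_times[OF cont] integrable_mult_left integrable) auto
  also have "\<dots> = B" using mass by simp
  finally show ?thesis .
qed

text \<open>As \<open>B\<close> may depend on \<open>p\<close> and \<open>q\<close>, this transfers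
  Lipschitz bounds to the mean: for the Euclidean distance when building a cutoff, and for lengths
  of curves in the smoothing step.\<close>

lemma mollify_diff_le:
  assumes cont: "continuous_on UNIV H" and B: "\<And>z. norm z < \<delta> \<Longrightarrow> \<bar>H (p - z) - H (q - z)\<bar> \<le> B"
  shows "\<bar>mollify \<rho> H p - mollify \<rho> H q\<bar> \<le> B"
proof -
  note c = continuous_on_reflect[OF cont]
  have "mollify \<rho> H p - mollify \<rho> H q = (\<integral>z. \<rho> z * (H (p - z) - H (q - z)) \<partial>lborel)"
    unfolding mollify_def
    by (subst Bochner_Integration.integral_diff[symmetric])
      (auto simp: right_diff_distrib intro: integrable_times c)
  then show ?thesis using average_bound[OF continuous_on_diff[OF c c] B] by simp
qed

lemma mollify_const [simp]: "mollify \<rho> (\<lambda>_. c) p = c"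
  using mass by (simp add: mollify_def)

lemma mollify_near:
  assumes cont: "continuous_on UNIV H" and B: "\<And>z. norm z < \<delta> \<Longrightarrow> \<bar>H (p - z) - c\<bar> \<le> B"
  shows "\<bar>mollify \<rho> H p - c\<bar> \<le> B"
proof -
  note c = continuous_on_reflect[OF cont]
  have "mollify \<rho> H p - mollify \<rho> (\<lambda>_. c) p = (\<integral>z. \<rho> z * (H (p - z) - c) \<partial>lborel)"
    unfolding mollify_def
    by (subst Bochner_Integration.integral_diff[symmetric])
      (auto simp: right_diff_distrib intro: integrable_times c integrable)
  then show ?thesis
    using average_bound[OF continuous_on_diff[OF c continuous_on_const] B] by simp
qed

lemma smooth_on_mollify:
  assumes cont: "continuous_on UNIV H"
  shows "smooth_on (mollify \<rho> H) UNIV"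
  unfolding smooth_on_def
proof (intro allI C_k_on_local)
  fix k and p0 :: 'e
  \<comment> \<open>For \<open>p\<close> within 1 of \<open>p0\<close> the kernel centred at
    \<open>p\<close> vanishes outside this box, so one box serves a whole neighbourhood.\<close>
  obtain a where a: "cball p0 (1 + \<delta>) \<subseteq> cbox (-a) a"
    using bounded_subset_cbox_symmetric[OF bounded_cball] by metis
  note c = continuous_on_reflect[OF cont]
  have eq: "integral (cbox (-a) a) (\<lambda>z. \<rho> (p - z) * H z) = mollify \<rho> H p" if p: "p \<in> ball p0 1" for p
  proof -
    have sub: "(\<lambda>z. p - z) = (\<lambda>z. p + (-1) *\<^sub>R z)" by (auto simp: fun_eq_iff)
    \<comment> \<open>Lebesgue measure is invariant under the reflection \<open>p - z\<close>, which
      moves the shift from \<open>H\<close> to the kernel.\<close>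
    have lb: "(lborel :: 'e measure) = distr lborel borel (\<lambda>z. p - z)"
      unfolding sub by (subst (1) lborel_affine[of "-1" p]) (auto simp: density_1)
    have zero: "\<rho> (p - z) * H z = 0" if "z \<notin> cbox (-a) a" for z
    proof -
      have "\<not> dist p0 z \<le> 1 + \<delta>" using a that by auto
      then have "\<delta> \<le> dist p z" using p dist_triangle[of p0 z p] by auto
      then show ?thesis using support[of "p - z"] by (simp add: dist_norm)
    qed
    have [measurable]: "(\<lambda>z. \<rho> z * H (p - z)) \<in> borel_measurable borel"
      by (intro borel_measurable_continuous_onI continuous_on_mult continuous c)
    have int: "integrable lborel (\<lambda>z. \<rho> z * H (p - z))" by (rule integrable_times[OF c])
    have "mollify \<rho> H p = (\<integral>z. \<rho> z * H (p - z) \<partial>distr lborel borel (\<lambda>z. p - z))"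
      unfolding mollify_def by (subst lb) simp
    also have "\<dots> = (\<integral>z. \<rho> (p - z) * H z \<partial>lborel)"
      by (subst integral_distr) auto
    also have "\<dots> = integral UNIV (\<lambda>z. \<rho> (p - z) * H z)"
    proof (rule integral_lborel[symmetric])
      show "integrable lborel (\<lambda>z. \<rho> (p - z) * H z)"
        using int by (subst (asm) lb, subst (asm) integrable_distr_eq) auto
    qed
    also have "\<dots> = integral (cbox (-a) a) (\<lambda>z. \<rho> (p - z) * H z)"
    proof -
      have "(\<lambda>z. \<rho> (p - z) * H z) = (\<lambda>z. if z \<in> cbox (-a) a then \<rho> (p - z) * H z else 0)"
        by (rule ext) (use zero in simp)
      then show ?thesis by (metis integral_restrict_UNIV)
    qed
    finally show ?thesis by simp
  qed
  have "C_k_on k (\<lambda>p. integral (cbox (-a) a) (\<lambda>z. \<rho> (p - z) * H z)) (ball p0 1)"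
    using smooth by (intro C_k_on_subset[OF C_k_on_integral_kernel[OF cont]]) (auto simp: smooth_on_def)
  then have "C_k_on k (mollify \<rho> H) (ball p0 1)"
    by (rule C_k_on_cong[OF open_ball eq, rotated])
  then show "\<exists>T. open T \<and> p0 \<in> T \<and> C_k_on k (mollify \<rho> H) T"
    by (intro exI[of _ "ball p0 1"]) auto
qed

end

lemma mollifier_obtain:
  assumes "0 < \<delta>"
  obtains \<rho> :: "'e::euclidean_space \<Rightarrow> real" where "mollifier \<rho> \<delta>"
  using mollifier_exists[OF assms] assms unfolding mollifier_def by metis

text \<open>That \<open>\<phi>\<close> is 1 on an open \<open>N\<close> around \<open>D\<close>, and
  not on \<open>D\<close> alone, will make the blended function equal to the mollification on an
  open set; the Lipschitz bound \<open>K\<close> controls the error caused by blending.\<close>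

lemma smooth_cutoff_exists:
  fixes D G :: "'e::euclidean_space set"
  assumes "compact D" "open G" "D \<subseteq> G"
  obtains \<phi> :: "'e \<Rightarrow> real" and N S K where "smooth_on \<phi> UNIV" "\<And>x. 0 \<le> \<phi> x \<and> \<phi> x \<le> 1"
    "K-lipschitz_on UNIV \<phi>" "open N" "D \<subseteq> N" "\<And>x. x \<in> N \<Longrightarrow> \<phi> x = 1"
    "compact S" "S \<subseteq> G" "\<And>x. x \<notin> S \<Longrightarrow> \<phi> x = 0"
proof (cases "D = {}")
  case True
  show thesis
    by (rule that[of "\<lambda>_. 0" 0 "{}" "{}"]) (auto simp: True smooth_on_def C_k_on_const intro: lipschitz_onI)
next
  case False
  obtain e where e: "e > 0" "{x. infdist x D \<le> e} \<subseteq> G"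
    using compact_in_open_separated[OF False assms] by metis
  \<comment> \<open>\<open>\<psi>\<close> is 1 up to distance \<open>r\<close> from \<open>D\<close>
    and 0 from \<open>2 * r\<close> on. Averaging at scale \<open>r/2\<close> preserves the value 1
    at distance less than \<open>r/2\<close> and the value 0 at distance more than
    \<open>e = 3 * r\<close>.\<close>
  define r where "r = e / 3"
  have r: "r > 0" using e by (simp add: r_def)
  define \<psi> where "\<psi> x = max 0 (min 1 (2 - infdist x D / r))" for x
  have lipD: "\<bar>infdist x D - infdist y D\<bar> \<le> dist x y" for x y
    using infdist_triangle[of x D y] infdist_triangle[of y D x] by (auto simp: dist_commute)
  have \<psi>lip: "\<bar>\<psi> x - \<psi> y\<bar> \<le> (1 / r) * dist x y" for x y
  proof -
    have "\<bar>\<psi> x - \<psi> y\<bar> \<le> \<bar>infdist x D / r - infdist y D / r\<bar>" unfolding \<psi>_def by linarith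
    also have "\<dots> = \<bar>infdist x D - infdist y D\<bar> / r" using r by (simp add: diff_divide_distrib[symmetric])
    also have "\<dots> \<le> dist x y / r" using lipD r by (intro divide_right_mono) auto
    finally show ?thesis by simp
  qed
  have "(1/r)-lipschitz_on UNIV \<psi>"
    by (rule lipschitz_onI) (use \<psi>lip r in \<open>auto simp: dist_real_def\<close>)
  then have cont: "continuous_on UNIV \<psi>" by (rule lipschitz_on_continuous_on)
  obtain \<rho> :: "'e \<Rightarrow> real" where "mollifier \<rho> (r/2)" using mollifier_obtain[of "r/2"] r by auto
  then interpret mollifier \<rho> "r/2" .
  have near: "infdist (x - z) D < infdist x D + r / 2 \<and> infdist x D < infdist (x - z) D + r / 2"
    if "norm z < r / 2" for x z
  proof -
    have "\<bar>infdist (x - z) D - infdist x D\<bar> < r / 2"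
      using lipD[of "x - z" x] that unfolding dist_norm by simp
    then show ?thesis unfolding abs_less_iff by linarith
  qed
  show thesis
  proof (rule that[of "mollify \<rho> \<psi>" "1/r" "{x. infdist x D < r / 2}" "{x. infdist x D \<le> e}"])
    show "smooth_on (mollify \<rho> \<psi>) UNIV" by (rule smooth_on_mollify[OF cont])
    fix x
    \<comment> \<open>Both bounds at once, since \<open>\<psi>\<close> takes values within 1/2 of
      1/2.\<close>
    have "\<bar>mollify \<rho> \<psi> x - 1/2\<bar> \<le> 1/2"
    proof (rule mollify_near[OF cont])
      fix z :: 'e
      have "0 \<le> \<psi> (x - z)" "\<psi> (x - z) \<le> 1" unfolding \<psi>_def by auto
      then show "\<bar>\<psi> (x - z) - 1/2\<bar> \<le> 1/2" by linarith
    qed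
    then show "0 \<le> mollify \<rho> \<psi> x \<and> mollify \<rho> \<psi> x \<le> 1" by linarith
  next
    show "(1/r)-lipschitz_on UNIV (mollify \<rho> \<psi>)"
    proof (rule lipschitz_onI)
      fix x y :: 'e
      show "dist (mollify \<rho> \<psi> x) (mollify \<rho> \<psi> y) \<le> 1 / r * dist x y"
        unfolding dist_real_def
      proof (rule mollify_diff_le[OF cont])
        show "\<bar>\<psi> (x - z) - \<psi> (y - z)\<bar> \<le> 1 / r * dist x y" for z
          using \<psi>lip[of "x - z" "y - z"] by (simp only: dist_norm) simp
      qed
    qed (use r in simp)
    show "open {x. infdist x D < r / 2}"
      by (intro open_Collect_less continuous_on_infdist continuous_on_id continuous_on_const)
    show "D \<subseteq> {x. infdist x D < r / 2}" using r by auto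
  next
    fix x assume x: "x \<in> {x. infdist x D < r / 2}"
    have "\<bar>mollify \<rho> \<psi> x - 1\<bar> \<le> 0"
    proof (rule mollify_near[OF cont])
      fix z :: 'e assume "norm z < r / 2"
      then have "infdist (x - z) D \<le> r" using near[of z x] x by auto
      then have "infdist (x - z) D / r \<le> 1" using r by simp
      then show "\<bar>\<psi> (x - z) - 1\<bar> \<le> 0" unfolding \<psi>_def by linarith
    qed
    then show "mollify \<rho> \<psi> x = 1" by simp
  next
    show "compact {x. infdist x D \<le> e}"
      by (rule compact_infdist_le) (use False assms e in auto)
    fix x assume x: "x \<notin> {x. infdist x D \<le> e}"
    have "\<bar>mollify \<rho> \<psi> x - 0\<bar> \<le> 0"
    proof (rule mollify_near[OF cont])
      fix z :: 'e assume "norm z < r / 2"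
      then have "infdist (x - z) D \<ge> 2 * r" using near[of z x] x r unfolding r_def by auto
      then have "infdist (x - z) D / r \<ge> 2" using r by (simp add: field_simps)
      then show "\<bar>\<psi> (x - z) - 0\<bar> \<le> 0" unfolding \<psi>_def by linarith
    qed
    then show "mollify \<rho> \<psi> x = 0" by simp
  qed (use e in auto)
qed

section \<open>Charts and tangent vectors\<close>

text \<open>The mean value inequality on a compact convex set; the operator norm is bounded through
  the basis, as \<open>C_k_on\<close> gives continuity direction by direction. It lets Lipschitz
  bounds for a curve pass from one chart to another.\<close>

lemma C1_lipschitz_on_cball:
  fixes f :: "'e::euclidean_space \<Rightarrow> 'b::real_normed_vector"
  assumes C1: "C_k_on (Suc 0) f S" and sub: "cball p r \<subseteq> S"
  obtains K where "K-lipschitz_on (cball p r) f"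
proof -
  let ?f' = "\<lambda>x. frechet_derivative f (at x)"
  have d: "(f has_derivative ?f' x) (at x)" if "x \<in> cball p r" for x
    using C_k_on_SucD(1)[OF C1] that sub by auto
  have "\<exists>B. \<forall>x\<in>cball p r. norm (?f' x b) \<le> B" for b
  proof -
    have "continuous_on (cball p r) (\<lambda>x. ?f' x b)"
      using C_k_on_SucD(2)[OF C1, of b] sub by (auto intro: continuous_on_subset)
    then have "bounded ((\<lambda>x. ?f' x b) ` cball p r)"
      by (intro compact_imp_bounded compact_continuous_image) auto
    then show ?thesis unfolding bounded_iff by auto
  qed
  then obtain B where B: "\<And>b x. x \<in> cball p r \<Longrightarrow> norm (?f' x b) \<le> B b" by metis
  define K where "K = (\<Sum>b\<in>Basis. \<bar>B b\<bar>)"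
  have on: "onorm (?f' x) \<le> K" if x: "x \<in> cball p r" for x
  proof (rule onorm_le)
    fix v :: 'e
    have "?f' x v = (\<Sum>b\<in>Basis. (v \<bullet> b) *\<^sub>R ?f' x b)"
      by (rule linear_eq_sum_Basis[OF has_derivative_linear[OF d[OF x]]])
    also have "norm \<dots> \<le> (\<Sum>b\<in>Basis. norm v * \<bar>B b\<bar>)"
    proof (rule sum_norm_le)
      fix b :: 'e assume b: "b \<in> Basis"
      have "norm ((v \<bullet> b) *\<^sub>R ?f' x b) = \<bar>v \<bullet> b\<bar> * norm (?f' x b)" by simp
      also have "\<dots> \<le> norm v * \<bar>B b\<bar>"
        using B[OF x, of b] Basis_le_norm[OF b, of v] by (intro mult_mono) auto
      finally show "norm ((v \<bullet> b) *\<^sub>R ?f' x b) \<le> norm v * \<bar>B b\<bar>" .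
    qed
    also have "\<dots> = K * norm v" unfolding K_def by (simp only: sum_distrib_left[symmetric] mult.commute)
    finally show "norm (?f' x v) \<le> K * norm v" .
  qed
  have "K-lipschitz_on (cball p r) f"
  proof (rule lipschitz_onI)
    fix x y assume xy: "x \<in> cball p r" "y \<in> cball p r"
    show "dist (f x) (f y) \<le> K * dist x y"
      unfolding dist_norm
      by (rule differentiable_bound[OF convex_cball has_derivative_at_withinI[OF d] on xy])
  qed (auto simp: K_def sum_nonneg)
  then show thesis by (rule that)
qed

locale smooth_manifold =
  fixes A :: "('a::{t2_space, second_countable_topology}, 'e::euclidean_space) chart set"
  assumes atlas: "smooth_atlas A"
begin

lemma chart:
  assumes "c \<in> A"
  shows open_dom: "open (dom_chart c)" and open_img: "open (img_chart c)"
    and continuous_coord: "continuous_on (dom_chart c) (coord c)"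
    and continuous_inv_coord: "continuous_on (img_chart c) (inv_coord c)"
    and inv_coord_coord: "\<And>x. x \<in> dom_chart c \<Longrightarrow> inv_coord c (coord c x) = x"
    and coord_inv_coord: "\<And>p. p \<in> img_chart c \<Longrightarrow> coord c (inv_coord c p) = p"
    and coord_in_img: "\<And>x. x \<in> dom_chart c \<Longrightarrow> coord c x \<in> img_chart c"
    and inv_coord_in_dom: "\<And>p. p \<in> img_chart c \<Longrightarrow> inv_coord c p \<in> dom_chart c"
proof -
  have c: "is_chart c" using atlas assms by (auto simp: smooth_atlas_def)
  then have h: "homeomorphism (dom_chart c) (img_chart c) (coord c) (inv_coord c)"
    by (simp add: is_chart_def)
  show "open (dom_chart c)" "open (img_chart c)" using c by (auto simp: is_chart_def)
  show "continuous_on (dom_chart c) (coord c)" "continuous_on (img_chart c) (inv_coord c)"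
    using h by (auto simp: homeomorphism_def)
  show "x \<in> dom_chart c \<Longrightarrow> inv_coord c (coord c x) = x" for x
    using h by (auto simp: homeomorphism_def)
  show "p \<in> img_chart c \<Longrightarrow> coord c (inv_coord c p) = p" for p
    using h by (auto simp: homeomorphism_def)
  show "x \<in> dom_chart c \<Longrightarrow> coord c x \<in> img_chart c" for x
    using h by (auto simp: homeomorphism_def)
  show "p \<in> img_chart c \<Longrightarrow> inv_coord c p \<in> dom_chart c" for p
    using h by (auto simp: homeomorphism_def)
qed

lemma chart_at_exists: obtains c where "c \<in> charts_at A x"
proof -
  have "x \<in> (\<Union>c\<in>A. dom_chart c)" using atlas unfolding smooth_atlas_def by blast
  then show thesis using that by (auto simp: charts_at_def)
qed

lemma open_coord_image:
  assumes "c \<in> A" "open U" "U \<subseteq> dom_chart c"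
  shows "open (coord c ` U)"
proof -
  have "coord c ` U = img_chart c \<inter> inv_coord c -` U"
    using assms(3) by (auto simp: chart[OF assms(1)] subset_iff image_iff) (metis chart(6)[OF assms(1)])
  then show ?thesis
    using continuous_open_preimage[OF continuous_inv_coord open_img] assms by simp
qed

lemma open_inv_coord_image:
  assumes "c \<in> A" "open U" "U \<subseteq> img_chart c"
  shows "open (inv_coord c ` U)"
proof -
  have "inv_coord c ` U = dom_chart c \<inter> coord c -` U"
    using assms(3) by (auto simp: chart[OF assms(1)] subset_iff image_iff) (metis chart(5)[OF assms(1)])
  then show ?thesis
    using continuous_open_preimage[OF continuous_coord open_dom] assms by simp
qed

lemma compact_coord_image:
  "c \<in> A \<Longrightarrow> compact Q \<Longrightarrow> Q \<subseteq> dom_chart c \<Longrightarrow> compact (coord c ` Q)"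
  by (intro compact_continuous_image continuous_on_subset[OF continuous_coord])

lemma compact_inv_coord_image:
  "c \<in> A \<Longrightarrow> compact Q \<Longrightarrow> Q \<subseteq> img_chart c \<Longrightarrow> compact (inv_coord c ` Q)"
  by (intro compact_continuous_image continuous_on_subset[OF continuous_inv_coord])

abbreviation overlap :: "('a, 'e) chart \<Rightarrow> ('a, 'e) chart \<Rightarrow> 'e set" where
  "overlap c c' \<equiv> coord c ` (dom_chart c \<inter> dom_chart c')"

lemma open_overlap: "c \<in> A \<Longrightarrow> c' \<in> A \<Longrightarrow> open (overlap c c')"
  by (intro open_coord_image open_Int open_dom) auto

lemma C_k_on_transition: "c \<in> A \<Longrightarrow> c' \<in> A \<Longrightarrow> C_k_on k (transition c c') (overlap c c')"
  using atlas by (auto simp: smooth_atlas_def smooth_on_def)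

lemma transition_coord: "c \<in> A \<Longrightarrow> x \<in> dom_chart c \<Longrightarrow> transition c c' (coord c x) = coord c' x"
  by (simp add: transition_def inv_coord_coord)

lemma transition_has_derivative:
  assumes "c \<in> charts_at A x" "c' \<in> charts_at A x"
  shows "(transition c c' has_derivative frechet_derivative (transition c c') (at (coord c x))) (at (coord c x))"
  using assms by (intro C_k_on_SucD(1)[OF C_k_on_transition[of c c' "Suc 0"]]) (auto simp: charts_at_def)

text \<open>The chain rule near \<open>coord c x\<close>. It is the reason why coordinates in a
  single chart determine a tangent vector (\<open>tvec_of_in_tangent_space\<close>).\<close>

lemma transition_derivative_compose:
  assumes c: "c \<in> charts_at A x" "c' \<in> charts_at A x" "c'' \<in> charts_at A x"
  shows "frechet_derivative (transition c' c'') (at (coord c' x))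
      (frechet_derivative (transition c c') (at (coord c x)) w) =
    frechet_derivative (transition c c'') (at (coord c x)) w"
proof -
  have A: "c \<in> A" "c' \<in> A" "c'' \<in> A" and x: "x \<in> dom_chart c" "x \<in> dom_chart c'" "x \<in> dom_chart c''"
    using c by (auto simp: charts_at_def)
  have "((\<lambda>p. transition c' c'' (transition c c' p)) has_derivative
      (\<lambda>w. frechet_derivative (transition c' c'') (at (coord c' x))
        (frechet_derivative (transition c c') (at (coord c x)) w))) (at (coord c x))"
    using transition_has_derivative[OF c(2,3)] transition_coord[OF A(1) x(1), of c']
    by (intro has_derivative_compose[OF transition_has_derivative[OF c(1,2)]]) simp
  then have "(transition c c'' has_derivative
      (\<lambda>w. frechet_derivative (transition c' c'') (at (coord c' x))
        (frechet_derivative (transition c c') (at (coord c x)) w))) (at (coord c x))"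
  proof (rule has_derivative_transform_within_open)
    show "open (coord c ` (dom_chart c \<inter> dom_chart c' \<inter> dom_chart c''))"
      using A by (intro open_coord_image open_Int open_dom) auto
    show "coord c x \<in> coord c ` (dom_chart c \<inter> dom_chart c' \<inter> dom_chart c'')" using x by auto
    fix p assume "p \<in> coord c ` (dom_chart c \<inter> dom_chart c' \<inter> dom_chart c'')"
    then show "transition c' c'' (transition c c' p) = transition c c'' p"
      using A by (auto simp: transition_coord)
  qed
  from frechet_derivative_at[OF this] show ?thesis by metis
qed

lemma tvec_of_in_tangent_space: "c \<in> charts_at A x \<Longrightarrow> tvec_of A c x w \<in> tangent_space A x"
  by (auto simp: tangent_space_def tvec_of_def transition_derivative_compose)

lemma tvec_of_scaleR:
  assumes "c \<in> charts_at A x"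
  shows "tvec_of A c x (r *\<^sub>R w) = (\<lambda>c'. r *\<^sub>R tvec_of A c x w c')"
  using linear_scale[OF has_derivative_linear[OF transition_has_derivative[OF assms]]]
  by (auto simp: tvec_of_def fun_eq_iff)

end

text \<open>Evaluating the derivative at \<open>w\<close> differentiates \<open>h\<close> along the
  ray, where it is constant. In \<open>Fl_pos\<close> this is applied to the square of the metric on
  a fibre, and then to the derivative of that square in the direction \<open>w\<close>.\<close>

lemma radial_derivative_zero:
  fixes h :: "'e::euclidean_space \<Rightarrow> real"
  assumes h: "(h has_derivative h') (at (s *\<^sub>R w))" and z: "\<And>t. 0 < t \<Longrightarrow> h (t *\<^sub>R w) = 0" and s: "0 < s"
  shows "h' w = 0"
proof -
  have "((\<lambda>t. t *\<^sub>R w) has_derivative (\<lambda>t. t *\<^sub>R w)) (at s)"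
    by (rule bounded_linear_imp_has_derivative[OF bounded_linear_scaleR_left])
  from has_derivative_compose[OF this h]
  have 1: "((\<lambda>t. h (t *\<^sub>R w)) has_derivative (\<lambda>t. h' (t *\<^sub>R w))) (at s)" .
  have 2: "((\<lambda>t. h (t *\<^sub>R w)) has_derivative (\<lambda>t. 0)) (at s)"
    by (rule has_derivative_transform_within_open[OF has_derivative_const[of 0] open_greaterThan[of 0]])
      (use s z in auto)
  from has_derivative_unique[OF 1 2] have "h' (1 *\<^sub>R w) = 0" by metis
  then show ?thesis by simp
qed

locale finsler_manifold = smooth_manifold A
  for A :: "('a::{t2_space, second_countable_topology}, 'e::euclidean_space) chart set" +
  fixes F :: "'a \<Rightarrow> ('a, 'e) tvec \<Rightarrow> real"
  assumes finsler: "finsler_metric A F"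
begin

abbreviation Fl :: "('a, 'e) chart \<Rightarrow> 'e \<times> 'e \<Rightarrow> real" where
  "Fl \<equiv> local_expr A F"

lemma Fl_continuous: "c \<in> A \<Longrightarrow> continuous_on (img_chart c \<times> UNIV) (Fl c)"
  using finsler by (auto simp: finsler_metric_def)

lemma charts_at_inv_coord: "c \<in> A \<Longrightarrow> p \<in> img_chart c \<Longrightarrow> c \<in> charts_at A (inv_coord c p)"
  by (simp add: charts_at_def inv_coord_in_dom)

lemma Fl_nonneg: "c \<in> A \<Longrightarrow> p \<in> img_chart c \<Longrightarrow> 0 \<le> Fl c (p, w)"
  using finsler by (simp add: finsler_metric_def local_expr_def tvec_of_in_tangent_space charts_at_inv_coord)

lemma F_homogeneous: "v \<in> tangent_space A x \<Longrightarrow> F x (\<lambda>c. r *\<^sub>R v c) = \<bar>r\<bar> * F x v"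
  using finsler by (simp add: finsler_metric_def)

lemma Fl_scaleR: "c \<in> A \<Longrightarrow> p \<in> img_chart c \<Longrightarrow> Fl c (p, r *\<^sub>R w) = \<bar>r\<bar> * Fl c (p, w)"
  by (simp add: local_expr_def tvec_of_scaleR F_homogeneous tvec_of_in_tangent_space charts_at_inv_coord)

text \<open>If \<open>F\<close> vanished at \<open>w\<close>, then by homogeneity \<open>F\<^sup>2\<close> would vanish on the ray through \<open>w\<close>, and
  its Hessian at \<open>w\<close> would not be positive in the direction \<open>w\<close>.\<close>

lemma Fl_pos:
  assumes c: "c \<in> A" and p: "p \<in> img_chart c" and w: "w \<noteq> 0"
  shows "0 < Fl c (p, w)"
proof (rule ccontr)
  assume "\<not> 0 < Fl c (p, w)"
  then have z: "Fl c (p, w) = 0" using Fl_nonneg[OF c p, of w] by simp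
  define x where "x = inv_coord c p"
  define g where "g w = (F x (tvec_of A c x w))\<^sup>2" for w
  have ch: "c \<in> charts_at A x" unfolding x_def by (rule charts_at_inv_coord[OF c p])
  have g_eq: "g w = Fl c (p, w) * Fl c (p, w)" for w
    by (simp add: g_def local_expr_def x_def power2_eq_square)
  have g0: "g (t *\<^sub>R w) = 0" for t by (simp add: g_eq Fl_scaleR[OF c p] z)
  have oT: "open (img_chart c \<times> (UNIV - {0 :: 'e}))" by (intro open_Times open_img[OF c]) auto
  have oS: "open (UNIV - {0 :: 'e})" by auto
  have "C_k_on 2 (\<lambda>w. (p, 0 :: 'e) + (0, w)) (UNIV - {0})"
    by (intro C_k_on_add oS C_k_on_const C_k_on_bounded_linear bounded_linear_Pair bounded_linear_zero bounded_linear_ident)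
  then have Cp: "C_k_on 2 (\<lambda>w. (p, w)) (UNIV - {0 :: 'e})" by simp
  have "C_k_on 2 (Fl c) (img_chart c \<times> (UNIV - {0}))"
    using finsler c by (auto simp: finsler_metric_def smooth_on_def)
  from C_k_on_compose[OF oS oT _ this Cp] have "C_k_on 2 (\<lambda>w. Fl c (p, w)) (UNIV - {0})"
    using p by auto
  then have "C_k_on 2 (\<lambda>w. Fl c (p, w) * Fl c (p, w)) (UNIV - {0})"
    by (intro C_k_on_bilinear[OF bounded_bilinear_mult oS])
  then have C2: "C_k_on (Suc (Suc 0)) g (UNIV - {0})"
    unfolding g_eq[abs_def] numeral_2_eq_2 .
  \<comment> \<open>\<open>hessian g w w w\<close> is the derivative of this function of
    \<open>z\<close> at \<open>w\<close> in the direction \<open>w\<close>, so it vanishes once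
    \<open>?D\<close> is known to vanish along the ray.\<close>
  let ?D = "\<lambda>z. frechet_derivative g (at z) w"
  have D0: "?D (t *\<^sub>R w) = 0" if t: "0 < t" for t
  proof -
    have "(g has_derivative frechet_derivative g (at (t *\<^sub>R w))) (at (t *\<^sub>R w))"
      by (rule C_k_on_SucD(1)[OF C2]) (use t w in auto)
    then show ?thesis using g0 t by (rule radial_derivative_zero)
  qed
  have "(?D has_derivative frechet_derivative ?D (at (1 *\<^sub>R w))) (at (1 *\<^sub>R w))"
    by (rule C_k_on_SucD(1)[OF C_k_on_SucD(2)[OF C2]]) (use w in auto)
  then have "frechet_derivative ?D (at (1 *\<^sub>R w)) w = 0"
    using D0 zero_less_one by (rule radial_derivative_zero)
  then have "hessian g w w w = 0" by (simp add: hessian_def)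
  moreover have "hessian_pos_def g w"
    using finsler ch w unfolding finsler_metric_def g_def by blast
  ultimately show False using w by (auto simp: hessian_pos_def_def)
qed

end

section \<open>Lipschitz curves and Finsler length\<close>

context smooth_manifold
begin

text \<open>\<open>lipschitz_curve\<close> with a free parameter set, so that curves can be cut,
  concatenated and reparametrized.\<close>

definition lip_path :: "(real \<Rightarrow> 'a) \<Rightarrow> real set \<Rightarrow> bool" where
  "lip_path \<gamma> I \<longleftrightarrow> (\<forall>t\<in>I. \<exists>c\<in>charts_at A (\<gamma> t). \<exists>e>0. \<exists>L.
     \<gamma> ` (I \<inter> ball t e) \<subseteq> dom_chart c \<and> L-lipschitz_on (I \<inter> ball t e) (coord c \<circ> \<gamma>))"

lemma lipschitz_curve_eq: "lipschitz_curve A \<gamma> \<longleftrightarrow> lip_path \<gamma> {0..1}"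
  by (simp add: lipschitz_curve_def lip_path_def)

lemma lip_path_subset:
  assumes "lip_path \<gamma> I" "J \<subseteq> I"
  shows "lip_path \<gamma> J"
  unfolding lip_path_def
proof
  fix t assume "t \<in> J"
  then have "t \<in> I" using assms(2) by auto
  then obtain c e L where c: "c \<in> charts_at A (\<gamma> t)" "e > 0" "\<gamma> ` (I \<inter> ball t e) \<subseteq> dom_chart c"
    "L-lipschitz_on (I \<inter> ball t e) (coord c \<circ> \<gamma>)"
    using assms(1) unfolding lip_path_def by blast
  have "J \<inter> ball t e \<subseteq> I \<inter> ball t e" using assms(2) by auto
  then have "\<gamma> ` (J \<inter> ball t e) \<subseteq> dom_chart c" "L-lipschitz_on (J \<inter> ball t e) (coord c \<circ> \<gamma>)"
    using c lipschitz_on_subset by blast+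
  then show "\<exists>c\<in>charts_at A (\<gamma> t). \<exists>e>0. \<exists>L. \<gamma> ` (J \<inter> ball t e) \<subseteq> dom_chart c \<and>
      L-lipschitz_on (J \<inter> ball t e) (coord c \<circ> \<gamma>)"
    using c by blast
qed

text \<open>The definition provides some chart at \<open>\<gamma> t\<close>; transition maps are
  locally Lipschitz, so every chart there will do.\<close>

lemma lip_path_chart:
  assumes "lip_path \<gamma> I" "t \<in> I" "c \<in> charts_at A (\<gamma> t)"
  obtains e L where "0 < e" "\<gamma> ` (I \<inter> ball t e) \<subseteq> dom_chart c" "L-lipschitz_on (I \<inter> ball t e) (coord c \<circ> \<gamma>)"
proof -
  obtain c0 e0 L0 where c0: "c0 \<in> charts_at A (\<gamma> t)" "e0 > 0" "\<gamma> ` (I \<inter> ball t e0) \<subseteq> dom_chart c0"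
    and L0: "L0-lipschitz_on (I \<inter> ball t e0) (coord c0 \<circ> \<gamma>)"
    using assms(1,2) unfolding lip_path_def by blast
  have A: "c \<in> A" "c0 \<in> A" and x: "\<gamma> t \<in> dom_chart c" "\<gamma> t \<in> dom_chart c0"
    using assms(3) c0(1) by (auto simp: charts_at_def)
  let ?u = "\<lambda>s. coord c0 (\<gamma> s)"
  have "?u t \<in> overlap c0 c" using x by auto
  then obtain r where r: "r > 0" "cball (?u t) r \<subseteq> overlap c0 c"
    using open_overlap[OF A(2,1)] open_contains_cball by blast
  obtain K where K: "K-lipschitz_on (cball (?u t) r) (transition c0 c)"
    using C1_lipschitz_on_cball[OF C_k_on_transition[OF A(2,1)] r(2)] .
  have L0nn: "L0 \<ge> 0" using L0 by (rule lipschitz_on_nonneg)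
  have Knn: "K \<ge> 0" using K by (rule lipschitz_on_nonneg)
  \<comment> \<open>So small that the coordinates in \<open>c0\<close> stay in the ball on which the
    transition map is \<open>K\<close>-Lipschitz; \<open>L0 + 1\<close> avoids a division by
    0.\<close>
  define e where "e = min e0 (r / (L0 + 1))"
  have e: "e > 0" using c0(2) r(1) L0nn by (simp add: e_def)
  have sub: "s \<in> I \<inter> ball t e0" if "s \<in> I \<inter> ball t e" for s using that by (auto simp: e_def)
  have near: "?u s \<in> cball (?u t) r" if s: "s \<in> I \<inter> ball t e" for s
  proof -
    have "dist (?u t) (?u s) \<le> L0 * dist t s"
      using lipschitz_onD[OF L0 _ sub[OF s], of t] assms(2) c0(2) by simp
    also have "\<dots> \<le> (L0 + 1) * (r / (L0 + 1))"
      using s L0nn by (intro mult_mono) (auto simp: e_def)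
    also have "\<dots> = r" using L0nn by simp
    finally show ?thesis by simp
  qed
  have in_dom: "\<gamma> s \<in> dom_chart c" if s: "s \<in> I \<inter> ball t e" for s
  proof -
    obtain y where y: "y \<in> dom_chart c0" "y \<in> dom_chart c" "?u s = coord c0 y"
      using near[OF s] r(2) by blast
    have "\<gamma> s \<in> dom_chart c0" using sub[OF s] c0(3) by blast
    then have "\<gamma> s = y" using y(1,3) inv_coord_coord[OF A(2)] by metis
    then show ?thesis using y by simp
  qed
  have tr: "(coord c \<circ> \<gamma>) s = transition c0 c (?u s)" if s: "s \<in> I \<inter> ball t e" for s
  proof -
    have "\<gamma> s \<in> dom_chart c0" using sub[OF s] c0(3) by blast
    then show ?thesis by (simp add: transition_coord[OF A(2)])
  qed
  have "(K * L0)-lipschitz_on (I \<inter> ball t e) (coord c \<circ> \<gamma>)"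
  proof (rule lipschitz_onI)
    fix s s' assume s: "s \<in> I \<inter> ball t e" "s' \<in> I \<inter> ball t e"
    have "dist ((coord c \<circ> \<gamma>) s) ((coord c \<circ> \<gamma>) s') \<le> K * dist (?u s) (?u s')"
      unfolding tr[OF s(1)] tr[OF s(2)] by (rule lipschitz_onD[OF K near[OF s(1)] near[OF s(2)]])
    also have "\<dots> \<le> K * (L0 * dist s s')"
      using lipschitz_onD[OF L0 sub[OF s(1)] sub[OF s(2)]] Knn by (intro mult_left_mono) auto
    finally show "dist ((coord c \<circ> \<gamma>) s) ((coord c \<circ> \<gamma>) s') \<le> K * L0 * dist s s'"
      by (simp add: mult.assoc)
  qed (use Knn L0nn in simp)
  then show thesis using that[OF e] in_dom by blast
qed

lemma lip_path_chart_cong: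
  assumes "lip_path \<gamma> I" "t \<in> I" "c \<in> charts_at A (\<gamma> t)"
    and J: "open J" "t \<in> J" "I' \<inter> J \<subseteq> I" "\<And>s. s \<in> J \<Longrightarrow> \<sigma> s = \<gamma> s"
  shows "\<exists>e>0. \<exists>L. \<sigma> ` (I' \<inter> ball t e) \<subseteq> dom_chart c \<and> L-lipschitz_on (I' \<inter> ball t e) (coord c \<circ> \<sigma>)"
proof -
  obtain e L where e: "0 < e" "\<gamma> ` (I \<inter> ball t e) \<subseteq> dom_chart c" "L-lipschitz_on (I \<inter> ball t e) (coord c \<circ> \<gamma>)"
    using lip_path_chart[OF assms(1-3)] .
  obtain r where r: "0 < r" "ball t r \<subseteq> J" using J(1,2) open_contains_ball by blast
  let ?B = "I' \<inter> ball t (min e r)"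
  have sub: "?B \<subseteq> I \<inter> ball t e" and eq: "\<sigma> s = \<gamma> s" if "s \<in> ?B" for s
    using that r(2) J(3,4) by (auto simp: subset_iff)
  have sub: "?B \<subseteq> I \<inter> ball t e" using sub by blast
  have "L-lipschitz_on ?B (coord c \<circ> \<sigma>)"
    by (rule lipschitz_on_transform[OF lipschitz_on_subset[OF e(3) sub]]) (simp add: eq)
  moreover have "\<sigma> ` ?B \<subseteq> dom_chart c" using e(2) sub eq by blast
  moreover have "0 < min e r" using e(1) r(1) by simp
  ultimately show ?thesis by blast
qed

lemma lip_path_continuous:
  assumes "lip_path \<gamma> I"
  shows "continuous_on I \<gamma>"
  unfolding continuous_on_eq_continuous_within
proof
  fix t assume t: "t \<in> I"
  obtain c where c: "c \<in> charts_at A (\<gamma> t)" by (rule chart_at_exists)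
  then have A: "c \<in> A" by (simp add: charts_at_def)
  obtain e L where e: "0 < e" "\<gamma> ` (I \<inter> ball t e) \<subseteq> dom_chart c" "L-lipschitz_on (I \<inter> ball t e) (coord c \<circ> \<gamma>)"
    using lip_path_chart[OF assms t c] .
  have "continuous_on (I \<inter> ball t e) (\<lambda>s. inv_coord c ((coord c \<circ> \<gamma>) s))"
    using e(2) by (intro continuous_on_compose2[OF continuous_inv_coord[OF A] lipschitz_on_continuous_on[OF e(3)]])
      (auto intro!: coord_in_img[OF A])
  moreover have "inv_coord c ((coord c \<circ> \<gamma>) s) = \<gamma> s" if "s \<in> I \<inter> ball t e" for s
    using that e(2) by (auto intro!: inv_coord_coord[OF A])
  ultimately have "continuous_on (I \<inter> ball t e) \<gamma>" by (rule continuous_on_eq)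
  then have "continuous (at t within I \<inter> ball t e) \<gamma>"
    using t e(1) by (simp add: continuous_on_eq_continuous_within)
  moreover have "at t within I \<inter> ball t e = at t within I"
    by (rule at_within_nhd[of _ "ball t e"]) (use e(1) in auto)
  ultimately show "continuous (at t within I) \<gamma>" by simp
qed

lemma lip_path_in_open:
  assumes "lip_path \<gamma> I" "t \<in> I" "open U" "\<gamma> t \<in> U"
  obtains e where "0 < e" "\<gamma> ` (I \<inter> ball t e) \<subseteq> U"
proof -
  obtain B where B: "open B" "t \<in> B" "\<And>s. s \<in> I \<Longrightarrow> s \<in> B \<Longrightarrow> \<gamma> s \<in> U"
    using lip_path_continuous[OF assms(1)] assms(2-) unfolding continuous_on_topological by metis
  then obtain e where "e > 0" "ball t e \<subseteq> B" using open_contains_ball by blast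
  then show thesis using that B(3) by blast
qed

text \<open>Bounds on adjacent intervals concatenate, so local ones combine by bisection:
  \<open>Bolzano\<close> serves here and below as the compactness argument.\<close>

lemma lip_path_lipschitz_in_chart:
  assumes \<gamma>: "lip_path \<gamma> {a..b}" "a \<le> b" "\<gamma> ` {a..b} \<subseteq> dom_chart c" "c \<in> A"
  obtains L where "L-lipschitz_on {a..b} (coord c \<circ> \<gamma>)"
proof -
  let ?u = "coord c \<circ> \<gamma>"
  let ?P = "\<lambda>x y. a \<le> x \<and> x \<le> y \<and> y \<le> b \<longrightarrow> (\<exists>L. L-lipschitz_on {x..y} ?u)"
  have "?P a b"
  proof (rule Bolzano[where P = ?P, OF \<open>a \<le> b\<close>])
    fix x y z assume *: "?P x y" "?P y z" "x \<le> y" "y \<le> z"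
    show "?P x z"
    proof
      assume "a \<le> x \<and> x \<le> z \<and> z \<le> b"
      then obtain L M where "L-lipschitz_on {x..y} ?u" "M-lipschitz_on {y..z} ?u" using * by auto
      from lipschitz_on_concat_max[OF this refl] show "\<exists>L. L-lipschitz_on {x..z} ?u" by auto
    qed
  next
    fix t assume t: "a \<le> t" "t \<le> b"
    then have c: "c \<in> charts_at A (\<gamma> t)" using \<gamma> by (auto simp: charts_at_def)
    obtain e L where e: "0 < e" "\<gamma> ` ({a..b} \<inter> ball t e) \<subseteq> dom_chart c"
      "L-lipschitz_on ({a..b} \<inter> ball t e) ?u"
      by (rule lip_path_chart[OF \<gamma>(1) _ c]) (use t in auto)
    have "?P x y" if "x \<le> t" "t \<le> y" "y - x < e" for x y
    proof
      assume "a \<le> x \<and> x \<le> y \<and> y \<le> b"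
      then have "{x..y} \<subseteq> {a..b} \<inter> ball t e" using that by (auto simp: dist_real_def)
      then show "\<exists>L. L-lipschitz_on {x..y} ?u" using e(3) lipschitz_on_subset by blast
    qed
    then show "\<exists>d>0. \<forall>x y. x \<le> t \<and> t \<le> y \<and> y - x < d \<longrightarrow> ?P x y" using e(1) by blast
  qed
  then show thesis using that \<open>a \<le> b\<close> by auto
qed

text \<open>Almost everywhere differentiability was proved for functions on the whole line, so the
  coordinate curve is extended by clamping the parameter to \<open>{a..b}\<close>. In the interior
  both curves agree locally, and the end points form a null set.\<close>

lemma lip_path_derivative_in_chart:
  assumes \<gamma>: "lip_path \<gamma> {a..b}" "a \<le> b" "\<gamma> ` {a..b} \<subseteq> dom_chart c" "c \<in> A"
  obtains g U K where "g \<in> borel_measurable borel" "K-lipschitz_on UNIV U" 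
    "\<And>t. U t \<in> img_chart c" "\<And>t. t \<in> {a..b} \<Longrightarrow> U t = coord c (\<gamma> t)"
    "AE t in lborel. t \<in> {a..b} \<longrightarrow> (U has_vector_derivative g t) (at t)"
    "AE t in lborel. t \<in> {a..b} \<longrightarrow> (coord c \<circ> \<gamma> has_vector_derivative g t) (at t)"
proof -
  obtain L where L: "L-lipschitz_on {a..b} (coord c \<circ> \<gamma>)"
    using lip_path_lipschitz_in_chart[OF \<gamma>] .
  define cl where "cl t = max a (min b t)" for t
  have cl: "cl t \<in> {a..b}" for t using \<open>a \<le> b\<close> by (auto simp: cl_def)
  have cl_id: "cl t = t" if "t \<in> {a..b}" for t using that by (auto simp: cl_def)
  define U where "U t = coord c (\<gamma> (cl t))" for t
  have U: "L-lipschitz_on UNIV U"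
  proof (rule lipschitz_onI)
    fix s t
    have "dist (U s) (U t) \<le> L * dist (cl s) (cl t)"
      using lipschitz_onD[OF L cl cl, of s t] by (simp add: U_def)
    also have "\<dots> \<le> L * dist s t"
      using lipschitz_on_nonneg[OF L] by (intro mult_left_mono) (auto simp: cl_def dist_real_def)
    finally show "dist (U s) (U t) \<le> L * dist s t" .
  qed (rule lipschitz_on_nonneg[OF L])
  obtain g where g: "g \<in> borel_measurable borel" "AE t in lborel. (U has_vector_derivative g t) (at t)"
    using lipschitz_AE_has_vector_derivative[OF U] .
  have "AE t in lborel. t \<in> {a..b} \<longrightarrow> (coord c \<circ> \<gamma> has_vector_derivative g t) (at t)"
    using g(2) AE_lborel_singleton[of a] AE_lborel_singleton[of b]
  proof eventually_elim
    case (elim t)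
    show ?case
    proof
      assume "t \<in> {a..b}"
      then have t: "t \<in> {a<..<b}" using elim by auto
      show "(coord c \<circ> \<gamma> has_vector_derivative g t) (at t)"
        by (rule has_vector_derivative_transform_within_open[OF elim(1) open_greaterThanLessThan t])
          (simp add: U_def cl_id)
    qed
  qed
  moreover have "U t \<in> img_chart c" for t
    unfolding U_def using cl[of t] \<gamma>(3) by (intro coord_in_img[OF \<gamma>(4)]) blast
  moreover have "AE t in lborel. t \<in> {a..b} \<longrightarrow> (U has_vector_derivative g t) (at t)"
    using g(2) by (rule eventually_mono) simp
  ultimately show thesis by (intro that[OF g(1) U]) (auto simp: U_def cl_id)
qed

text \<open>The two-sided derivative, so that it does not depend on the domain of the curve; it differs
  from \<open>velocity\<close> at most at the end points.\<close>

definition velo :: "(real \<Rightarrow> 'a) \<Rightarrow> real \<Rightarrow> ('a, 'e) tvec" where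
  "velo \<gamma> t = (\<lambda>c. if c \<in> charts_at A (\<gamma> t) then vector_derivative (coord c \<circ> \<gamma>) (at t) else 0)"

text \<open>\<open>vector_derivative\<close> is arbitrary where no derivative exists, and
  homogeneity of the metric is assumed on tangent spaces; this singles out the parameters at which
  \<open>velo\<close> can be relied on.\<close>

definition regular :: "(real \<Rightarrow> 'a) \<Rightarrow> real \<Rightarrow> bool" where
  "regular \<gamma> t \<longleftrightarrow> velo \<gamma> t \<in> tangent_space A (\<gamma> t) \<and>
     (\<forall>c\<in>charts_at A (\<gamma> t). (coord c \<circ> \<gamma> has_vector_derivative velo \<gamma> t c) (at t))"

text \<open>Differentiability in one chart spreads to all others by the chain rule through
  \<open>transition\<close>, with derivatives related as \<open>tangent_space\<close>
  demands.\<close>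

lemma velo_eq_tvec_of:
  assumes c: "c \<in> A" and J: "open J" "t \<in> J" "\<gamma> ` J \<subseteq> dom_chart c"
    and w: "(coord c \<circ> \<gamma> has_vector_derivative w) (at t)"
  shows "velo \<gamma> t = tvec_of A c (\<gamma> t) w" "regular \<gamma> t"
proof -
  have ch: "c \<in> charts_at A (\<gamma> t)" using c J by (auto simp: charts_at_def)
  have d: "(coord c' \<circ> \<gamma> has_vector_derivative frechet_derivative (transition c c') (at (coord c (\<gamma> t))) w) (at t)"
    if c': "c' \<in> charts_at A (\<gamma> t)" for c'
  proof -
    let ?T = "frechet_derivative (transition c c') (at (coord c (\<gamma> t)))"
    have T: "(transition c c' has_derivative ?T) (at ((coord c \<circ> \<gamma>) t))"
      using transition_has_derivative[OF ch c'] by simp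
    have "((\<lambda>s. transition c c' ((coord c \<circ> \<gamma>) s)) has_derivative (\<lambda>h. ?T (h *\<^sub>R w))) (at t)"
      by (rule has_derivative_compose[OF w[unfolded has_vector_derivative_def] T])
    then have "((\<lambda>s. transition c c' ((coord c \<circ> \<gamma>) s)) has_vector_derivative ?T w) (at t)"
      unfolding has_vector_derivative_def linear_scale[OF has_derivative_linear[OF T]] .
    then show ?thesis
    proof (rule has_vector_derivative_transform_within_open[OF _ J(1,2)])
      fix s assume "s \<in> J"
      then have "\<gamma> s \<in> dom_chart c" using J by auto
      then show "transition c c' ((coord c \<circ> \<gamma>) s) = (coord c' \<circ> \<gamma>) s"
        by (simp add: transition_coord[OF c])
    qed
  qed
  show eq: "velo \<gamma> t = tvec_of A c (\<gamma> t) w"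
    using vector_derivative_at[OF d] by (auto simp: velo_def tvec_of_def fun_eq_iff)
  show "regular \<gamma> t"
    unfolding regular_def eq
  proof (intro conjI ballI)
    show "tvec_of A c (\<gamma> t) w \<in> tangent_space A (\<gamma> t)" by (rule tvec_of_in_tangent_space[OF ch])
    fix c' assume c': "c' \<in> charts_at A (\<gamma> t)"
    then show "(coord c' \<circ> \<gamma> has_vector_derivative tvec_of A c (\<gamma> t) w c') (at t)"
      using d[OF c'] by (simp add: tvec_of_def)
  qed
qed

lemma velo_affine:
  assumes "regular \<gamma> (m * s + k)"
  shows "velo (\<lambda>s. \<gamma> (m * s + k)) s = (\<lambda>c. m *\<^sub>R velo \<gamma> (m * s + k) c)"
proof
  fix c
  show "velo (\<lambda>s. \<gamma> (m * s + k)) s c = m *\<^sub>R velo \<gamma> (m * s + k) c"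
  proof (cases "c \<in> charts_at A (\<gamma> (m * s + k))")
    case True
    then have "(coord c \<circ> \<gamma> has_vector_derivative velo \<gamma> (m * s + k) c) (at (m * s + k))"
      using assms by (simp add: regular_def)
    moreover have "((\<lambda>s. m * s + k) has_vector_derivative m) (at s)"
      by (auto intro!: derivative_eq_intros simp flip: has_real_derivative_iff_has_vector_derivative)
    ultimately have "((coord c \<circ> \<gamma>) \<circ> (\<lambda>s. m * s + k) has_vector_derivative m *\<^sub>R velo \<gamma> (m * s + k) c) (at s)"
      by (intro vector_diff_chain_at)
    from vector_derivative_at[OF this] True show ?thesis
      by (simp add: velo_def o_def)
  qed (simp add: velo_def)
qed

lemma velo_local:
  assumes "open J" "t \<in> J" "\<And>s. s \<in> J \<Longrightarrow> \<gamma> s = \<sigma> s"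
  shows "velo \<gamma> t = velo \<sigma> t"
proof -
  have "vector_derivative (coord c \<circ> \<gamma>) (at t) = vector_derivative (coord c \<circ> \<sigma>) (at t)" for c
  proof (rule vector_derivative_cong_eq)
    show "\<forall>\<^sub>F x in nhds t. x \<in> UNIV \<longrightarrow> (coord c \<circ> \<gamma>) x = (coord c \<circ> \<sigma>) x"
      using assms by (auto simp: eventually_nhds)
  qed auto
  then show ?thesis using assms by (auto simp: velo_def fun_eq_iff)
qed

end

section \<open>Length and distance: measurability, additivity, reparametrization\<close>

context finsler_manifold
begin

definition speed :: "(real \<Rightarrow> 'a) \<Rightarrow> real \<Rightarrow> real" where
  "speed \<gamma> t = F (\<gamma> t) (velo \<gamma> t)"

definition len :: "(real \<Rightarrow> 'a) \<Rightarrow> real set \<Rightarrow> ennreal" where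
  "len \<gamma> I = (\<integral>\<^sup>+t. ennreal (speed \<gamma> t) * indicator I t \<partial>lborel)"

lemma len_cong:
  assumes J: "open J" "AE t in lborel. t \<in> I \<longrightarrow> t \<in> J" "\<And>t. t \<in> J \<Longrightarrow> \<sigma> t = \<gamma> t"
  shows "len \<sigma> I = len \<gamma> I"
  unfolding len_def
proof (rule nn_integral_cong_AE, rule eventually_mono[OF J(2)])
  fix t assume t: "t \<in> I \<longrightarrow> t \<in> J"
  show "ennreal (speed \<sigma> t) * indicator I t = ennreal (speed \<gamma> t) * indicator I t"
  proof (cases "t \<in> I")
    case True
    then have "velo \<sigma> t = velo \<gamma> t" using t by (intro velo_local[OF J(1) _ J(3)]) auto
    then show ?thesis using True t by (simp add: speed_def J(3))
  qed simp
qed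

text \<open>\<open>velocity\<close> and \<open>velo\<close> can differ only at the parameters 0 and
  1, and completing the measure does not change the integral.\<close>

lemma finsler_length_eq: "finsler_length A F \<gamma> = len \<gamma> {0..1}"
proof -
  have "finsler_length A F \<gamma> = (\<integral>\<^sup>+t\<in>{0..1}. ennreal (F (\<gamma> t) (velocity A \<gamma> t)) \<partial>lborel)"
    unfolding finsler_length_def by (rule nn_integral_completion)
  also have "\<dots> = len \<gamma> {0..1}"
    unfolding len_def
  proof (rule nn_integral_cong_AE)
    show "AE t in lborel. ennreal (F (\<gamma> t) (velocity A \<gamma> t)) * indicator {0..1} t =
        ennreal (speed \<gamma> t) * indicator {0..1} t"
      using AE_lborel_singleton[of 0] AE_lborel_singleton[of 1]
    proof eventually_elim
      case (elim t)
      show ?case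
      proof (cases "t \<in> {0..1}")
        case True
        then have "at t within {0..1} = at t" using elim by (intro at_within_Icc_at) auto
        then have "velocity A \<gamma> t = velo \<gamma> t" by (auto simp: velocity_def velo_def fun_eq_iff)
        then show ?thesis by (simp add: speed_def)
      qed simp
    qed
  qed
  finally show ?thesis .
qed

lemma finsler_dist_eq:
  "finsler_dist A F x y = (INF \<gamma>\<in>{\<gamma>. lip_path \<gamma> {0..1} \<and> \<gamma> 0 = x \<and> \<gamma> 1 = y}. len \<gamma> {0..1})"
  by (simp add: finsler_dist_def lipschitz_curve_eq finsler_length_eq)

lemma speed_in_chart:
  assumes "c \<in> A" "\<gamma> ` {a..b} \<subseteq> dom_chart c" "t \<in> {a<..<b}"
    and "(coord c \<circ> \<gamma> has_vector_derivative w) (at t)"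
  shows "regular \<gamma> t" "speed \<gamma> t = Fl c (coord c (\<gamma> t), w)"
proof -
  have sub: "\<gamma> ` {a<..<b} \<subseteq> dom_chart c" using assms(2) greaterThanLessThan_subseteq_atLeastAtMost_iff[of a b a b] by auto
  then have "\<gamma> t \<in> dom_chart c" using assms(3) by blast
  note v = velo_eq_tvec_of[OF assms(1) open_greaterThanLessThan assms(3) sub assms(4)]
  show "regular \<gamma> t" by (rule v(2))
  show "speed \<gamma> t = Fl c (coord c (\<gamma> t), w)"
    by (simp add: speed_def v(1) local_expr_def inv_coord_coord[OF assms(1) \<open>\<gamma> t \<in> dom_chart c\<close>])
qed

lemma len_in_chart:
  assumes c: "c \<in> A" "\<gamma> ` {a..b} \<subseteq> dom_chart c"
    and g: "AE t in lborel. t \<in> {a..b} \<longrightarrow> (coord c \<circ> \<gamma> has_vector_derivative g t) (at t)"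
  shows "len \<gamma> {a..b} = (\<integral>\<^sup>+t. ennreal (Fl c (coord c (\<gamma> t), g t)) * indicator {a..b} t \<partial>lborel)"
  unfolding len_def
proof (rule nn_integral_cong_AE)
  show "AE t in lborel. ennreal (speed \<gamma> t) * indicator {a..b} t =
      ennreal (Fl c (coord c (\<gamma> t), g t)) * indicator {a..b} t"
    using g AE_lborel_singleton[of a] AE_lborel_singleton[of b]
  proof eventually_elim
    case (elim t)
    show ?case
    proof (cases "t \<in> {a..b}")
      case True
      then have "speed \<gamma> t = Fl c (coord c (\<gamma> t), g t)"
        using elim by (intro speed_in_chart(2)[OF c]) auto
      then show ?thesis by simp
    qed simp
  qed
qed

text \<open>\<open>speed\<close> is not known to be measurable, being arbitrary off the regular
  parameters. The Borel function \<open>B\<close> replaces it wherever additivity or substitution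
  for \<open>nn_integral\<close> is used.\<close>

lemma speed_AE_borel:
  assumes \<gamma>: "lip_path \<gamma> {a..b}" "a \<le> b"
  obtains B where "B \<in> borel_measurable borel"
    "AE t in lborel. t \<in> {a..b} \<longrightarrow> regular \<gamma> t \<and> ennreal (speed \<gamma> t) = B t"
proof -
  let ?Q = "\<lambda>x y B. B \<in> borel_measurable borel \<and>
    (AE t in lborel. t \<in> {x..y} \<longrightarrow> regular \<gamma> t \<and> ennreal (speed \<gamma> t) = B t)"
  let ?P = "\<lambda>x y. a \<le> x \<and> x \<le> y \<and> y \<le> b \<longrightarrow> (\<exists>B. ?Q x y B)"
  have "?P a b"
  proof (rule Bolzano[where P = ?P, OF \<open>a \<le> b\<close>])
    fix x y z assume *: "?P x y" "?P y z" "x \<le> y" "y \<le> z"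
    show "?P x z"
    proof
      assume "a \<le> x \<and> x \<le> z \<and> z \<le> b"
      then obtain B1 B2 where B: "?Q x y B1" "?Q y z B2" using * by auto
      have [measurable]: "B1 \<in> borel_measurable borel" "B2 \<in> borel_measurable borel" using B by auto
      have "?Q x z (\<lambda>t. if t \<le> y then B1 t else B2 t)"
      proof
        show "AE t in lborel. t \<in> {x..z} \<longrightarrow> regular \<gamma> t \<and> ennreal (speed \<gamma> t) = (if t \<le> y then B1 t else B2 t)"
          using B(1)[THEN conjunct2] B(2)[THEN conjunct2] by eventually_elim auto
      qed measurable
      then show "\<exists>B. ?Q x z B" by (rule exI[where P = "?Q x z"])
    qed
  next
    fix t assume t: "a \<le> t" "t \<le> b"
    obtain c where c: "c \<in> charts_at A (\<gamma> t)" by (rule chart_at_exists)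
    then have A: "c \<in> A" by (simp add: charts_at_def)
    obtain e L where e: "0 < e" "\<gamma> ` ({a..b} \<inter> ball t e) \<subseteq> dom_chart c"
      "L-lipschitz_on ({a..b} \<inter> ball t e) (coord c \<circ> \<gamma>)"
      by (rule lip_path_chart[OF \<gamma>(1) _ c]) (use t in auto)
    have "?P x y" if xy: "x \<le> t" "t \<le> y" "y - x < e" for x y
    proof
      assume ab: "a \<le> x \<and> x \<le> y \<and> y \<le> b"
      then have "{x..y} \<subseteq> {a..b} \<inter> ball t e" using xy by (auto simp: dist_real_def)
      then have dom: "\<gamma> ` {x..y} \<subseteq> dom_chart c" using e(2) by blast
      have lp: "lip_path \<gamma> {x..y}" using ab by (intro lip_path_subset[OF \<gamma>(1)]) auto
      obtain g U K where [measurable]: "g \<in> borel_measurable borel" and U: "K-lipschitz_on UNIV U"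
        and Ui: "\<And>t. U t \<in> img_chart c" and Ueq: "\<And>t. t \<in> {x..y} \<Longrightarrow> U t = coord c (\<gamma> t)"
        and g: "AE t in lborel. t \<in> {x..y} \<longrightarrow> (coord c \<circ> \<gamma> has_vector_derivative g t) (at t)"
        by (rule lip_path_derivative_in_chart[OF lp ab[THEN conjunct2, THEN conjunct1] dom A]) blast
      have [measurable]: "U \<in> borel_measurable borel"
        by (intro borel_measurable_continuous_onI lipschitz_on_continuous_on[OF U])
      let ?S = "img_chart c \<times> (UNIV :: 'e set)"
      have "?S \<in> sets borel" using open_img[OF A] by (intro borel_open open_Times) auto
      \<comment> \<open>\<open>Fl c\<close> is continuous over the image of the chart; cutting it
        off there yields a Borel function on the whole space.\<close>
      then have [measurable]: "(\<lambda>x. indicator ?S x *\<^sub>R Fl c x) \<in> borel_measurable borel"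
        by (intro borel_measurable_continuous_on_indicator Fl_continuous[OF A])
      define B where "B t = ennreal (indicator ?S (U t, g t) *\<^sub>R Fl c (U t, g t))" for t
      have "B \<in> borel_measurable borel" unfolding B_def
        by (intro measurable_compose[OF _ measurable_ennreal] measurable_compose[of "\<lambda>t. (U t, g t)"
            borel borel "\<lambda>x. indicator ?S x *\<^sub>R Fl c x"]) measurable
      moreover have "AE t in lborel. t \<in> {x..y} \<longrightarrow> regular \<gamma> t \<and> ennreal (speed \<gamma> t) = B t"
        using g AE_lborel_singleton[of x] AE_lborel_singleton[of y]
      proof eventually_elim
        case (elim t)
        show ?case
        proof
          assume t: "t \<in> {x..y}"
          then have t': "t \<in> {x<..<y}" using elim by auto
          have d: "(coord c \<circ> \<gamma> has_vector_derivative g t) (at t)" using elim t by blast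
          have "B t = ennreal (Fl c (coord c (\<gamma> t), g t))"
            using Ui[of t] Ueq[OF t] by (simp add: B_def)
          then show "regular \<gamma> t \<and> ennreal (speed \<gamma> t) = B t"
            using speed_in_chart[OF A dom t' d] by simp
        qed
      qed
      ultimately show "\<exists>B. ?Q x y B" by blast
    qed
    then show "\<exists>d>0. \<forall>x y. x \<le> t \<and> t \<le> y \<and> y - x < d \<longrightarrow> ?P x y" using e(1) by blast
  qed
  then show thesis using that \<open>a \<le> b\<close> by auto
qed

lemma len_split:
  assumes \<gamma>: "lip_path \<gamma> {a..c}" and ab: "a \<le> b" "b \<le> c"
  shows "len \<gamma> {a..c} = len \<gamma> {a..b} + len \<gamma> {b..c}"
proof -
  obtain B where [measurable]: "B \<in> borel_measurable borel"
    and B: "AE t in lborel. t \<in> {a..c} \<longrightarrow> regular \<gamma> t \<and> ennreal (speed \<gamma> t) = B t"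
    using speed_AE_borel[OF \<gamma>] ab by auto
  have eq: "len \<gamma> {x..y} = (\<integral>\<^sup>+t. B t * indicator {x..y} t \<partial>lborel)" if "a \<le> x" "y \<le> c" for x y
    unfolding len_def
    by (rule nn_integral_cong_AE, rule eventually_mono[OF B]) (use that in \<open>auto simp: indicator_def\<close>)
  have "len \<gamma> {a..c} = (\<integral>\<^sup>+t. B t * indicator {a..b} t + B t * indicator {b..c} t \<partial>lborel)"
    unfolding eq[OF order_refl order_refl]
    by (rule nn_integral_cong_AE, rule eventually_mono[OF AE_lborel_singleton[of b]])
      (use ab in \<open>auto simp: indicator_def\<close>)
  also have "\<dots> = len \<gamma> {a..b} + len \<gamma> {b..c}"
    using ab by (subst nn_integral_add) (auto simp: eq)
  finally show ?thesis .
qed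

text \<open>The speed is multiplied by \<open>\<bar>m\<bar>\<close> and the substitution divides by
  it. Describing \<open>J\<close> as a preimage admits negative \<open>m\<close>, hence the reversal
  of curves.\<close>

lemma lip_path_affine:
  assumes \<gamma>: "lip_path \<gamma> {a..b}" "a \<le> b" and m: "m \<noteq> 0"
    and J: "J = (\<lambda>s. m * s + k) -` {a..b}"
  shows "lip_path (\<lambda>s. \<gamma> (m * s + k)) J" "len (\<lambda>s. \<gamma> (m * s + k)) J = len \<gamma> {a..b}"
proof -
  let ?\<sigma> = "\<lambda>s. \<gamma> (m * s + k)"
  have dist: "dist (m * s + k) (m * s' + k) = \<bar>m\<bar> * dist s s'" for s s'
    by (simp add: dist_real_def abs_mult[symmetric] right_diff_distrib)
  show "lip_path ?\<sigma> J"
    unfolding lip_path_def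
  proof
    fix s assume s: "s \<in> J"
    then obtain c e L where c: "c \<in> charts_at A (\<gamma> (m * s + k))" "e > 0"
      "\<gamma> ` ({a..b} \<inter> ball (m * s + k) e) \<subseteq> dom_chart c"
      "L-lipschitz_on ({a..b} \<inter> ball (m * s + k) e) (coord c \<circ> \<gamma>)"
      using \<gamma>(1) J unfolding lip_path_def by blast
    have sub: "m * s' + k \<in> {a..b} \<inter> ball (m * s + k) e" if "s' \<in> J \<inter> ball s (e / \<bar>m\<bar>)" for s'
    proof -
      have "dist (m * s + k) (m * s' + k) < e"
        unfolding dist using that m by (auto simp: field_simps)
      then show ?thesis using that J by auto
    qed
    have "?\<sigma> ` (J \<inter> ball s (e / \<bar>m\<bar>)) \<subseteq> dom_chart c" using sub c(3) by blast
    moreover have "(L * \<bar>m\<bar>)-lipschitz_on (J \<inter> ball s (e / \<bar>m\<bar>)) (coord c \<circ> ?\<sigma>)"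
    proof (rule lipschitz_onI)
      fix x y assume xy: "x \<in> J \<inter> ball s (e / \<bar>m\<bar>)" "y \<in> J \<inter> ball s (e / \<bar>m\<bar>)"
      show "dist ((coord c \<circ> ?\<sigma>) x) ((coord c \<circ> ?\<sigma>) y) \<le> L * \<bar>m\<bar> * dist x y"
        using lipschitz_onD[OF c(4) sub[OF xy(1)] sub[OF xy(2)]] unfolding dist by (simp add: mult.assoc)
    qed (use lipschitz_on_nonneg[OF c(4)] in simp)
    moreover have "0 < e / \<bar>m\<bar>" using c(2) m by simp
    ultimately show "\<exists>c\<in>charts_at A (?\<sigma> s). \<exists>e>0. \<exists>L. ?\<sigma> ` (J \<inter> ball s e) \<subseteq> dom_chart c \<and>
        L-lipschitz_on (J \<inter> ball s e) (coord c \<circ> ?\<sigma>)"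
      using c(1) by blast
  qed
  obtain B where [measurable]: "B \<in> borel_measurable borel"
    and B: "AE t in lborel. t \<in> {a..b} \<longrightarrow> regular \<gamma> t \<and> ennreal (speed \<gamma> t) = B t"
    using speed_AE_borel[OF \<gamma>] .
  \<comment> \<open>The exceptional parameters are enclosed in a Borel null set, because
    \<open>AE_borel_affine\<close> asks for a measurable predicate.\<close>
  then obtain N where N: "N \<in> null_sets lborel"
    and NB: "{t \<in> space lborel. \<not> (t \<in> {a..b} \<longrightarrow> regular \<gamma> t \<and> ennreal (speed \<gamma> t) = B t)} \<subseteq> N"
    unfolding eventually_ae_filter by blast
  have Nm [measurable]: "N \<in> sets borel" using N by auto
  have "AE s in lborel. k + m * s \<notin> N"
    by (rule AE_borel_affine[OF m]) (use AE_not_in[OF N] in auto)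
  then have AE: "AE s in lborel. ennreal (speed ?\<sigma> s) * indicator J s =
      ennreal \<bar>m\<bar> * (B (k + m * s) * indicator {a..b} (k + m * s))"
  proof (rule eventually_mono)
    fix s assume s: "k + m * s \<notin> N"
    show "ennreal (speed ?\<sigma> s) * indicator J s = ennreal \<bar>m\<bar> * (B (k + m * s) * indicator {a..b} (k + m * s))"
    proof (cases "s \<in> J")
      case True
      then have in_ab: "k + m * s \<in> {a..b}" by (simp add: J add.commute)
      then have r: "regular \<gamma> (m * s + k)" "ennreal (speed \<gamma> (m * s + k)) = B (m * s + k)"
        using NB s by (auto simp: add.commute)
      have "speed ?\<sigma> s = \<bar>m\<bar> * speed \<gamma> (m * s + k)"
        unfolding speed_def velo_affine[OF r(1)] using r(1) by (intro F_homogeneous) (simp add: regular_def)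
      then show ?thesis using True in_ab r(2) by (simp add: ennreal_mult' add.commute)
    next
      case False
      then have "k + m * s \<notin> {a..b}" by (simp add: J add.commute)
      then show ?thesis using False by simp
    qed
  qed
  have "len ?\<sigma> J = (\<integral>\<^sup>+s. ennreal \<bar>m\<bar> * (B (k + m * s) * indicator {a..b} (k + m * s)) \<partial>lborel)"
    unfolding len_def by (rule nn_integral_cong_AE[OF AE])
  also have "\<dots> = ennreal \<bar>m\<bar> * (\<integral>\<^sup>+s. B (k + m * s) * indicator {a..b} (k + m * s) \<partial>lborel)"
    by (rule nn_integral_cmult) measurable
  also have "\<dots> = (\<integral>\<^sup>+t. B t * indicator {a..b} t \<partial>lborel)"
    by (rule nn_integral_real_affine[OF _ m, symmetric]) measurable
  also have "\<dots> = len \<gamma> {a..b}"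
    unfolding len_def
    by (rule nn_integral_cong_AE, rule eventually_mono[OF B]) (auto simp: indicator_def)
  finally show "len ?\<sigma> J = len \<gamma> {a..b}" .
qed

lemma finsler_dist_le_len:
  assumes \<gamma>: "lip_path \<gamma> {a..b}" "a < b"
  shows "finsler_dist A F (\<gamma> a) (\<gamma> b) \<le> len \<gamma> {a..b}"
proof -
  have J: "{0..1} = (\<lambda>s. (b - a) * s + a) -` {a..b}"
  proof (rule set_eqI)
    fix s :: real
    have "(b - a) * s + a \<le> b \<longleftrightarrow> (b - a) * s \<le> (b - a) * 1" by auto
    also have "\<dots> \<longleftrightarrow> s \<le> 1" using \<gamma>(2) by (subst mult_le_cancel_left_pos) auto
    finally show "s \<in> {0..1} \<longleftrightarrow> s \<in> (\<lambda>s. (b - a) * s + a) -` {a..b}"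
      using \<gamma>(2) by (auto simp: zero_le_mult_iff)
  qed
  have ab: "a \<le> b" "b - a \<noteq> 0" using \<gamma>(2) by auto
  note * = lip_path_affine[OF \<gamma>(1) ab J]
  show ?thesis
    unfolding finsler_dist_eq *(2)[symmetric] by (rule INF_lower) (use *(1) in auto)
qed

lemma finsler_dist_commute_le: "finsler_dist A F x y \<le> finsler_dist A F y x"
  unfolding finsler_dist_eq[of y x]
proof (rule INF_greatest)
  fix \<gamma> assume "\<gamma> \<in> {\<gamma>. lip_path \<gamma> {0..1} \<and> \<gamma> 0 = y \<and> \<gamma> 1 = x}"
  then have \<gamma>: "lip_path \<gamma> {0..1}" "\<gamma> 0 = y" "\<gamma> 1 = x" by auto
  have J: "{0..1} = (\<lambda>s. (-1) * s + 1) -` {0..1::real}" by auto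
  note * = lip_path_affine[OF \<gamma>(1) _ _ J, simplified]
  have "finsler_dist A F x y \<le> len (\<lambda>s. \<gamma> (1 - s)) {0..1}"
    using finsler_dist_le_len[OF *(1)] \<gamma> by simp
  then show "finsler_dist A F x y \<le> len \<gamma> {0..1}" using *(2) by simp
qed

text \<open>Almost minimal curves are concatenated, the second one shifted to \<open>{1..2}\<close>;
  \<open>finsler_dist_le_len\<close> accepts the resulting domain \<open>{0..2}\<close>.\<close>

lemma finsler_dist_triangle: "finsler_dist A F x z \<le> finsler_dist A F x y + finsler_dist A F y z"
proof -
  have le: "finsler_dist A F x z \<le> len \<gamma>1 {0..1} + len \<gamma>2 {0..1}"
    if 1: "lip_path \<gamma>1 {0..1}" "\<gamma>1 0 = x" "\<gamma>1 1 = y" and 2: "lip_path \<gamma>2 {0..1}" "\<gamma>2 0 = y" "\<gamma>2 1 = z"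
    for \<gamma>1 \<gamma>2
  proof -
    have J: "{1..2} = (\<lambda>s. 1 * s + (-1)) -` {0..1::real}" by auto
    define \<gamma>3 where "\<gamma>3 s = \<gamma>2 (s - 1)" for s
    have 3: "lip_path \<gamma>3 {1..2}" "len \<gamma>3 {1..2} = len \<gamma>2 {0..1}" "\<gamma>3 1 = y" "\<gamma>3 2 = z"
      using lip_path_affine[OF 2(1) _ _ J] 2 by (simp_all add: \<gamma>3_def[abs_def])
    define \<sigma> where "\<sigma> s = (if s \<le> 1 then \<gamma>1 s else \<gamma>3 s)" for s
    have lp: "lip_path \<sigma> {0..2}"
      unfolding lip_path_def
    proof
      fix t :: real assume t: "t \<in> {0..2}"
      obtain c where c: "c \<in> charts_at A (\<sigma> t)" by (rule chart_at_exists)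
      consider "t < 1" | "t = 1" | "t > 1" by linarith
      then have "\<exists>e>0. \<exists>L. \<sigma> ` ({0..2} \<inter> ball t e) \<subseteq> dom_chart c \<and>
        L-lipschitz_on ({0..2} \<inter> ball t e) (coord c \<circ> \<sigma>)"
      proof cases
        case 1
        show ?thesis
          by (rule lip_path_chart_cong[OF \<open>lip_path \<gamma>1 {0..1}\<close>, of t c "{..<1}"])
            (use 1 t c in \<open>auto simp: \<sigma>_def\<close>)
      next
        case 3
        show ?thesis
          by (rule lip_path_chart_cong[OF \<open>lip_path \<gamma>3 {1..2}\<close>, of t c "{1<..}"])
            (use 3 t c in \<open>auto simp: \<sigma>_def\<close>)
      next
        \<comment> \<open>At the junction both pieces are Lipschitz in the same chart, one on each
          side of 1, and they agree at 1.\<close>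
        case 2
        obtain e L where e: "0 < e" "\<gamma>1 ` ({0..1} \<inter> ball 1 e) \<subseteq> dom_chart c"
          "L-lipschitz_on ({0..1} \<inter> ball 1 e) (coord c \<circ> \<gamma>1)"
          by (rule lip_path_chart[OF \<open>lip_path \<gamma>1 {0..1}\<close>, of 1 c]) (use 2 c in \<open>auto simp: \<sigma>_def\<close>)
        obtain e' M where e': "0 < e'" "\<gamma>3 ` ({1..2} \<inter> ball 1 e') \<subseteq> dom_chart c"
          "M-lipschitz_on ({1..2} \<inter> ball 1 e') (coord c \<circ> \<gamma>3)"
          by (rule lip_path_chart[OF \<open>lip_path \<gamma>3 {1..2}\<close>, of 1 c])
            (use 2 c \<open>\<gamma>3 1 = y\<close> \<open>\<gamma>1 1 = y\<close> in \<open>auto simp: \<sigma>_def\<close>)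
        define r where "r = min 1 (min (e/2) (e'/2))"
        have r: "0 < r" "r \<le> 1" "r < e" "r < e'" using e(1) e'(1) by (auto simp: r_def)
        have L: "L-lipschitz_on {1 - r..1} (coord c \<circ> \<gamma>1)"
          by (rule lipschitz_on_subset[OF e(3)]) (use r in \<open>auto simp: dist_real_def\<close>)
        have M: "M-lipschitz_on {1..1 + r} (coord c \<circ> \<gamma>3)"
          by (rule lipschitz_on_subset[OF e'(3)]) (use r in \<open>auto simp: dist_real_def\<close>)
        have eq: "(\<lambda>s. if s \<le> 1 then (coord c \<circ> \<gamma>1) s else (coord c \<circ> \<gamma>3) s) = coord c \<circ> \<sigma>"
          by (auto simp: \<sigma>_def)
        have "(max L M)-lipschitz_on {1 - r..1 + r} (coord c \<circ> \<sigma>)"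
          using lipschitz_on_concat_max[OF L M] \<open>\<gamma>3 1 = y\<close> \<open>\<gamma>1 1 = y\<close> unfolding eq by simp
        then have "(max L M)-lipschitz_on ({0..2} \<inter> ball t r) (coord c \<circ> \<sigma>)"
          by (rule lipschitz_on_subset) (use 2 in \<open>auto simp: dist_real_def\<close>)
        moreover have "\<sigma> s \<in> dom_chart c" if "s \<in> {0..2} \<inter> ball t r" for s
        proof (cases "s \<le> 1")
          case True
          then have "s \<in> {0..1} \<inter> ball 1 e" using that r 2 by (auto simp: dist_real_def)
          then show ?thesis using e(2) True by (auto simp: \<sigma>_def)
        next
          case False
          then have "s \<in> {1..2} \<inter> ball 1 e'" using that r 2 by (auto simp: dist_real_def)
          then show ?thesis using e'(2) False by (auto simp: \<sigma>_def)
        qed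
        ultimately show ?thesis using r(1) by blast
      qed
      then show "\<exists>c\<in>charts_at A (\<sigma> t). \<exists>e>0. \<exists>L. \<sigma> ` ({0..2} \<inter> ball t e) \<subseteq> dom_chart c \<and>
          L-lipschitz_on ({0..2} \<inter> ball t e) (coord c \<circ> \<sigma>)"
        using c by blast
    qed
    have "finsler_dist A F x z \<le> len \<sigma> {0..2}"
      using finsler_dist_le_len[OF lp] 1 3 by (simp add: \<sigma>_def)
    also have "\<dots> = len \<sigma> {0..1} + len \<sigma> {1..2}" by (rule len_split[OF lp]) auto
    also have "len \<sigma> {0..1} = len \<gamma>1 {0..1}"
      by (rule len_cong[of "{..<1}"], simp, rule eventually_mono[OF AE_lborel_singleton[of 1]])
        (auto simp: \<sigma>_def)
    also have "len \<sigma> {1..2} = len \<gamma>3 {1..2}"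
      by (rule len_cong[of "{1<..}"], simp, rule eventually_mono[OF AE_lborel_singleton[of 1]])
        (auto simp: \<sigma>_def)
    finally show ?thesis using 3 by simp
  qed
  show ?thesis
  proof (rule ennreal_le_epsilon)
    fix e :: real assume fin: "finsler_dist A F x y + finsler_dist A F y z < top" and e: "0 < e"
    have less: "d < d + ennreal (e/2)" if "d < top" for d
      using ennreal_add_left_cancel_less[of d 0 "ennreal (e/2)"] e that by auto
    have "finsler_dist A F x y < finsler_dist A F x y + ennreal (e/2)"
      using fin by (intro less) auto
    then obtain \<gamma>1 where 1: "lip_path \<gamma>1 {0..1}" "\<gamma>1 0 = x" "\<gamma>1 1 = y"
      "len \<gamma>1 {0..1} < finsler_dist A F x y + ennreal (e/2)"
      unfolding finsler_dist_eq[of x y] INF_less_iff by blast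
    have "finsler_dist A F y z < finsler_dist A F y z + ennreal (e/2)"
      using fin by (intro less) auto
    then obtain \<gamma>2 where 2: "lip_path \<gamma>2 {0..1}" "\<gamma>2 0 = y" "\<gamma>2 1 = z"
      "len \<gamma>2 {0..1} < finsler_dist A F y z + ennreal (e/2)"
      unfolding finsler_dist_eq[of y z] INF_less_iff by blast
    have "finsler_dist A F x z \<le> len \<gamma>1 {0..1} + len \<gamma>2 {0..1}" using 1 2 by (intro le)
    also have "\<dots> \<le> (finsler_dist A F x y + ennreal (e/2)) + (finsler_dist A F y z + ennreal (e/2))"
      using 1(4) 2(4) by (intro add_mono) auto
    also have "\<dots> = finsler_dist A F x y + finsler_dist A F y z + (ennreal (e/2) + ennreal (e/2))"
      by (simp add: ac_simps)
    also have "ennreal (e/2) + ennreal (e/2) = ennreal e" using e by (simp flip: ennreal_plus)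
    finally show "finsler_dist A F x z \<le> finsler_dist A F x y + finsler_dist A F y z + ennreal e" .
  qed
qed

text \<open>Stated in \<open>ennreal\<close> because points not joined by a curve have distance
  \<open>\<infinity>\<close>.\<close>

definition finsler_lipschitz :: "real \<Rightarrow> ('a \<Rightarrow> real) \<Rightarrow> bool" where
  "finsler_lipschitz L h \<longleftrightarrow> (\<forall>x y. ennreal \<bar>h x - h y\<bar> \<le> ennreal L * finsler_dist A F x y)"

lemma finsler_lipschitz_len:
  assumes "finsler_lipschitz L h" "lip_path \<gamma> {a..b}" "a < b"
  shows "ennreal \<bar>h (\<gamma> a) - h (\<gamma> b)\<bar> \<le> ennreal L * len \<gamma> {a..b}"
proof -
  have "ennreal \<bar>h (\<gamma> a) - h (\<gamma> b)\<bar> \<le> ennreal L * finsler_dist A F (\<gamma> a) (\<gamma> b)"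
    using assms(1) by (simp add: finsler_lipschitz_def)
  also have "\<dots> \<le> ennreal L * len \<gamma> {a..b}"
    by (intro mult_left_mono finsler_dist_le_len assms) auto
  finally show ?thesis .
qed

text \<open>Along a curve, bisection reduces the estimate to short arcs inside the given
  neighbourhoods, and \<open>len_split\<close> adds up their lengths; the infimum over all curves
  then turns length into distance.\<close>

lemma finsler_lipschitz_local:
  assumes L: "0 < L"
    and loc: "\<And>x. \<exists>U. open U \<and> x \<in> U \<and> (\<forall>\<gamma> a b. a < b \<longrightarrow> lip_path \<gamma> {a..b} \<longrightarrow> \<gamma> ` {a..b} \<subseteq> U \<longrightarrow>
      ennreal \<bar>h (\<gamma> a) - h (\<gamma> b)\<bar> \<le> ennreal L * len \<gamma> {a..b})"
  shows "finsler_lipschitz L h"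
  unfolding finsler_lipschitz_def
proof (intro allI)
  fix x y
  have path: "ennreal \<bar>h (\<gamma> 0) - h (\<gamma> 1)\<bar> \<le> ennreal L * len \<gamma> {0..1}" if \<gamma>: "lip_path \<gamma> {0..1}" for \<gamma>
  proof -
    let ?P = "\<lambda>x y. 0 \<le> x \<and> x \<le> y \<and> y \<le> 1 \<longrightarrow> ennreal \<bar>h (\<gamma> x) - h (\<gamma> y)\<bar> \<le> ennreal L * len \<gamma> {x..y}"
    have "?P 0 1"
    proof (rule Bolzano[where P = ?P, OF zero_le_one])
      fix x y z assume *: "?P x y" "?P y z" "x \<le> y" "y \<le> z"
      show "?P x z"
      proof
        assume xz: "0 \<le> x \<and> x \<le> z \<and> z \<le> 1"
        have "ennreal \<bar>h (\<gamma> x) - h (\<gamma> z)\<bar> \<le> ennreal (\<bar>h (\<gamma> x) - h (\<gamma> y)\<bar> + \<bar>h (\<gamma> y) - h (\<gamma> z)\<bar>)"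
          by (intro ennreal_leI) linarith
        also have "\<dots> = ennreal \<bar>h (\<gamma> x) - h (\<gamma> y)\<bar> + ennreal \<bar>h (\<gamma> y) - h (\<gamma> z)\<bar>" by simp
        also have "\<dots> \<le> ennreal L * len \<gamma> {x..y} + ennreal L * len \<gamma> {y..z}"
          using * xz by (intro add_mono) auto
        also have "\<dots> = ennreal L * len \<gamma> {x..z}"
          using xz * by (subst len_split[of \<gamma> x z y])
            (auto intro: lip_path_subset[OF \<gamma>] simp: distrib_left)
        finally show "ennreal \<bar>h (\<gamma> x) - h (\<gamma> z)\<bar> \<le> ennreal L * len \<gamma> {x..z}" .
      qed
    next
      fix t :: real assume t: "0 \<le> t" "t \<le> 1"
      obtain U where U: "open U" "\<gamma> t \<in> U" "\<And>\<gamma> a b. a < b \<Longrightarrow> lip_path \<gamma> {a..b} \<Longrightarrow> \<gamma> ` {a..b} \<subseteq> U \<Longrightarrow>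
          ennreal \<bar>h (\<gamma> a) - h (\<gamma> b)\<bar> \<le> ennreal L * len \<gamma> {a..b}"
        using loc[of "\<gamma> t"] by blast
      obtain e where e: "0 < e" "\<gamma> ` ({0..1} \<inter> ball t e) \<subseteq> U"
        using lip_path_in_open[OF \<gamma> _ U(1,2)] t by auto
      have "?P x y" if xy: "x \<le> t" "t \<le> y" "y - x < e" for x y
      proof
        assume 01: "0 \<le> x \<and> x \<le> y \<and> y \<le> 1"
        then have "{x..y} \<subseteq> {0..1} \<inter> ball t e" using xy by (auto simp: dist_real_def)
        then have im: "\<gamma> ` {x..y} \<subseteq> U" using e(2) by blast
        show "ennreal \<bar>h (\<gamma> x) - h (\<gamma> y)\<bar> \<le> ennreal L * len \<gamma> {x..y}"
        proof (cases "x = y")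
          case False
          show ?thesis
            by (rule U(3)[OF _ lip_path_subset[OF \<gamma>] im]) (use False 01 in auto)
        qed simp
      qed
      then show "\<exists>d>0. \<forall>x y. x \<le> t \<and> t \<le> y \<and> y - x < d \<longrightarrow> ?P x y" using e(1) by blast
    qed
    then show ?thesis by simp
  qed
  \<comment> \<open>Dividing by the positive \<open>L\<close> leaves a lower bound for every single
    length, hence for the infimum.\<close>
  have "ennreal (\<bar>h x - h y\<bar> / L) \<le> finsler_dist A F x y"
    unfolding finsler_dist_eq
  proof (rule INF_greatest)
    fix \<gamma> assume "\<gamma> \<in> {\<gamma>. lip_path \<gamma> {0..1} \<and> \<gamma> 0 = x \<and> \<gamma> 1 = y}"
    then have "ennreal L * ennreal (\<bar>h x - h y\<bar> / L) \<le> ennreal L * len \<gamma> {0..1}"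
      using path[of \<gamma>] L by (auto simp flip: ennreal_mult')
    then show "ennreal (\<bar>h x - h y\<bar> / L) \<le> len \<gamma> {0..1}"
      using L by (subst (asm) ennreal_mult_le_mult_iff) auto
  qed
  then have "ennreal L * ennreal (\<bar>h x - h y\<bar> / L) \<le> ennreal L * finsler_dist A F x y"
    by (rule mult_left_mono) simp
  then show "ennreal \<bar>h x - h y\<bar> \<le> ennreal L * finsler_dist A F x y"
    using L by (simp flip: ennreal_mult')
qed

lemma finsler_lipschitz_mono: "finsler_lipschitz L h \<Longrightarrow> L \<le> M \<Longrightarrow> finsler_lipschitz M h"
  unfolding finsler_lipschitz_def by (meson ennreal_leI mult_right_mono order_trans zero_le)

end

section \<open>Smoothing in one chart\<close>

context smooth_manifold
begin

definition smooth_at :: "('a \<Rightarrow> real) \<Rightarrow> 'a set \<Rightarrow> bool" where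
  "smooth_at h U \<longleftrightarrow> (\<forall>c\<in>A. \<forall>k. C_k_on k (h \<circ> inv_coord c) (img_chart c \<inter> inv_coord c -` U))"

lemma smooth_at_UNIV_iff: "smooth_at h UNIV \<longleftrightarrow> h \<in> smooth_functions A"
  by (auto simp: smooth_at_def smooth_functions_def smooth_on_def)

lemma open_inv_coord_vimage: "c \<in> A \<Longrightarrow> open U \<Longrightarrow> open (img_chart c \<inter> inv_coord c -` U)"
  by (rule continuous_open_preimage[OF continuous_inv_coord open_img])

lemma smooth_at_local:
  assumes "\<And>x. x \<in> U \<Longrightarrow> \<exists>V. open V \<and> x \<in> V \<and> smooth_at h V"
  shows "smooth_at h U"
  unfolding smooth_at_def
proof (intro ballI allI C_k_on_local)
  fix c k p assume c: "c \<in> A" and p: "p \<in> img_chart c \<inter> inv_coord c -` U"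
  then obtain V where V: "open V" "inv_coord c p \<in> V" "smooth_at h V" using assms by blast
  show "\<exists>T. open T \<and> p \<in> T \<and> C_k_on k (h \<circ> inv_coord c) T"
    using V p c by (intro exI[of _ "img_chart c \<inter> inv_coord c -` V"])
      (auto simp: smooth_at_def intro!: open_inv_coord_vimage)
qed

lemma smooth_at_cong:
  assumes "open V" "V \<subseteq> U" "\<And>x. x \<in> V \<Longrightarrow> h x = h' x" "smooth_at h U"
  shows "smooth_at h' V"
  unfolding smooth_at_def
proof (intro ballI allI)
  fix c k assume c: "c \<in> A"
  have "C_k_on k (h \<circ> inv_coord c) (img_chart c \<inter> inv_coord c -` V)"
    using assms(2,4) c unfolding smooth_at_def by (blast intro: C_k_on_subset)
  then show "C_k_on k (h' \<circ> inv_coord c) (img_chart c \<inter> inv_coord c -` V)"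
    by (rule C_k_on_cong[OF open_inv_coord_vimage[OF c assms(1)], rotated]) (simp add: assms(3))
qed

text \<open>Any other chart reads \<open>h\<close> as its expression in \<open>c\<close> composed
  with a transition map.\<close>

lemma smooth_at_chart:
  assumes c: "c \<in> A" and V: "open V" "V \<subseteq> img_chart c" and h: "\<And>k. C_k_on k (h \<circ> inv_coord c) V"
  shows "smooth_at h (inv_coord c ` V)"
  unfolding smooth_at_def
proof (intro ballI allI)
  fix c' k assume c': "c' \<in> A"
  let ?S = "img_chart c' \<inter> inv_coord c' -` (inv_coord c ` V)"
  have S: "open ?S" by (intro open_inv_coord_vimage c' open_inv_coord_image c V)
  have sub: "?S \<subseteq> overlap c' c"
  proof
    fix p assume p: "p \<in> ?S"
    then have "inv_coord c' p \<in> dom_chart c' \<inter> dom_chart c"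
      using V(2) inv_coord_in_dom[OF c] inv_coord_in_dom[OF c'] by auto
    moreover have "p = coord c' (inv_coord c' p)" using p coord_inv_coord[OF c'] by simp
    ultimately show "p \<in> overlap c' c" by blast
  qed
  have im: "transition c' c ` ?S \<subseteq> V"
    using V(2) coord_inv_coord[OF c] by (auto simp: transition_def)
  have "C_k_on k (\<lambda>p. (h \<circ> inv_coord c) (transition c' c p)) ?S"
    by (rule C_k_on_compose[OF S V(1) im h C_k_on_subset[OF C_k_on_transition[OF c' c] sub]])
  then show "C_k_on k (h \<circ> inv_coord c') ?S"
  proof (rule C_k_on_cong[OF S, rotated])
    fix p assume "p \<in> ?S"
    then obtain q where q: "q \<in> V" "inv_coord c' p = inv_coord c q" by auto
    then have "coord c (inv_coord c q) = q" using V(2) coord_inv_coord[OF c] by auto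
    then show "(h \<circ> inv_coord c) (transition c' c p) = (h \<circ> inv_coord c') p"
      using q by (simp add: transition_def)
  qed
qed

end

section \<open>Estimates uniform over compact subsets of a chart, and the smoothing step\<close>

context finsler_manifold
begin

text \<open>On \<open>R\<close> times the unit sphere \<open>Fl c\<close> has a positive lower bound
  \<open>c0\<close>. Uniform continuity there gives an absolute error \<open>\<eta> * c0\<close>,
  which this bound turns into a relative one, and homogeneity extends both estimates to all
  vectors.\<close>

lemma Fl_uniform:
  assumes c: "c \<in> A" and R: "compact R" "R \<subseteq> img_chart c" and \<eta>: "0 < \<eta>"
  obtains c0 \<delta> where "0 < c0" "\<And>p w. p \<in> R \<Longrightarrow> c0 * norm w \<le> Fl c (p, w)" "0 < \<delta>"
    "\<And>p q w. p \<in> R \<Longrightarrow> q \<in> R \<Longrightarrow> dist p q < \<delta> \<Longrightarrow> Fl c (q, w) \<le> (1 + \<eta>) * Fl c (p, w)"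
proof -
  let ?X = "R \<times> sphere (0::'e) 1"
  have X: "compact ?X" by (intro compact_Times R) auto
  have cont: "continuous_on ?X (Fl c)"
    by (rule continuous_on_subset[OF Fl_continuous[OF c]]) (use R in auto)
  have "\<exists>c0>0. \<forall>x\<in>?X. c0 \<le> Fl c x"
  proof (cases "?X = {}")
    case False
    then obtain x where x: "x \<in> ?X" "\<And>y. y \<in> ?X \<Longrightarrow> Fl c x \<le> Fl c y"
      using continuous_attains_inf[OF X False cont] by blast
    obtain p w where pw: "x = (p, w)" by (cases x)
    have "0 < Fl c x" unfolding pw by (rule Fl_pos[OF c]) (use x(1) pw R in auto)
    then show ?thesis using x(2) by blast
  qed (auto intro: exI[of _ 1])
  then obtain c0 where c0: "c0 > 0" "\<And>x. x \<in> ?X \<Longrightarrow> c0 \<le> Fl c x" by blast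
  have "uniformly_continuous_on ?X (Fl c)" by (rule compact_uniformly_continuous[OF cont X])
  moreover have "0 < \<eta> * c0" using \<eta> c0(1) by simp
  ultimately obtain \<delta> where \<delta>: "\<delta> > 0"
    "\<And>x y. x \<in> ?X \<Longrightarrow> y \<in> ?X \<Longrightarrow> dist y x < \<delta> \<Longrightarrow> dist (Fl c y) (Fl c x) < \<eta> * c0"
    unfolding uniformly_continuous_on_def by metis
  have Fl_norm: "Fl c (p, w) = norm w * Fl c (p, w /\<^sub>R norm w)" if "p \<in> R" "w \<noteq> 0" for p w
    using Fl_scaleR[OF c, of p "norm w" "w /\<^sub>R norm w"] that R by auto
  have unit: "(p, w /\<^sub>R norm w) \<in> ?X" if "p \<in> R" "w \<noteq> 0" for p w using that by simp
  have Fl0: "Fl c (p, 0) = 0" if "p \<in> R" for p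
    using Fl_scaleR[OF c, of p 0 0] that R by auto
  show thesis
  proof (rule that[OF c0(1) _ \<delta>(1)])
    fix p w assume p: "p \<in> R"
    show "c0 * norm w \<le> Fl c (p, w)"
    proof (cases "w = 0")
      case False
      have "norm w * c0 \<le> norm w * Fl c (p, w /\<^sub>R norm w)"
        by (intro mult_left_mono c0(2) unit p False) simp
      then show ?thesis unfolding Fl_norm[OF p False] by (simp add: mult.commute)
    qed (simp add: Fl0[OF p])
  next
    fix p q w assume p: "p \<in> R" and q: "q \<in> R" and pq: "dist p q < \<delta>"
    show "Fl c (q, w) \<le> (1 + \<eta>) * Fl c (p, w)"
    proof (cases "w = 0")
      case False
      let ?v = "w /\<^sub>R norm w"
      have "dist (q, ?v) (p, ?v) < \<delta>" using pq by (simp add: dist_Pair_Pair dist_commute)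
      then have "dist (Fl c (q, ?v)) (Fl c (p, ?v)) < \<eta> * c0"
        by (rule \<delta>(2)[OF unit[OF p False] unit[OF q False]])
      then have "Fl c (q, ?v) \<le> Fl c (p, ?v) + \<eta> * c0" by (simp add: dist_real_def abs_less_iff)
      also have "\<eta> * c0 \<le> \<eta> * Fl c (p, ?v)"
        using \<eta> by (intro mult_left_mono c0(2) unit[OF p False]) simp
      finally have "Fl c (q, ?v) \<le> (1 + \<eta>) * Fl c (p, ?v)" by (simp add: distrib_right)
      then have "norm w * Fl c (q, ?v) \<le> norm w * ((1 + \<eta>) * Fl c (p, ?v))"
        by (rule mult_left_mono) simp
      then show ?thesis unfolding Fl_norm[OF p False] Fl_norm[OF q False] by (simp add: mult.left_commute)
    qed (simp add: Fl0 p q)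
  qed
qed

text \<open>Translating in coordinates leaves the coordinate velocity unchanged and moves only the
  base point, so the hypothesis on \<open>\<kappa>\<close> compares the two speeds at almost every
  parameter.\<close>

lemma translate_path:
  assumes \<gamma>: "lip_path \<gamma> {a..b}" "a < b" and c: "c \<in> A" "\<gamma> ` {a..b} \<subseteq> dom_chart c"
    and z: "\<And>t. t \<in> {a..b} \<Longrightarrow> coord c (\<gamma> t) - z \<in> img_chart c"
    and \<kappa>: "\<And>t w. t \<in> {a..b} \<Longrightarrow> Fl c (coord c (\<gamma> t) - z, w) \<le> \<kappa> * Fl c (coord c (\<gamma> t), w)" "0 \<le> \<kappa>"
  defines "\<sigma> \<equiv> \<lambda>t. inv_coord c (coord c (\<gamma> t) - z)"
  shows "lip_path \<sigma> {a..b}" "len \<sigma> {a..b} \<le> ennreal \<kappa> * len \<gamma> {a..b}"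
proof -
  have ab: "a \<le> b" using \<gamma>(2) by simp
  have \<sigma>dom: "\<sigma> ` {a..b} \<subseteq> dom_chart c" unfolding \<sigma>_def using z inv_coord_in_dom[OF c(1)] by auto
  have \<sigma>c: "coord c (\<sigma> t) = coord c (\<gamma> t) - z" if "t \<in> {a..b}" for t
    unfolding \<sigma>_def by (rule coord_inv_coord[OF c(1) z[OF that]])
  obtain L where L: "L-lipschitz_on {a..b} (coord c \<circ> \<gamma>)"
    using lip_path_lipschitz_in_chart[OF \<gamma>(1) ab c(2,1)] .
  show "lip_path \<sigma> {a..b}"
    unfolding lip_path_def
  proof
    fix t assume t: "t \<in> {a..b}"
    have "L-lipschitz_on ({a..b} \<inter> ball t 1) (coord c \<circ> \<sigma>)"
    proof (rule lipschitz_onI)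
      fix x y assume "x \<in> {a..b} \<inter> ball t 1" "y \<in> {a..b} \<inter> ball t 1"
      then show "dist ((coord c \<circ> \<sigma>) x) ((coord c \<circ> \<sigma>) y) \<le> L * dist x y"
        using lipschitz_onD[OF L, of x y] by (simp add: \<sigma>c dist_norm)
    qed (rule lipschitz_on_nonneg[OF L])
    moreover have "c \<in> charts_at A (\<sigma> t)" using c \<sigma>dom t by (auto simp: charts_at_def)
    moreover have "\<sigma> ` ({a..b} \<inter> ball t 1) \<subseteq> dom_chart c" using \<sigma>dom by blast
    ultimately show "\<exists>c\<in>charts_at A (\<sigma> t). \<exists>e>0. \<exists>L. \<sigma> ` ({a..b} \<inter> ball t e) \<subseteq> dom_chart c \<and>
        L-lipschitz_on ({a..b} \<inter> ball t e) (coord c \<circ> \<sigma>)"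
      using zero_less_one by blast
  qed
  obtain g U K where g: "AE t in lborel. t \<in> {a..b} \<longrightarrow> (coord c \<circ> \<gamma> has_vector_derivative g t) (at t)"
    by (rule lip_path_derivative_in_chart[OF \<gamma>(1) ab c(2,1)]) blast
  obtain B where [measurable]: "B \<in> borel_measurable borel"
    and B: "AE t in lborel. t \<in> {a..b} \<longrightarrow> regular \<gamma> t \<and> ennreal (speed \<gamma> t) = B t"
    using speed_AE_borel[OF \<gamma>(1) ab] .
  have le: "AE t in lborel. ennreal (speed \<sigma> t) * indicator {a..b} t \<le> ennreal \<kappa> * (B t * indicator {a..b} t)"
    using g B AE_lborel_singleton[of a] AE_lborel_singleton[of b]
  proof eventually_elim
    case (elim t)
    show ?case
    proof (cases "t \<in> {a..b}")
      case True
      then have t: "t \<in> {a<..<b}" using elim by auto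
      have d: "(coord c \<circ> \<gamma> has_vector_derivative g t) (at t)" using elim True by blast
      have "((\<lambda>s. (coord c \<circ> \<gamma>) s - z) has_vector_derivative g t - 0) (at t)"
        by (intro has_vector_derivative_diff d has_vector_derivative_const)
      then have "((\<lambda>s. (coord c \<circ> \<gamma>) s - z) has_vector_derivative g t) (at t)" by simp
      then have d\<sigma>: "(coord c \<circ> \<sigma> has_vector_derivative g t) (at t)"
        by (rule has_vector_derivative_transform_within_open[OF _ open_greaterThanLessThan t]) (simp add: \<sigma>c)
      have "speed \<sigma> t = Fl c (coord c (\<gamma> t) - z, g t)"
        using speed_in_chart(2)[OF c(1) \<sigma>dom t d\<sigma>] unfolding \<sigma>c[OF True] .
      also have "\<dots> \<le> \<kappa> * Fl c (coord c (\<gamma> t), g t)" by (rule \<kappa>(1)[OF True])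
      also have "Fl c (coord c (\<gamma> t), g t) = speed \<gamma> t" using speed_in_chart(2)[OF c t d] by simp
      finally have "ennreal (speed \<sigma> t) \<le> ennreal \<kappa> * ennreal (speed \<gamma> t)"
        using \<kappa>(2) by (simp add: ennreal_leI flip: ennreal_mult')
      then show ?thesis using elim True by simp
    qed simp
  qed
  have "len \<sigma> {a..b} \<le> (\<integral>\<^sup>+t. ennreal \<kappa> * (B t * indicator {a..b} t) \<partial>lborel)"
    unfolding len_def by (rule nn_integral_mono_AE[OF le])
  also have "\<dots> = ennreal \<kappa> * (\<integral>\<^sup>+t. B t * indicator {a..b} t \<partial>lborel)"
    by (rule nn_integral_cmult) measurable
  also have "(\<integral>\<^sup>+t. B t * indicator {a..b} t \<partial>lborel) = len \<gamma> {a..b}"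
    unfolding len_def
    by (rule nn_integral_cong_AE, rule eventually_mono[OF B]) (auto simp: indicator_def)
  finally show "len \<sigma> {a..b} \<le> ennreal \<kappa> * len \<gamma> {a..b}" .
qed

text \<open>Projected on its own unit direction \<open>w\<close>, the displacement is the integral
  of \<open>g t \<bullet> w\<close>, which is at most that of \<open>norm (g t)\<close>. In this way
  the variation of a cutoff can be paid for by length.\<close>

lemma chart_displacement_le_len:
  assumes \<gamma>: "lip_path \<gamma> {a..b}" "a < b" and c: "c \<in> A" "\<gamma> ` {a..b} \<subseteq> dom_chart c"
    and c0: "0 < c0" "\<And>t w. t \<in> {a..b} \<Longrightarrow> c0 * norm w \<le> Fl c (coord c (\<gamma> t), w)"
  shows "ennreal (c0 * norm (coord c (\<gamma> b) - coord c (\<gamma> a))) \<le> len \<gamma> {a..b}"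
proof (cases "coord c (\<gamma> b) = coord c (\<gamma> a)")
  case False
  have ab: "a \<le> b" using \<gamma>(2) by simp
  obtain g U K where gm [measurable]: "g \<in> borel_measurable borel" and U: "K-lipschitz_on UNIV U"
    and Ueq: "\<And>t. t \<in> {a..b} \<Longrightarrow> U t = coord c (\<gamma> t)"
    and gU: "AE t in lborel. t \<in> {a..b} \<longrightarrow> (U has_vector_derivative g t) (at t)"
    and g: "AE t in lborel. t \<in> {a..b} \<longrightarrow> (coord c \<circ> \<gamma> has_vector_derivative g t) (at t)"
    by (rule lip_path_derivative_in_chart[OF \<gamma>(1) ab c(2,1)]) blast
  define w where "w = sgn (U b - U a)"
  have nw: "norm w = 1" using False ab by (simp add: w_def norm_sgn Ueq)
  have "(U b - U a) \<bullet> w = norm (U b - U a)"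
    using False ab unfolding w_def sgn_div_norm
    by (simp add: Ueq dot_square_norm power2_eq_square)
  then have eq: "norm (U b - U a) = U b \<bullet> w - U a \<bullet> w" by (simp add: inner_diff_left)
  have lip: "K-lipschitz_on UNIV (\<lambda>t. U t \<bullet> w)"
  proof (rule lipschitz_onI)
    fix s t :: real
    have "\<bar>(U s - U t) \<bullet> w\<bar> \<le> norm (U s - U t) * norm w" by (rule Cauchy_Schwarz_ineq2)
    also have "\<dots> \<le> K * dist s t" using lipschitz_onD[OF U, of s t] nw by (simp add: dist_norm)
    finally show "dist (U s \<bullet> w) (U t \<bullet> w) \<le> K * dist s t" by (simp add: dist_real_def inner_diff_left)
  qed (rule lipschitz_on_nonneg[OF U])
  have [measurable]: "(\<lambda>t. g t \<bullet> w) \<in> borel_measurable borel" by measurable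
  have AE: "AE t in lborel. t \<in> {a..b} \<longrightarrow> ((\<lambda>t. U t \<bullet> w) has_vector_derivative g t \<bullet> w) (at t)"
    using gU by (rule eventually_mono)
      (auto intro: bounded_linear.has_vector_derivative[OF bounded_linear_inner_left])
  have si: "set_integrable lborel {a..b} (\<lambda>t. g t \<bullet> w)" and
    inc: "U b \<bullet> w - U a \<bullet> w = (LINT t:{a..b}|lborel. g t \<bullet> w)"
    by (rule lipschitz_increment_eq_integral[OF lip _ AE ab]; measurable)+
  have "ennreal (c0 * norm (U b - U a)) = ennreal (LINT t|lborel. c0 * (indicator {a..b} t *\<^sub>R (g t \<bullet> w)))"
    unfolding eq inc set_lebesgue_integral_def by simp
  \<comment> \<open>The integrand may be negative, and \<open>ennreal\<close> then gives 0; hence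
    the detour through the positive part.\<close>
  also have "\<dots> \<le> (\<integral>\<^sup>+t. ennreal (c0 * (indicator {a..b} t *\<^sub>R (g t \<bullet> w))) \<partial>lborel)"
  proof -
    have "integrable lborel (\<lambda>t. c0 * (indicator {a..b} t *\<^sub>R (g t \<bullet> w)))"
      using si unfolding set_integrable_def by (rule integrable_mult_right)
    then have int: "integrable lborel (\<lambda>t. max 0 (c0 * (indicator {a..b} t *\<^sub>R (g t \<bullet> w))))"
      by (intro integrable_max) auto
    have "(LINT t|lborel. c0 * (indicator {a..b} t *\<^sub>R (g t \<bullet> w))) \<le>
        (LINT t|lborel. max 0 (c0 * (indicator {a..b} t *\<^sub>R (g t \<bullet> w))))"
      by (intro integral_mono int \<open>integrable lborel (\<lambda>t. c0 * (indicator {a..b} t *\<^sub>R (g t \<bullet> w)))\<close>) simp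
    then have "ennreal (LINT t|lborel. c0 * (indicator {a..b} t *\<^sub>R (g t \<bullet> w))) \<le>
        ennreal (LINT t|lborel. max 0 (c0 * (indicator {a..b} t *\<^sub>R (g t \<bullet> w))))"
      by (rule ennreal_leI)
    also have "\<dots> = (\<integral>\<^sup>+t. ennreal (max 0 (c0 * (indicator {a..b} t *\<^sub>R (g t \<bullet> w)))) \<partial>lborel)"
      by (rule nn_integral_eq_integral[OF int, symmetric]) simp
    also have "\<dots> = (\<integral>\<^sup>+t. ennreal (c0 * (indicator {a..b} t *\<^sub>R (g t \<bullet> w))) \<partial>lborel)"
      by (intro nn_integral_cong) (auto simp: max_def ennreal_neg)
    finally show ?thesis .
  qed
  also have "\<dots> \<le> (\<integral>\<^sup>+t. ennreal (Fl c (coord c (\<gamma> t), g t)) * indicator {a..b} t \<partial>lborel)"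
  proof (rule nn_integral_mono)
    fix t
    show "ennreal (c0 * (indicator {a..b} t *\<^sub>R (g t \<bullet> w))) \<le> ennreal (Fl c (coord c (\<gamma> t), g t)) * indicator {a..b} t"
    proof (cases "t \<in> {a..b}")
      case True
      have "g t \<bullet> w \<le> norm (g t)" using norm_cauchy_schwarz[of "g t" w] nw by simp
      then have "c0 * (g t \<bullet> w) \<le> c0 * norm (g t)" using c0(1) by simp
      also have "\<dots> \<le> Fl c (coord c (\<gamma> t), g t)" by (rule c0(2)[OF True])
      finally show ?thesis using True by (simp add: ennreal_leI)
    qed simp
  qed
  also have "\<dots> = len \<gamma> {a..b}" by (rule len_in_chart[OF c g, symmetric])
  finally show ?thesis using ab by (simp add: Ueq)
qed simp

end

text \<open>\<open>below\<close> makes the distance of \<open>F\<close> finite and its Lipschitz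
  functions Lipschitz for \<open>d\<close>; together with \<open>topology\<close> this makes them
  continuous on the manifold.\<close>

locale finsler_below_metric = finsler_manifold A F
  for A :: "('a::{t2_space, second_countable_topology}, 'e::euclidean_space) chart set"
    and F :: "'a \<Rightarrow> ('a, 'e) tvec \<Rightarrow> real" +
  fixes d :: "'a \<Rightarrow> 'a \<Rightarrow> real"
  assumes metric: "Metric_space UNIV d" and topology: "Metric_space.mtopology UNIV d = euclidean"
    and below: "\<And>x y. finsler_dist A F x y \<le> ennreal (d x y)"
begin

lemma finsler_lipschitz_imp_d:
  assumes "finsler_lipschitz L h" "0 \<le> L"
  shows "\<bar>h x - h y\<bar> \<le> L * d x y"
proof -
  interpret Metric_space UNIV d by (rule metric)
  have "ennreal \<bar>h x - h y\<bar> \<le> ennreal L * finsler_dist A F x y"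
    using assms(1) by (simp add: finsler_lipschitz_def)
  also have "\<dots> \<le> ennreal L * ennreal (d x y)" by (intro mult_left_mono below) simp
  also have "\<dots> = ennreal (L * d x y)" using assms(2) by (simp add: ennreal_mult')
  finally show ?thesis using assms(2) by (subst (asm) ennreal_le_iff) auto
qed

lemma finsler_lipschitz_continuous:
  assumes h: "finsler_lipschitz L h" "0 \<le> L"
  shows "continuous_on UNIV h"
proof -
  interpret Metric_space UNIV d by (rule metric)
  show ?thesis
  proof (rule continuous_at_imp_continuous_on, intro ballI)
    fix x
    show "isCont h x"
      unfolding isCont_def
    proof (rule tendstoI)
      fix e :: real assume e: "0 < e"
      have "openin mtopology (mball x (e / (L + 1)))" by (rule openin_mball)
      then have op: "open (mball x (e / (L + 1)))" by (simp add: topology)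
      have "dist (h y) (h x) < e" if "y \<in> mball x (e / (L + 1))" for y
      proof -
        have "d x y < e / (L + 1)" using that by simp
        then have dy: "d x y * (L + 1) < e" using h(2) by (simp add: less_divide_eq)
        have "\<bar>h x - h y\<bar> \<le> L * d x y" by (rule finsler_lipschitz_imp_d[OF h])
        also have "\<dots> \<le> d x y * (L + 1)" by (simp add: algebra_simps)
        finally show ?thesis using dy by (simp add: dist_real_def abs_minus_commute)
      qed
      moreover have "x \<in> mball x (e / (L + 1))" using e h(2) by simp
      ultimately show "\<forall>\<^sub>F y in at x. dist (h y) (h x) < e"
        unfolding eventually_at_topological using op by blast
    qed
  qed
qed

text \<open>The new function is \<open>h + \<phi> * (m - h)\<close> in the chart, with a
  mollification \<open>m\<close> and a cutoff \<open>\<phi>\<close> that is 1 near the part of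
  \<open>Q\<close> outside \<open>V\<close> and 0 on \<open>C\<close>. Its increments are a convex
  combination of those of \<open>h\<close> and \<open>m\<close>, plus the variation of
  \<open>\<phi>\<close> times \<open>m - h\<close>, which is small because \<open>m\<close> is close
  to \<open>h\<close>.\<close>

lemma smoothing_step:
  assumes h: "finsler_lipschitz L h" "0 \<le> L" "L < L'" and V: "open V" "smooth_at h V"
    and C: "compact C" "C \<subseteq> V" and c: "c \<in> A" and Q: "compact Q" "Q \<subseteq> dom_chart c" and \<epsilon>: "0 < \<epsilon>"
  obtains h' V' where "finsler_lipschitz L' h'" "open V'" "V \<subseteq> V'" "Q \<subseteq> V'" "smooth_at h' V'"
    "\<And>x. x \<in> C \<Longrightarrow> h' x = h x" "\<And>x. \<bar>h' x - h x\<bar> \<le> \<epsilon>"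
proof -
  note inv = inv_coord_coord[OF c] coord_inv_coord[OF c] coord_in_img[OF c] inv_coord_in_dom[OF c]
  \<comment> \<open>Only \<open>Q - V\<close> still needs smoothing, and nothing may change on
    \<open>C\<close>. As \<open>D\<close> is compact and \<open>G\<close> open, a cutoff separates
    the two.\<close>
  define D where "D = coord c ` (Q - V)"
  define G where "G = coord c ` (dom_chart c - C)"
  have D: "compact D" unfolding D_def using Q V
    by (intro compact_coord_image[OF c] compact_diff) auto
  have "closed C" using C(1) by (rule compact_imp_closed)
  then have G: "open G" unfolding G_def
    by (intro open_coord_image[OF c] open_Diff open_dom[OF c]) auto
  have DG: "D \<subseteq> G" unfolding D_def G_def using C(2) Q(2) by blast
  have Gimg: "G \<subseteq> img_chart c" unfolding G_def by (auto simp: inv)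
  obtain \<phi> :: "'e \<Rightarrow> real" and N S K where \<phi>: "smooth_on \<phi> UNIV" "\<And>x. 0 \<le> \<phi> x \<and> \<phi> x \<le> 1" "K-lipschitz_on UNIV \<phi>"
    and N: "open N" "D \<subseteq> N" "\<And>x. x \<in> N \<Longrightarrow> \<phi> x = 1"
    and S: "compact S" "S \<subseteq> G" "\<And>x. x \<notin> S \<Longrightarrow> \<phi> x = 0"
    by (rule smooth_cutoff_exists[OF D G DG]) blast
  have K: "0 \<le> K" using \<phi>(3) by (rule lipschitz_on_nonneg)
  have Simg: "S \<subseteq> img_chart c" using S(2) Gimg by blast
  obtain e where e: "0 < e" "(\<Union>x\<in>S. ball x e) \<subseteq> img_chart c"
    using compact_subset_open_imp_ball_epsilon_subset[OF S(1) open_img[OF c] Simg] by metis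
  define r where "r = e / 3"
  have r: "0 < r" using e(1) by (simp add: r_def)
  \<comment> \<open>Points within \<open>r\<close> of \<open>S\<close> (the set \<open>B\<close>
    below) stay in \<open>R\<close> under shifts by less than \<open>\<delta> \<le> r\<close>, and
    \<open>2 * r < e\<close> keeps \<open>R\<close> inside the chart.\<close>
  define R where "R = {x + y |x y. x \<in> S \<and> y \<in> cball 0 (2 * r)}"
  have Rc: "compact R" unfolding R_def by (intro compact_sums S compact_cball)
  have R_iff: "p \<in> R" if "x \<in> S" "dist x p \<le> 2 * r" for x p
    unfolding R_def mem_Collect_eq using that
    by (intro exI[of _ x] exI[of _ "p - x"]) (auto simp: dist_norm norm_minus_commute)
  have Rimg: "R \<subseteq> img_chart c"
  proof
    fix p assume "p \<in> R"
    then obtain x y where "x \<in> S" "norm y \<le> 2 * r" "p = x + y" unfolding R_def by auto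
    then have "p \<in> ball x e" using r by (auto simp: dist_norm r_def)
    then show "p \<in> img_chart c" using e(2) \<open>x \<in> S\<close> by blast
  qed
  \<comment> \<open>The factor \<open>1 + \<eta>\<close> lost by translating curves may raise
    \<open>L\<close> at most to the midpoint \<open>M\<close> of \<open>L\<close> and
    \<open>L'\<close>; the other half of the gap is kept for the cutoff. Using \<open>L + 1\<close>
    covers the case \<open>L = 0\<close>.\<close>
  define \<eta> where "\<eta> = (L' - L) / (2 * (L + 1))"
  have \<eta>: "0 < \<eta>" using h by (simp add: \<eta>_def)
  define M where "M = (L + L') / 2"
  have L\<eta>: "L * (1 + \<eta>) \<le> M"
  proof -
    have "L * \<eta> \<le> (L + 1) * \<eta>" using \<eta> by simp
    also have "\<dots> = (L' - L) / 2"
    proof -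
      have "x * (y / (2 * x)) = y / 2" if "x \<noteq> 0" for x y :: real using that by simp
      from this[of "L + 1"] show ?thesis using h(2) unfolding \<eta>_def by simp
    qed
    finally show ?thesis by (simp add: M_def field_simps)
  qed
  obtain c0 \<delta>0 where c0: "0 < c0" "\<And>p w. p \<in> R \<Longrightarrow> c0 * norm w \<le> Fl c (p, w)"
    and \<delta>0: "0 < \<delta>0" "\<And>p q w. p \<in> R \<Longrightarrow> q \<in> R \<Longrightarrow> dist p q < \<delta>0 \<Longrightarrow> Fl c (q, w) \<le> (1 + \<eta>) * Fl c (p, w)"
    by (rule Fl_uniform[OF c Rc Rimg \<eta>]) blast
  have hc: "continuous_on UNIV h" by (rule finsler_lipschitz_continuous[OF h(1,2)])
  have "continuous_on R (h \<circ> inv_coord c)"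
    by (intro continuous_on_compose continuous_on_subset[OF hc] continuous_on_subset[OF continuous_inv_coord[OF c] Rimg]) auto
  moreover have "closedin (top_of_set UNIV) R" using Rc by (simp add: compact_imp_closed)
  \<comment> \<open>Mollification acts on functions continuous on the whole space. How
    \<open>h\<close> is extended beyond \<open>R\<close> does not matter, since over
    \<open>B\<close> the mean only involves values on \<open>R\<close>.\<close>
  ultimately obtain H where H: "continuous_on UNIV H" "\<And>p. p \<in> R \<Longrightarrow> H p = (h \<circ> inv_coord c) p"
    by (rule Tietze_unbounded) blast
  \<comment> \<open>On an arc of length \<open>l\<close> the cutoff varies by at most
    \<open>K * l / c0\<close>; times the mollification error \<open>\<epsilon>'\<close> this is at
    most \<open>(L' - L) / 2 * l\<close>.\<close>
  define \<epsilon>' where "\<epsilon>' = min \<epsilon> ((L' - L) * c0 / (2 * (K + 1)))"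
  have \<epsilon>': "0 < \<epsilon>'" "\<epsilon>' \<le> \<epsilon>" using \<epsilon> h c0 K by (auto simp: \<epsilon>'_def)
  have K\<epsilon>: "K * \<epsilon>' \<le> (L' - L) / 2 * c0"
  proof -
    have "K * \<epsilon>' \<le> (K + 1) * ((L' - L) * c0 / (2 * (K + 1)))"
      using K \<epsilon>'(1) by (intro mult_mono) (auto simp: \<epsilon>'_def)
    also have "\<dots> = (L' - L) / 2 * c0"
    proof -
      have "x * (y * z / (2 * x)) = y / 2 * z" if "x \<noteq> 0" for x y z :: real using that by simp
      from this[of "K + 1"] show ?thesis using K by simp
    qed
    finally show ?thesis .
  qed
  have "uniformly_continuous_on R H"
    by (rule compact_uniformly_continuous[OF continuous_on_subset[OF H(1)] Rc]) simp
  then obtain \<delta>1 where \<delta>1: "0 < \<delta>1" "\<And>p q. p \<in> R \<Longrightarrow> q \<in> R \<Longrightarrow> dist q p < \<delta>1 \<Longrightarrow> dist (H q) (H p) < \<epsilon>'"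
    unfolding uniformly_continuous_on_def using \<epsilon>'(1) by metis
  define \<delta> where "\<delta> = min r (min \<delta>0 \<delta>1)"
  have \<delta>: "0 < \<delta>" "\<delta> \<le> r" "\<delta> \<le> \<delta>0" "\<delta> \<le> \<delta>1" using r \<delta>0 \<delta>1 by (auto simp: \<delta>_def)
  obtain \<rho> :: "'e \<Rightarrow> real" where "mollifier \<rho> \<delta>" using mollifier_obtain[OF \<delta>(1)] .
  then interpret mollifier \<rho> \<delta> .
  define m where "m = mollify \<rho> H"
  define B where "B = (\<Union>x\<in>S. ball x r)"
  have B: "open B" unfolding B_def by blast
  have SB: "S \<subseteq> B" unfolding B_def using r by auto
  have BR: "p - z \<in> R" if "p \<in> B" "norm z < \<delta>" for p z
  proof -
    obtain x where x: "x \<in> S" "dist x p < r" using \<open>p \<in> B\<close> by (auto simp: B_def)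
    have "dist x (p - z) \<le> dist x p + dist p (p - z)" by (rule dist_triangle)
    also have "\<dots> \<le> 2 * r" using x(2) that(2) \<delta>(2) by (simp add: dist_norm)
    finally show ?thesis by (rule R_iff[OF x(1)])
  qed
  have BR0: "p \<in> R" if "p \<in> B" for p using BR[OF that, of 0] \<delta>(1) by simp
  have Bimg: "B \<subseteq> img_chart c" using BR0 Rimg by blast
  have m_near: "\<bar>m p - h (inv_coord c p)\<bar> \<le> \<epsilon>'" if p: "p \<in> B" for p
    unfolding m_def
  proof (rule mollify_near[OF H(1)])
    fix z :: 'e assume z: "norm z < \<delta>"
    have "dist (H (p - z)) (H p) < \<epsilon>'"
      by (rule \<delta>1(2)[OF BR0[OF p] BR[OF p z]]) (use z \<delta>(4) in \<open>simp add: dist_norm\<close>)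
    then show "\<bar>H (p - z) - h (inv_coord c p)\<bar> \<le> \<epsilon>'"
      using H(2)[OF BR0[OF p]] by (simp add: dist_real_def)
  qed
  define h' where "h' x = (if x \<in> dom_chart c then h x + \<phi> (coord c x) * (m (coord c x) - h x) else h x)" for x
  define T where "T = inv_coord c ` S"
  have T: "closed T" unfolding T_def by (intro compact_imp_closed compact_inv_coord_image[OF c S(1) Simg])
  have h'_off: "h' x = h x" if "x \<notin> T" for x
  proof (cases "x \<in> dom_chart c")
    case True
    then have "coord c x \<notin> S" using that inv(1)[OF True] unfolding T_def by force
    then show ?thesis using S(3) by (simp add: h'_def)
  qed (simp add: h'_def)
  have TC: "x \<notin> T" if "x \<in> C" for x
  proof
    assume "x \<in> T"
    then obtain p where p: "p \<in> S" "x = inv_coord c p" by (auto simp: T_def)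
    then obtain y where "y \<in> dom_chart c" "y \<notin> C" "p = coord c y" using S(2) unfolding G_def by blast
    then show False using p that by (simp add: inv)
  qed
  have Tdom: "x \<in> dom_chart c" "coord c x \<in> S" if "x \<in> T" for x
    using that Simg unfolding T_def by (auto simp: inv subset_iff)
  have h'_near: "\<bar>h' x - h x\<bar> \<le> \<epsilon>" for x
  proof (cases "x \<in> T")
    case True
    have "h' x - h x = \<phi> (coord c x) * (m (coord c x) - h x)" using Tdom[OF True] by (simp add: h'_def)
    then have "\<bar>h' x - h x\<bar> = \<phi> (coord c x) * \<bar>m (coord c x) - h x\<bar>" using \<phi>(2) by (simp add: abs_mult)
    also have "\<dots> \<le> 1 * \<epsilon>'"
      using m_near[of "coord c x"] Tdom[OF True] SB \<phi>(2) by (intro mult_mono) (auto simp: inv)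
    finally show ?thesis using \<epsilon>'(2) by simp
  qed (use h'_off \<epsilon> in simp)
  \<comment> \<open>On the added set \<open>\<phi>\<close> is 1, so \<open>h'\<close> is the
    mollification there. At other points of \<open>V\<close> it is a smooth blend of
    \<open>h\<close> and \<open>m\<close>, or \<open>h\<close> itself.\<close>
  define V' where "V' = V \<union> inv_coord c ` (N \<inter> img_chart c)"
  have Nimg: "open (N \<inter> img_chart c)" by (intro open_Int N open_img[OF c])
  have V'open: "open V'" unfolding V'_def by (intro open_Un V open_inv_coord_image[OF c Nimg]) simp
  have QV': "Q \<subseteq> V'"
  proof
    fix x assume x: "x \<in> Q"
    show "x \<in> V'"
    proof (cases "x \<in> V")
      case False
      then have "coord c x \<in> N" "x \<in> dom_chart c" using x N(2) Q(2) by (auto simp: D_def)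
      then have "inv_coord c (coord c x) \<in> V'" unfolding V'_def by (blast intro: inv(3))
      then show ?thesis using \<open>x \<in> dom_chart c\<close> by (simp add: inv)
    qed (simp add: V'_def)
  qed
  have smooth_m: "C_k_on k m UNIV" for k
    using smooth_on_mollify[OF H(1)] by (simp add: m_def smooth_on_def)
  have smooth_\<phi>: "C_k_on k \<phi> UNIV" for k using \<phi>(1) by (simp add: smooth_on_def)
  have sm': "smooth_at h' V'"
  proof (rule smooth_at_local)
    fix x assume x: "x \<in> V'"
    then consider "x \<in> inv_coord c ` (N \<inter> img_chart c)" | "x \<in> V" "x \<in> T" | "x \<in> V" "x \<notin> T"
      unfolding V'_def by blast
    then show "\<exists>W. open W \<and> x \<in> W \<and> smooth_at h' W"
    proof cases
      case 1
      have "C_k_on k (h' \<circ> inv_coord c) (N \<inter> img_chart c)" for k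
        by (rule C_k_on_cong[OF Nimg _ C_k_on_subset[OF smooth_m]]) (auto simp: h'_def inv N(3))
      then have "smooth_at h' (inv_coord c ` (N \<inter> img_chart c))"
        by (intro smooth_at_chart[OF c Nimg]) auto
      then show ?thesis using 1 open_inv_coord_image[OF c Nimg] by blast
    next
      case 2
      let ?W = "img_chart c \<inter> inv_coord c -` V"
      have W: "open ?W" by (rule open_inv_coord_vimage[OF c V(1)])
      have "C_k_on k (h' \<circ> inv_coord c) ?W" for k
      proof (rule C_k_on_cong[OF W])
        have hk: "C_k_on k (h \<circ> inv_coord c) ?W" using V(2) c by (simp add: smooth_at_def)
        have "C_k_on k (\<lambda>p. - (h \<circ> inv_coord c) p) ?W"
          by (rule C_k_on_bounded_linear_compose[OF bounded_linear_minus[OF bounded_linear_ident] W hk])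
        then have "C_k_on k (\<lambda>p. m p + - (h \<circ> inv_coord c) p) ?W"
          by (intro C_k_on_add[OF W] C_k_on_subset[OF smooth_m]) auto
        then show "C_k_on k (\<lambda>p. (h \<circ> inv_coord c) p + \<phi> p * (m p + - (h \<circ> inv_coord c) p)) ?W"
          by (intro C_k_on_add[OF W hk] C_k_on_bilinear[OF bounded_bilinear_mult W] C_k_on_subset[OF smooth_\<phi>]) auto
      qed (simp add: h'_def inv)
      then have "smooth_at h' (inv_coord c ` ?W)" by (intro smooth_at_chart[OF c W]) auto
      moreover have "x \<in> inv_coord c ` ?W"
        using 2 Tdom(1)[OF 2(2)] by (intro image_eqI[of _ _ "coord c x"]) (auto simp: inv)
      ultimately show ?thesis using open_inv_coord_image[OF c W] by blast
    next
      case 3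
      have "smooth_at h' (V - T)"
        by (rule smooth_at_cong[OF open_Diff[OF V(1) T] _ _ V(2)]) (auto simp: h'_off)
      then show ?thesis using 3 open_Diff[OF V(1) T] by blast
    qed
  qed
  have "finsler_lipschitz L' h'"
  proof (rule finsler_lipschitz_local)
    show "0 < L'" using h by simp
    fix x
    show "\<exists>U. open U \<and> x \<in> U \<and> (\<forall>\<gamma> a b. a < b \<longrightarrow> lip_path \<gamma> {a..b} \<longrightarrow> \<gamma> ` {a..b} \<subseteq> U \<longrightarrow>
        ennreal \<bar>h' (\<gamma> a) - h' (\<gamma> b)\<bar> \<le> ennreal L' * len \<gamma> {a..b})"
    \<comment> \<open>Off the closed set \<open>T\<close> the function has not changed. A point of
      \<open>T\<close> has the neighbourhood over \<open>B\<close>, where curves can be translated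
      by all shifts of the mollifier.\<close>
    proof (cases "x \<in> T")
      case False
      have "ennreal \<bar>h' (\<gamma> a) - h' (\<gamma> b)\<bar> \<le> ennreal L' * len \<gamma> {a..b}"
        if "a < b" "lip_path \<gamma> {a..b}" "\<gamma> ` {a..b} \<subseteq> - T" for \<gamma> a b
      proof -
        have "a \<in> {a..b}" "b \<in> {a..b}" using that(1) by auto
        then have "\<gamma> a \<notin> T" "\<gamma> b \<notin> T" using that(3) by blast+
        then have "ennreal \<bar>h' (\<gamma> a) - h' (\<gamma> b)\<bar> \<le> ennreal L * len \<gamma> {a..b}"
          using finsler_lipschitz_len[OF h(1) that(2,1)] by (simp add: h'_off)
        also have "\<dots> \<le> ennreal L' * len \<gamma> {a..b}" using h(3) by (intro mult_right_mono ennreal_leI) auto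
        finally show ?thesis .
      qed
      then show ?thesis using False T by (intro exI[of _ "- T"]) auto
    next
      case True
      let ?W = "inv_coord c ` B"
      have W: "open ?W" by (rule open_inv_coord_image[OF c B Bimg])
      have "ennreal \<bar>h' (\<gamma> a) - h' (\<gamma> b)\<bar> \<le> ennreal L' * len \<gamma> {a..b}"
        if ab: "a < b" and \<gamma>: "lip_path \<gamma> {a..b}" and im: "\<gamma> ` {a..b} \<subseteq> ?W" for \<gamma> a b
      proof (cases "len \<gamma> {a..b} = top")
        case True
        then show ?thesis using h by (simp add: ennreal_mult_top)
      next
        case False
        then obtain l where l: "len \<gamma> {a..b} = ennreal l" "0 \<le> l" by (cases "len \<gamma> {a..b}") auto
        define u where "u t = coord c (\<gamma> t)" for t
        have uB: "u t \<in> B" and \<gamma>u: "inv_coord c (u t) = \<gamma> t" and \<gamma>d: "\<gamma> t \<in> dom_chart c"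
          if "t \<in> {a..b}" for t
        proof -
          have "\<gamma> t \<in> ?W" by (rule subsetD[OF im imageI[OF that]])
          then obtain p where p: "\<gamma> t = inv_coord c p" "p \<in> B" by (rule imageE)
          then have "p \<in> img_chart c" using Bimg by blast
          with p show "u t \<in> B" "inv_coord c (u t) = \<gamma> t" "\<gamma> t \<in> dom_chart c"
            by (auto simp: u_def inv)
        qed
        have dom: "\<gamma> ` {a..b} \<subseteq> dom_chart c" by (intro image_subsetI \<gamma>d)
        have ends: "a \<in> {a..b}" "b \<in> {a..b}" using ab by auto
        have "ennreal \<bar>h (\<gamma> a) - h (\<gamma> b)\<bar> \<le> ennreal L * ennreal l"
          using finsler_lipschitz_len[OF h(1) \<gamma> ab] l by simp
        then have 1: "\<bar>h (\<gamma> a) - h (\<gamma> b)\<bar> \<le> L * l"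
          using h l by (simp flip: ennreal_mult')
        \<comment> \<open>For each shift \<open>z\<close> the increment of \<open>H\<close> between
          the shifted end points is the increment of \<open>h\<close> along the translated curve,
          whose length is at most \<open>(1 + \<eta>) * l\<close>.\<close>
        have 2: "\<bar>m (u a) - m (u b)\<bar> \<le> L * ((1 + \<eta>) * l)"
          unfolding m_def
        proof (rule mollify_diff_le[OF H(1)])
          fix z :: 'e assume z: "norm z < \<delta>"
          have zi: "coord c (\<gamma> t) - z \<in> img_chart c" if "t \<in> {a..b}" for t
            using BR[OF uB[OF that] z] Rimg by (auto simp: u_def)
          have \<kappa>: "Fl c (coord c (\<gamma> t) - z, w) \<le> (1 + \<eta>) * Fl c (coord c (\<gamma> t), w)" if "t \<in> {a..b}" for t w
            using \<delta>0(2)[OF BR0[OF uB[OF that]] BR[OF uB[OF that] z]] z \<delta>(3) by (simp add: u_def dist_norm)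
          have \<eta>0: "0 \<le> 1 + \<eta>" using \<eta> by simp
          note tr = translate_path[OF \<gamma> ab c dom zi \<kappa> \<eta>0]
          have eqH: "h (inv_coord c (coord c (\<gamma> t) - z)) = H (u t - z)" if "t \<in> {a..b}" for t
            using H(2)[OF BR[OF uB[OF that] z]] by (simp add: u_def)
          have "ennreal \<bar>H (u a - z) - H (u b - z)\<bar> \<le> ennreal L * len (\<lambda>t. inv_coord c (coord c (\<gamma> t) - z)) {a..b}"
            using finsler_lipschitz_len[OF h(1) tr(1) ab] unfolding eqH[OF ends(1)] eqH[OF ends(2)] .
          also have "\<dots> \<le> ennreal L * (ennreal (1 + \<eta>) * ennreal l)"
            using tr(2) unfolding l(1) by (rule mult_left_mono) simp_all
          also have "\<dots> = ennreal (L * ((1 + \<eta>) * l))" using h(2) \<eta>0 l(2) by (simp add: ennreal_mult')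
          finally show "\<bar>H (u a - z) - H (u b - z)\<bar> \<le> L * ((1 + \<eta>) * l)"
            using h(2) \<eta>0 l(2) by (subst (asm) ennreal_le_iff) auto
        qed
        have "ennreal (c0 * norm (coord c (\<gamma> b) - coord c (\<gamma> a))) \<le> len \<gamma> {a..b}"
          by (rule chart_displacement_le_len[OF \<gamma> ab c dom c0(1)])
            (use c0(2)[OF BR0[OF uB]] in \<open>simp add: u_def\<close>)
        then have 3: "c0 * norm (u a - u b) \<le> l"
          using l by (simp add: u_def norm_minus_commute)
        have M1: "L * l \<le> M * l" using h l by (intro mult_right_mono) (auto simp: M_def)
        have M2: "L * ((1 + \<eta>) * l) \<le> M * l" using mult_right_mono[OF L\<eta> l(2)] by (simp add: mult.assoc)
        have h'u: "h' (\<gamma> t) = h (\<gamma> t) + \<phi> (u t) * (m (u t) - h (\<gamma> t))" if "t \<in> {a..b}" for t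
          using \<gamma>d[OF that] by (simp add: h'_def u_def)
        have \<phi>u: "0 \<le> \<phi> (u a)" "\<phi> (u a) \<le> 1" using \<phi>(2) by auto
        \<comment> \<open>The weights are frozen at \<open>a\<close> and the difference
          \<open>m - h\<close> at \<open>b\<close>, so that the last term carries all the variation
          of the cutoff.\<close>
        have "h' (\<gamma> a) - h' (\<gamma> b) = (1 - \<phi> (u a)) * (h (\<gamma> a) - h (\<gamma> b)) + \<phi> (u a) * (m (u a) - m (u b)) +
            (\<phi> (u a) - \<phi> (u b)) * (m (u b) - h (\<gamma> b))"
          unfolding h'u[OF ends(1)] h'u[OF ends(2)] by (simp add: algebra_simps)
        also have "\<bar>\<dots>\<bar> \<le> \<bar>(1 - \<phi> (u a)) * (h (\<gamma> a) - h (\<gamma> b))\<bar> + \<bar>\<phi> (u a) * (m (u a) - m (u b))\<bar> +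
            \<bar>(\<phi> (u a) - \<phi> (u b)) * (m (u b) - h (\<gamma> b))\<bar>"
          by (intro order_trans[OF abs_triangle_ineq] add_mono abs_triangle_ineq order_refl)
        also have "\<dots> \<le> (1 - \<phi> (u a)) * (M * l) + \<phi> (u a) * (M * l) + (L' - L) / 2 * l"
        proof (intro add_mono)
          show "\<bar>(1 - \<phi> (u a)) * (h (\<gamma> a) - h (\<gamma> b))\<bar> \<le> (1 - \<phi> (u a)) * (M * l)"
            using 1 M1 \<phi>u by (simp add: abs_mult mult_left_mono)
          show "\<bar>\<phi> (u a) * (m (u a) - m (u b))\<bar> \<le> \<phi> (u a) * (M * l)"
            using 2 M2 \<phi>u by (simp add: abs_mult mult_left_mono)
          have "\<bar>(\<phi> (u a) - \<phi> (u b)) * (m (u b) - h (\<gamma> b))\<bar> \<le> (K * norm (u a - u b)) * \<epsilon>'"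
            unfolding abs_mult
            using lipschitz_onD[OF \<phi>(3) UNIV_I UNIV_I, of "u a" "u b"] m_near[OF uB[OF ends(2)]] K
            by (intro mult_mono) (auto simp: dist_norm \<gamma>u[OF ends(2)])
          also have "\<dots> = (K * \<epsilon>') * norm (u a - u b)" by simp
          also have "\<dots> \<le> ((L' - L) / 2 * c0) * norm (u a - u b)" by (rule mult_right_mono[OF K\<epsilon>]) simp
          also have "\<dots> = (L' - L) / 2 * (c0 * norm (u a - u b))" by simp
          also have "\<dots> \<le> (L' - L) / 2 * l" using h(3) by (intro mult_left_mono 3) simp
          finally show "\<bar>(\<phi> (u a) - \<phi> (u b)) * (m (u b) - h (\<gamma> b))\<bar> \<le> (L' - L) / 2 * l" .
        qed
        also have "\<dots> = L' * l" by (simp add: M_def algebra_simps) (simp add: field_simps)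
        finally have "ennreal \<bar>h' (\<gamma> a) - h' (\<gamma> b)\<bar> \<le> ennreal (L' * l)" by (rule ennreal_leI)
        then show ?thesis using l h by (simp add: ennreal_mult')
      qed
      moreover have "x \<in> ?W" using True SB unfolding T_def by blast
      ultimately show ?thesis using W by (intro exI[of _ ?W]) blast
    qed
  qed
  then show thesis
    by (rule that[OF _ V'open _ QV' sm' h'_off[OF TC] h'_near]) (simp_all add: V'_def)
qed

end

section \<open>Smooth approximation\<close>

context smooth_manifold
begin

text \<open>The open sets \<open>W n\<close> serve as neighbourhoods for checking smoothness, the
  compact \<open>Q n\<close> are what one smoothing step can treat. Second countability enters
  through Lindelof's theorem.\<close>

lemma countable_compact_chart_cover:
  obtains W Q :: "nat \<Rightarrow> 'a set" and c where
    "\<And>n. open (W n)" "\<And>n. W n \<subseteq> Q n" "\<And>n. compact (Q n)" "\<And>n. Q n \<subseteq> dom_chart (c n)"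
    "\<And>n. c n \<in> A" "(\<Union>n. W n) = UNIV"
proof -
  define \<W> where "\<W> = {W. open W \<and> (\<exists>c\<in>A. \<exists>Q. compact Q \<and> W \<subseteq> Q \<and> Q \<subseteq> dom_chart c)}"
  have cover: "\<Union>\<W> = UNIV"
  proof (intro set_eqI iffI UNIV_I)
    fix x :: 'a
    obtain c where "c \<in> charts_at A x" by (rule chart_at_exists)
    then have c: "c \<in> A" "x \<in> dom_chart c" by (auto simp: charts_at_def)
    obtain r where r: "0 < r" "cball (coord c x) r \<subseteq> img_chart c"
      using open_img[OF c(1)] coord_in_img[OF c] open_contains_cball by blast
    let ?W = "inv_coord c ` ball (coord c x) r" and ?Q = "inv_coord c ` cball (coord c x) r"
    have sub: "ball (coord c x) r \<subseteq> img_chart c" using r(2) ball_subset_cball by blast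
    have "open ?W" by (rule open_inv_coord_image[OF c(1) open_ball sub])
    moreover have "compact ?Q" by (rule compact_inv_coord_image[OF c(1) compact_cball r(2)])
    moreover have "?W \<subseteq> ?Q" by (rule image_mono[OF ball_subset_cball])
    moreover have "?Q \<subseteq> dom_chart c" using r(2) inv_coord_in_dom[OF c(1)] by blast
    ultimately have "?W \<in> \<W>" unfolding \<W>_def using c(1) by blast
    moreover have "x \<in> ?W"
      using r(1) inv_coord_coord[OF c] by (intro image_eqI[of _ _ "coord c x"]) auto
    ultimately show "x \<in> \<Union>\<W>" by blast
  qed
  obtain \<W>' where W': "\<W>' \<subseteq> \<W>" "countable \<W>'" "\<Union>\<W>' = \<Union>\<W>"
    using Lindelof[of \<W>] unfolding \<W>_def by blast
  then have ne: "\<W>' \<noteq> {}" using cover by auto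
  define W where "W = from_nat_into \<W>'"
  have range: "range W = \<W>'" unfolding W_def by (rule range_from_nat_into[OF ne W'(2)])
  have "\<exists>p. compact (fst p) \<and> W n \<subseteq> fst p \<and> fst p \<subseteq> dom_chart (snd p) \<and> snd p \<in> A" for n
  proof -
    have "W n \<in> \<W>" using range W'(1) by blast
    then obtain c Q where "c \<in> A" "compact Q" "W n \<subseteq> Q" "Q \<subseteq> dom_chart c"
      unfolding \<W>_def by blast
    then show ?thesis by (intro exI[of _ "(Q, c)"]) simp
  qed
  then obtain p where p: "\<And>n. compact (fst (p n))" "\<And>n. W n \<subseteq> fst (p n)"
    "\<And>n. fst (p n) \<subseteq> dom_chart (snd (p n))" "\<And>n. snd (p n) \<in> A"
    by metis
  have "open (W n)" for n using range W'(1) unfolding \<W>_def by blast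
  moreover have "(\<Union>n. W n) = UNIV" using range W'(3) cover by simp
  ultimately show thesis using that[of W "\<lambda>n. fst (p n)" "\<lambda>n. snd (p n)"] p by blast
qed

end

section \<open>Infinitely many smoothing steps, and the extension from finite sets\<close>

context finsler_below_metric
begin

text \<open>Infinitely many steps must fit into the gap between \<open>L\<close> and
  \<open>L'\<close> and into the tolerance \<open>\<epsilon>\<close>: the constants increase along
  \<open>M n\<close>, and step \<open>n\<close> moves the function by at most
  \<open>\<epsilon> / 2 ^ Suc n\<close>.\<close>

theorem smooth_approximation:
  assumes g: "finsler_lipschitz L g" "0 \<le> L" "L < L'" and \<epsilon>: "0 < \<epsilon>"
  obtains h where "h \<in> smooth_functions A" "finsler_lipschitz L' h" "\<And>x. \<bar>h x - g x\<bar> \<le> \<epsilon>"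
proof -
  obtain W Q :: "nat \<Rightarrow> 'a set" and c where W: "\<And>n. open (W n)" "\<And>n. W n \<subseteq> Q n"
    and Q: "\<And>n. compact (Q n)" "\<And>n. Q n \<subseteq> dom_chart (c n)" and c: "\<And>n. c n \<in> A"
    and cover: "(\<Union>n. W n) = UNIV"
    by (rule countable_compact_chart_cover) blast
  define M where "M n = L' - (L' - L) / 2 ^ n" for n :: nat
  have M: "L \<le> M n" "M n < M (Suc n)" "M n \<le> L'" for n
  proof -
    have "(L' - L) / 2 ^ n \<le> (L' - L) / 1" using g(3) by (intro divide_left_mono) auto
    then show "L \<le> M n" by (simp add: M_def)
    have "0 < (L' - L) / 2 ^ Suc n" using g(3) by simp
    moreover have "(L' - L) / 2 ^ n = 2 * ((L' - L) / 2 ^ Suc n)" by (simp add: field_simps)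
    ultimately show "M n < M (Suc n)" "M n \<le> L'" unfolding M_def by linarith+
  qed
  define C where "C n = (\<Union>j<n. Q j)" for n :: nat
  \<comment> \<open>The state after \<open>n\<close> steps is a function with an open set on which
    it is smooth. The last conjunct anchors the sequence at \<open>g\<close>, because dependent
    choice guarantees nothing about the initial state beyond \<open>P 0\<close>.\<close>
  define P where "P n s \<longleftrightarrow> finsler_lipschitz (M n) (fst s) \<and> open (snd s) \<and>
    smooth_at (fst s) (snd s) \<and> C n \<subseteq> snd s \<and> (n = 0 \<longrightarrow> fst s = g)" for n and s :: "('a \<Rightarrow> real) \<times> 'a set"
  define S where "S n s s' \<longleftrightarrow> (\<forall>x\<in>C n. fst s' x = fst s x) \<and> (\<forall>x. \<bar>fst s' x - fst s x\<bar> \<le> \<epsilon> / 2 ^ Suc n)"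
    for n :: nat and s s' :: "('a \<Rightarrow> real) \<times> 'a set"
  \<comment> \<open>Nothing is required to be smooth yet: the open set and \<open>C 0\<close> are
    empty, and \<open>M 0 = L\<close>.\<close>
  have "\<exists>s. P 0 s"
    by (rule exI[of _ "(g, {})"])
      (auto simp: P_def M_def C_def g intro: smooth_at_local)
  moreover have "\<exists>s'. P (Suc n) s' \<and> S n s s'" if P: "P n s" for n s
  proof -
    have h: "finsler_lipschitz (M n) (fst s)" "open (snd s)" "smooth_at (fst s) (snd s)" "C n \<subseteq> snd s"
      using P by (auto simp: P_def)
    have Cc: "compact (C n)" unfolding C_def using Q(1) by (intro compact_UN) auto
    have M0: "0 \<le> M n" using M(1)[of n] g(2) by linarith
    have \<epsilon>n: "0 < \<epsilon> / 2 ^ Suc n" using \<epsilon> by simp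
    obtain h' V' where h': "finsler_lipschitz (M (Suc n)) h'" "open V'" "snd s \<subseteq> V'" "Q n \<subseteq> V'"
      "smooth_at h' V'" "\<And>x. x \<in> C n \<Longrightarrow> h' x = fst s x" "\<And>x. \<bar>h' x - fst s x\<bar> \<le> \<epsilon> / 2 ^ Suc n"
      by (rule smoothing_step[OF h(1) M0 M(2) h(2,3) Cc h(4) c Q \<epsilon>n]) blast
    have "C (Suc n) = C n \<union> Q n" by (auto simp: C_def less_Suc_eq)
    then have "C (Suc n) \<subseteq> V'" using h(4) h'(3,4) by blast
    then show ?thesis
      using h' by (intro exI[of _ "(h', V')"]) (simp add: P_def S_def)
  qed
  ultimately have "\<exists>s. \<forall>n. P n (s n) \<and> S n (s n) (s (Suc n))" by (rule dependent_nat_choice)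
  then obtain s where s: "\<And>n. P n (s n)" "\<And>n. S n (s n) (s (Suc n))" by blast
  define H where "H n = fst (s n)" for n
  have lip: "finsler_lipschitz (M n) (H n)" for n using s(1)[of n] by (simp add: P_def H_def)
  \<comment> \<open>On \<open>Q j\<close> the sequence is constant from \<open>Suc j\<close> on, so that no convergence of derivatives is needed.\<close>
  have stable: "H n x = H (Suc j) x" if "x \<in> Q j" "Suc j \<le> n" for n j x
    using that(2)
  proof (induction n rule: dec_induct)
    case (step n)
    have "x \<in> C n" using step(1) \<open>x \<in> Q j\<close> by (auto simp: C_def)
    then have "H (Suc n) x = H n x" using s(2)[of n] by (simp add: S_def H_def)
    then show ?case using step by simp
  qed simp
  have close: "\<bar>H n x - H 0 x\<bar> \<le> \<epsilon> * (1 - 1 / 2 ^ n)" for n x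
  proof (induction n)
    case (Suc n)
    have "\<bar>H (Suc n) x - H n x\<bar> \<le> \<epsilon> / 2 ^ Suc n" using s(2)[of n] by (simp add: S_def H_def)
    then have "\<bar>H (Suc n) x - H 0 x\<bar> \<le> \<epsilon> * (1 - 1 / 2 ^ n) + \<epsilon> / 2 ^ Suc n" using Suc by linarith
    also have "\<dots> = \<epsilon> * (1 - 1 / 2 ^ Suc n)" by (simp add: field_simps)
    finally show ?case .
  qed simp
  define k where "k x = (LEAST j. x \<in> Q j)" for x
  have k: "x \<in> Q (k x)" for x
  proof -
    have "\<exists>j. x \<in> Q j" using cover W(2) by blast
    then show ?thesis unfolding k_def by (rule LeastI_ex)
  qed
  \<comment> \<open>\<open>Q j\<close> is part of \<open>C n\<close> from \<open>n = Suc j\<close>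
    on, hence the successor in the index.\<close>
  define h where "h x = H (Suc (k x)) x" for x
  have h_eq: "h x = H n x" if "x \<in> Q j" "Suc j \<le> n" for x j n
  proof -
    have "k x \<le> j" unfolding k_def by (rule Least_le[of "\<lambda>j. x \<in> Q j", OF that(1)])
    then show ?thesis unfolding h_def using stable[OF k, of x n] that(2) by simp
  qed
  show thesis
  proof (rule that)
    have "smooth_at h UNIV"
    proof (rule smooth_at_local)
      fix x
      obtain j where j: "x \<in> W j" using cover by blast
      have "smooth_at (H (Suc j)) (snd (s (Suc j)))" using s(1)[of "Suc j"] by (simp add: P_def H_def)
      moreover have "W j \<subseteq> snd (s (Suc j))"
      proof -
        have "W j \<subseteq> C (Suc j)" using W(2)[of j] by (auto simp: C_def)
        then show ?thesis using s(1)[of "Suc j"] by (auto simp: P_def)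
      qed
      moreover have "H (Suc j) y = h y" if "y \<in> W j" for y
        using h_eq[of y j "Suc j"] that W(2)[of j] by auto
      ultimately have "smooth_at h (W j)" using smooth_at_cong[OF W(1)] by blast
      then show "\<exists>V. open V \<and> x \<in> V \<and> smooth_at h V" using W(1) j by blast
    qed
    then show "h \<in> smooth_functions A" by (simp add: smooth_at_UNIV_iff)
    show "finsler_lipschitz L' h"
      unfolding finsler_lipschitz_def
    proof (intro allI)
      fix x y
      \<comment> \<open>From this index on \<open>h\<close> agrees with \<open>H ?n\<close> at both
        points, so the Lipschitz bound is inherited without any limit.\<close>
      let ?n = "max (Suc (k x)) (Suc (k y))"
      have "h x = H ?n x" "h y = H ?n y" by (rule h_eq[OF k]; simp)+
      then show "ennreal \<bar>h x - h y\<bar> \<le> ennreal L' * finsler_dist A F x y"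
        using finsler_lipschitz_mono[OF lip M(3), of ?n] by (simp add: finsler_lipschitz_def)
    qed
    fix x
    have "H 0 = g" using s(1)[of 0] by (simp add: P_def H_def)
    moreover have "\<epsilon> * (1 - 1 / 2 ^ Suc (k x)) \<le> \<epsilon> * 1" using \<epsilon> by (intro mult_left_mono) auto
    ultimately show "\<bar>h x - g x\<bar> \<le> \<epsilon>" using close[of "Suc (k x)" x] by (simp add: h_def)
  qed
qed

text \<open>McShane's formula, with a minimum as \<open>X\<close> is finite. It rests on the
  distance of \<open>F\<close> being symmetric, zero on the diagonal and subject to the triangle
  inequality; \<open>below\<close> makes it real-valued.\<close>

lemma finite_lipschitz_extension:
  assumes X: "finite X" "X \<noteq> {}" and L: "0 \<le> L"
    and f: "\<And>x y. x \<in> X \<Longrightarrow> y \<in> X \<Longrightarrow> ennreal \<bar>f x - f y\<bar> \<le> ennreal L * finsler_dist A F x y"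
  obtains g where "finsler_lipschitz L g" "\<And>x. x \<in> X \<Longrightarrow> g x = f x"
proof -
  interpret Metric_space UNIV d by (rule metric)
  define D where "D x y = enn2real (finsler_dist A F x y)" for x y
  have fin: "finsler_dist A F x y < top" for x y
    using below[of x y] by (rule order.strict_trans1) simp
  have D: "finsler_dist A F x y = ennreal (D x y)" for x y using fin by (simp add: D_def)
  have Dnn: "0 \<le> D x y" for x y by (simp add: D_def)
  have Dtri: "D x z \<le> D x y + D y z" for x y z
    using finsler_dist_triangle[of x z y] Dnn by (simp add: D flip: ennreal_plus)
  have Dsym: "D x y \<le> D y x" for x y
    using finsler_dist_commute_le[of x y] Dnn by (simp add: D)
  have D0: "D x x = 0" for x
    using below[of x x] Dnn[of x x] by (simp add: D)
  have fD: "\<bar>f x - f y\<bar> \<le> L * D x y" if "x \<in> X" "y \<in> X" for x y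
    using f[OF that] L Dnn[of x y] by (simp add: D flip: ennreal_mult')
  define g where "g x = Min ((\<lambda>y. f y + L * D y x) ` X)" for x
  have step: "g y \<le> g x + L * D x y" for x y
  proof -
    have "g x \<in> (\<lambda>y. f y + L * D y x) ` X" unfolding g_def using X by (intro Min_in) auto
    then obtain z where z: "z \<in> X" "g x = f z + L * D z x" by auto
    have "g y \<le> f z + L * D z y" unfolding g_def using X z by (intro Min_le) auto
    also have "\<dots> \<le> f z + L * (D z x + D x y)" using L Dtri by (intro add_left_mono mult_left_mono)
    finally show ?thesis using z by (simp add: distrib_left)
  qed
  show thesis
  proof (rule that)
    show "finsler_lipschitz L g"
      unfolding finsler_lipschitz_def
    proof (intro allI)
      fix x y
      have "L * D y x \<le> L * D x y" using L Dsym by (intro mult_left_mono)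
      then have "\<bar>g x - g y\<bar> \<le> L * D x y" using step[of x y] step[of y x] by (simp add: abs_le_iff)
      then show "ennreal \<bar>g x - g y\<bar> \<le> ennreal L * finsler_dist A F x y"
        using L by (simp add: D ennreal_leI flip: ennreal_mult')
    qed
    fix x assume x: "x \<in> X"
    show "g x = f x"
      unfolding g_def
    proof (rule Min_eqI)
      show "f x \<in> (\<lambda>y. f y + L * D y x) ` X" using x D0 by (intro image_eqI[of _ _ x]) auto
      fix b assume "b \<in> (\<lambda>y. f y + L * D y x) ` X"
      then obtain y where y: "y \<in> X" "b = f y + L * D y x" by auto
      have "f x \<le> f y + L * D y x" using fD[OF y(1) x] by (simp add: abs_le_iff)
      then show "f x \<le> b" using y by simp
    qed (use X in simp)
  qed
qed

end

text \<open>The factor \<open>1 - \<tau>\<close> put on \<open>f\<close> pays for two losses: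
  \<open>\<kappa>\<close> for replacing \<open>d\<close> by the distance of \<open>F i\<close> on
  \<open>X\<close>, and \<open>1 - \<tau> / 2\<close> for the strict inequality
  \<open>L1 < L\<close> that smoothing demands.\<close>

lemma smooth_lipschitz_interpolation:
  fixes A :: "('a::{t2_space, second_countable_topology}, 'e::euclidean_space) chart set"
    and d :: "'a \<Rightarrow> 'a \<Rightarrow> real"
  assumes atlas: "smooth_atlas A" and metric: "Metric_space UNIV d"
    and topology: "Metric_space.mtopology UNIV d = euclidean"
    and finsler: "\<And>i. finsler_metric A (F i)"
    and below: "\<And>i x y. finsler_dist A (F i) x y \<le> ennreal (d x y)"
    and lim: "\<And>x y. (\<lambda>i. finsler_dist A (F i) x y) \<longlonglongrightarrow> ennreal (d x y)"
    and f: "\<And>x y. \<bar>f x - f y\<bar> \<le> L * d x y" and L: "0 < L"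
    and X: "finite X" "X \<noteq> {}" and \<epsilon>: "0 < \<epsilon>"
  obtains h where "h \<in> smooth_functions A" "\<And>x y. \<bar>h x - h y\<bar> \<le> L * d x y"
    "\<And>x. x \<in> X \<Longrightarrow> \<bar>h x - f x\<bar> \<le> \<epsilon>"
proof -
  interpret Metric_space UNIV d by (rule metric)
  \<comment> \<open>A bound for \<open>f\<close> on \<open>X\<close>, where the shrinking must cost
    little; the summand 1 makes it positive.\<close>
  define B where "B = Max ((\<lambda>x. \<bar>f x\<bar>) ` X) + 1"
  have fB: "\<bar>f x\<bar> \<le> B" if "x \<in> X" for x
  proof -
    have "\<bar>f x\<bar> \<le> Max ((\<lambda>x. \<bar>f x\<bar>) ` X)" using X that by (intro Max_ge) auto
    then show ?thesis unfolding B_def by linarith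
  qed
  have B: "0 < B"
  proof -
    obtain x where "x \<in> X" using X by auto
    then have "\<bar>f x\<bar> \<le> Max ((\<lambda>x. \<bar>f x\<bar>) ` X)" using X by (intro Max_ge) auto
    then show ?thesis unfolding B_def by linarith
  qed
  \<comment> \<open>Half of \<open>\<epsilon>\<close> is spent on shrinking \<open>f\<close> and
    half on smoothing; the \<open>1/2\<close> keeps \<open>\<tau> < 1\<close>.\<close>
  define \<tau> where "\<tau> = min (1/2) (\<epsilon> / (2 * B))"
  have \<tau>: "0 < \<tau>" "\<tau> < 1" using \<epsilon> B by (auto simp: \<tau>_def)
  have \<tau>B: "\<tau> * B \<le> \<epsilon> / 2"
  proof -
    have "\<tau> * B \<le> \<epsilon> / (2 * B) * B" using B by (intro mult_right_mono) (auto simp: \<tau>_def)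
    then show ?thesis using B by simp
  qed
  define \<kappa> where "\<kappa> = (1 - \<tau>) / (1 - \<tau> / 2)"
  have \<kappa>: "\<kappa> < 1" "0 < \<kappa>" "(1 - \<tau> / 2) * \<kappa> = 1 - \<tau>" using \<tau> by (simp_all add: \<kappa>_def)
  have "\<forall>\<^sub>F i in sequentially. \<forall>x\<in>X. \<forall>y\<in>X. ennreal (\<kappa> * d x y) \<le> finsler_dist A (F i) x y"
  \<comment> \<open>Finiteness of \<open>X\<close> turns pointwise convergence into one index good
    for all pairs. As \<open>\<kappa> < 1\<close>, the target is strictly below \<open>d x y\<close>
    whenever \<open>x \<noteq> y\<close>.\<close>
  proof (intro eventually_ball_finite ballI X(1))
    fix x y
    show "\<forall>\<^sub>F i in sequentially. ennreal (\<kappa> * d x y) \<le> finsler_dist A (F i) x y"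
    proof (cases "x = y")
      case False
      then have "0 < d x y" by simp
      then have "\<kappa> * d x y < d x y" using \<kappa>(1) by simp
      then have "ennreal (\<kappa> * d x y) < ennreal (d x y)" using \<kappa>(2) by (intro ennreal_lessI) auto
      from order_tendstoD(1)[OF lim this] show ?thesis by (rule eventually_mono) simp
    qed simp
  qed
  then obtain i where i: "\<And>x y. x \<in> X \<Longrightarrow> y \<in> X \<Longrightarrow> ennreal (\<kappa> * d x y) \<le> finsler_dist A (F i) x y"
    by (auto simp: eventually_sequentially)
  interpret finsler_below_metric A "F i" d
    by unfold_locales (use assms in auto)
  define L1 where "L1 = (1 - \<tau> / 2) * L"
  have L1: "0 \<le> L1" "L1 < L" using L \<tau> by (auto simp: L1_def)
  obtain g where g: "finsler_lipschitz L1 g" "\<And>x. x \<in> X \<Longrightarrow> g x = (1 - \<tau>) * f x"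
  proof (rule finite_lipschitz_extension[OF X L1(1), of "\<lambda>x. (1 - \<tau>) * f x"])
    fix x y assume xy: "x \<in> X" "y \<in> X"
    have "\<bar>(1 - \<tau>) * f x - (1 - \<tau>) * f y\<bar> = (1 - \<tau>) * \<bar>f x - f y\<bar>"
      using \<tau> by (simp add: abs_mult flip: right_diff_distrib)
    also have "\<dots> \<le> (1 - \<tau>) * (L * d x y)" using f \<tau> by (intro mult_left_mono) auto
    also have "\<dots> = L1 * (\<kappa> * d x y)" unfolding L1_def \<kappa>(3)[symmetric] by simp
    finally have "ennreal \<bar>(1 - \<tau>) * f x - (1 - \<tau>) * f y\<bar> \<le> ennreal L1 * ennreal (\<kappa> * d x y)"
      using L1 by (simp add: ennreal_leI flip: ennreal_mult')
    also have "\<dots> \<le> ennreal L1 * finsler_dist A (F i) x y" by (rule mult_left_mono[OF i[OF xy]]) simp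
    finally show "ennreal \<bar>(1 - \<tau>) * f x - (1 - \<tau>) * f y\<bar> \<le> ennreal L1 * finsler_dist A (F i) x y" .
  qed blast
  have \<epsilon>2: "0 < \<epsilon> / 2" using \<epsilon> by simp
  obtain h where h: "h \<in> smooth_functions A" "finsler_lipschitz L h" "\<And>x. \<bar>h x - g x\<bar> \<le> \<epsilon> / 2"
    by (rule smooth_approximation[OF g(1) L1 \<epsilon>2]) blast
  show thesis
  proof (rule that[OF h(1)])
    show "\<bar>h x - h y\<bar> \<le> L * d x y" for x y
      using finsler_lipschitz_imp_d[OF h(2)] L by simp
    fix x assume x: "x \<in> X"
    have "\<bar>\<tau> * f x\<bar> \<le> \<tau> * B" using fB[OF x] \<tau> by (simp add: abs_mult)
    moreover have "h x - f x = (h x - g x) - \<tau> * f x" using g(2)[OF x] by (simp add: algebra_simps)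
    ultimately show "\<bar>h x - f x\<bar> \<le> \<epsilon>" using h(3)[of x] \<tau>B by linarith
  qed
qed

text \<open>The \<open>n\<close>-th approximant is within \<open>1 / (n + 1)\<close> of
  \<open>f\<close> at the first \<open>n + 1\<close> points of a dense sequence. The common constant
  \<open>L\<close> bounds the suprema and carries this closeness over to compact sets.\<close>

theorem theoremA1:
  fixes A :: "('a::{t2_space, second_countable_topology}, 'e::euclidean_space) chart set"
    and d :: "'a \<Rightarrow> 'a \<Rightarrow> real"
    and F :: "nat \<Rightarrow> 'a \<Rightarrow> ('a, 'e) tvec \<Rightarrow> real"
    and f :: "'a \<Rightarrow> real"
  assumes "smooth_atlas A"
    and "Metric_space UNIV d"
    and "Metric_space.mtopology UNIV d = euclidean"
    and "\<And>i. finsler_metric A (F i)"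
    and "\<And>x y. incseq (\<lambda>i. finsler_dist A (F i) x y)"
    and "\<And>x y. (\<lambda>i. finsler_dist A (F i) x y) \<longlonglongrightarrow> ennreal (d x y)"
    and "f \<in> LIP d"
  shows "\<exists>g :: nat \<Rightarrow> 'a \<Rightarrow> real.
           (\<forall>n. g n \<in> smooth_functions A \<inter> LIP d) \<and>
           (SUP n. lip_const d (g n)) \<le> lip_const d f \<and>
           (\<forall>K. compact K \<longrightarrow> uniform_limit K g f sequentially)"
proof -
  interpret Metric_space UNIV d by (rule assms(2))
  have below: "finsler_dist A (F i) x y \<le> ennreal (d x y)" for i x y
    by (rule incseq_le[OF assms(5,6)])
  have LIP_iff: "h \<in> LIP d \<longleftrightarrow> (\<exists>B. \<forall>x y. \<bar>h x - h y\<bar> \<le> B * d x y)" for h :: "'a \<Rightarrow> real"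
    by (simp add: LIP_def Lipschitz_continuous_map_def mspace_metric mdist_metric assms(2) dist_real_def)
  obtain B where B: "\<And>x y. \<bar>f x - f y\<bar> \<le> B * d x y" using assms(7) unfolding LIP_iff by blast
  have "lip_const d f \<le> ennreal B"
    unfolding lip_const_def using B
    by (intro SUP_least) (auto intro!: ennreal_leI simp: divide_le_eq)
  then have fin: "lip_const d f < top" by (rule order.strict_trans1) simp
  define L where "L = enn2real (lip_const d f)"
  have L: "lip_const d f = ennreal L" "0 \<le> L" using fin by (simp_all add: L_def)
  have f: "\<bar>f x - f y\<bar> \<le> L * d x y" for x y
  proof (cases "x = y")
    case False
    then have "ennreal (\<bar>f x - f y\<bar> / d x y) \<le> lip_const d f"
      unfolding lip_const_def by (intro SUP_upper2[of "(x, y)"]) auto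
    then have "\<bar>f x - f y\<bar> / d x y \<le> L" unfolding L(1) using L(2) by simp
    then show ?thesis using False by (simp add: divide_le_eq)
  qed simp
  have lip_le: "lip_const d h \<le> lip_const d f" if "\<And>x y. \<bar>h x - h y\<bar> \<le> L * d x y" for h
  proof -
    have "lip_const d h \<le> ennreal L"
      unfolding lip_const_def using that
      by (intro SUP_least) (auto intro!: ennreal_leI simp: divide_le_eq)
    then show ?thesis by (simp only: L(1))
  qed
  show ?thesis
  \<comment> \<open>With constant 0 there is no room below \<open>L\<close> for any loss, but then
    \<open>f\<close> is constant and thus smooth.\<close>
  proof (cases "L = 0")
    case True
    have "f = (\<lambda>_. f undefined)" using f[of _ undefined] by (auto simp: True)
    then have "f \<circ> inv_coord c = (\<lambda>_. f undefined)" for c :: "('a, 'e) chart" by (metis comp_apply)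
    then have "f \<in> smooth_functions A" by (simp add: smooth_functions_def smooth_on_def C_k_on_const)
    then show ?thesis using assms(7) by (intro exI[of _ "\<lambda>_. f"]) (auto intro: uniform_limit_const)
  next
    case False
    then have L0: "0 < L" using L(2) by simp
    obtain D :: "'a set" where D: "countable D" "\<And>U. open U \<Longrightarrow> U \<noteq> {} \<Longrightarrow> \<exists>x\<in>D. x \<in> U"
      using countable_dense_exists by blast
    have Dne: "D \<noteq> {}" using D(2)[of UNIV] by auto
    define p where "p = from_nat_into D"
    have p: "range p = D" unfolding p_def by (rule range_from_nat_into[OF Dne D(1)])
    have "\<exists>h. h \<in> smooth_functions A \<and> (\<forall>x y. \<bar>h x - h y\<bar> \<le> L * d x y) \<and>
        (\<forall>x\<in>p ` {..n}. \<bar>h x - f x\<bar> \<le> inverse (real (Suc n)))" for n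
    proof -
      have X: "finite (p ` {..n})" "p ` {..n} \<noteq> {}" "0 < inverse (real (Suc n))" by auto
      show ?thesis
        by (rule smooth_lipschitz_interpolation[OF assms(1-4) below assms(6) f L0 X]) blast
    qed
    then obtain g where g: "\<And>n. g n \<in> smooth_functions A" "\<And>n x y. \<bar>g n x - g n y\<bar> \<le> L * d x y"
      "\<And>n x. x \<in> p ` {..n} \<Longrightarrow> \<bar>g n x - f x\<bar> \<le> inverse (real (Suc n))"
      by metis
    have unif: "uniform_limit K g f sequentially" if K: "compact K" for K
    proof (rule uniform_limitI)
      fix e :: real assume e: "0 < e"
      \<comment> \<open>One third of \<open>e\<close> each for moving \<open>f\<close> and
        \<open>g n\<close> from \<open>x\<close> to a nearby \<open>p j\<close>, and one third for
        their difference at \<open>p j\<close>.\<close>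
      define r where "r = e / (3 * L)"
      have r: "0 < r" using e L0 by (simp add: r_def)
      have op: "open (mball x r)" for x using openin_mball[of x r] by (simp add: assms(3))
      have cover: "K \<subseteq> (\<Union>j\<in>UNIV. mball (p j) r)"
      proof
        fix x
        have "x \<in> mball x r" using r by simp
        then obtain y where "y \<in> D" "y \<in> mball x r" using D(2)[OF op, of x] by blast
        then obtain j where "y = p j" using p by blast
        then have "x \<in> mball (p j) r" using \<open>y \<in> mball x r\<close> by (simp add: commute)
        then show "x \<in> (\<Union>j\<in>UNIV. mball (p j) r)" by blast
      qed
      obtain J where J: "J \<subseteq> UNIV" "finite J" "K \<subseteq> (\<Union>j\<in>J. mball (p j) r)"
        by (rule compactE_image[OF K op cover])
      obtain N0 where N0: "\<And>j. j \<in> J \<Longrightarrow> j \<le> N0"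
        using finite_nat_set_iff_bounded_le[THEN iffD1, OF J(2)] by blast
      obtain N1 where N1: "inverse (real (Suc N1)) < e / 3"
        using reals_Archimedean[of "e / 3"] e by auto
      show "\<forall>\<^sub>F n in sequentially. \<forall>x\<in>K. dist (g n x) (f x) < e"
      \<comment> \<open>Beyond \<open>N0\<close> all centres of the finite subcover are among the
        interpolation points; beyond \<open>N1\<close> the tolerance there is below
        \<open>e / 3\<close>.\<close>
      proof (rule eventually_sequentiallyI[of "max N0 N1"], rule ballI)
        fix n x assume n: "max N0 N1 \<le> n" and x: "x \<in> K"
        obtain j where j: "j \<in> J" "d (p j) x < r" using J(3) x by auto
        have "j \<le> n" using N0[OF j(1)] n by simp
        then have 1: "\<bar>g n (p j) - f (p j)\<bar> \<le> inverse (real (Suc n))" by (intro g(3)) auto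
        have "inverse (real (Suc n)) \<le> inverse (real (Suc N1))" using n by (intro le_imp_inverse_le) auto
        then have 2: "inverse (real (Suc n)) < e / 3" using N1 by linarith
        have "L * d (p j) x < L * r" using j(2) L0 by simp
        also have "\<dots> = e / 3" using L0 by (simp add: r_def)
        finally have 3: "L * d (p j) x < e / 3" .
        show "dist (g n x) (f x) < e"
          unfolding dist_real_def using 1 2 3 g(2)[of n "p j" x] f[of "p j" x] by linarith
      qed
    qed
    have sup: "(SUP n. lip_const d (g n)) \<le> lip_const d f"
      by (intro SUP_least lip_le g(2))
    have "g n \<in> LIP d" for n unfolding LIP_iff using g(2) by blast
    then show ?thesis by (intro exI[of _ g] conjI allI impI IntI g(1) sup unif)
  qed
qed

end
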